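(* Assume the Riemann Hypothesis. Let $a<c$ and $k$ be positive integers, and let $\varepsilon>0$. Then for all $x\ge2$ and all $y$ with $1\le y<x^{1/c}$, $$\Delta_k(a;c;x)=-\sum_{l\le y}\mu_k(l)\,\psi\!\left(\Big(\frac{x}{l^c}\Big)^{1/a}\right)+O\!\left(x^{\frac1{2a}+\varepsilon}y^{\frac12-\frac{c}{2a}}+y^{\frac12+\varepsilon}\right).$$
   Context: $\psi(t)=\{t\}-\frac12$, where $\{t\}$ is the fractional part of $t$. $\zeta$ is the Riemann zeta-function and $\mu_k$ is defined by $\sum_{n\ge1}\mu_k(n)n^{-s}=\zeta(s)^{-k}$ for $\Re s>1$ (so $\mu_1=\mu$ is the Möbius function). For positive integers $a<c$ put $u_k(a;c;n)=\sum_{l^ad^c=n}\mu_k(d)$ (sum over positive integers $l,d$), so that $\sum_n u_k(a;c;n)n^{-s}=\zeta(as)/\zeta^k(cs)$ for $\Re s>1$, and $$\Delta_k(a;c;x)=\sum_{n\le x}u_k(a;c;n)-\frac{x^{1/a}}{\zeta^k(c/a)}.$$ Implied constants depend only on $a,c,k,\varepsilon$. *)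

theory Defs
  imports
    "HOL-Complex_Analysis.Complex_Analysis"
    "HOL-Computational_Algebra.Squarefree"
begin

lemma holomorphic_series_aux:
  fixes F :: "nat \<Rightarrow> complex \<Rightarrow> complex" and \<sigma> :: real
  assumes hol: "\<And>n. F n holomorphic_on {s. Re s > \<sigma>}"
  assumes bd: "\<And>B \<delta>. \<delta> > 0 \<Longrightarrow> \<exists>C. \<forall>n s. Re s \<ge> \<sigma> + \<delta> \<and> norm s \<le> B \<longrightarrow>
                  norm (F n s) \<le> C * real (Suc n) powr (- 1 - \<delta>)"
  shows "(\<lambda>s. \<Sum>n. F n s) holomorphic_on {s. Re s > \<sigma>}"
    and "Re s > \<sigma> \<Longrightarrow> summable (\<lambda>n. F n s)"
proof -
  have sm: "summable (\<lambda>n. C * real (Suc n) powr (- 1 - \<delta>))" if "\<delta> > 0" for C \<delta> :: real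
  proof -
    have "summable (\<lambda>n. real n powr (- 1 - \<delta>))"
      using that by (subst summable_real_powr_iff) auto
    then show ?thesis
      by (intro summable_mult) (subst summable_Suc_iff)
  qed
  show "(\<lambda>s. \<Sum>n. F n s) holomorphic_on {s. Re s > \<sigma>}"
  proof (rule holomorphic_uniform_sequence)
    show "open {s. Re s > \<sigma>}" by (rule open_halfspace_Re_gt)
    show "(\<lambda>s. \<Sum>i<n. F i s) holomorphic_on {s. Re s > \<sigma>}" for n
      by (intro holomorphic_on_sum hol)
  next
    fix s :: complex assume s: "s \<in> {s. Re s > \<sigma>}"
    define \<delta> where "\<delta> = (Re s - \<sigma>) / 2"
    have \<delta>: "\<delta> > 0" using s by (simp add: \<delta>_def)
    have re: "Re w \<ge> \<sigma> + \<delta>" if "w \<in> cball s \<delta>" for w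
    proof -
      have "\<bar>Re (s - w)\<bar> \<le> \<delta>"
        using that abs_Re_le_cmod[of "s - w"] by (simp add: dist_norm)
      moreover have "\<sigma> + \<delta> = Re s - \<delta>"
        by (simp add: \<delta>_def field_simps)
      ultimately show ?thesis by (simp add: abs_le_iff)
    qed
    have nm: "norm w \<le> norm s + \<delta>" if "w \<in> cball s \<delta>" for w
      using that norm_triangle_ineq4[of s "s - w"] by (simp add: dist_norm)
    obtain C where C: "\<And>n w. Re w \<ge> \<sigma> + \<delta> \<Longrightarrow> norm w \<le> norm s + \<delta> \<Longrightarrow>
                  norm (F n w) \<le> C * real (Suc n) powr (- 1 - \<delta>)"
      using bd[OF \<delta>, of "norm s + \<delta>"] by blast
    have "uniform_limit (cball s \<delta>) (\<lambda>n w. \<Sum>i<n. F i w) (\<lambda>w. \<Sum>i. F i w) sequentially"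
      by (rule Weierstrass_m_test[OF _ sm[OF \<delta>, of C]]) (intro C re nm)
    moreover have "cball s \<delta> \<subseteq> {s. Re s > \<sigma>}"
      using re \<delta> by fastforce
    ultimately show "\<exists>d>0. cball s d \<subseteq> {s. Re s > \<sigma>} \<and>
        uniform_limit (cball s d) (\<lambda>n w. \<Sum>i<n. F i w) (\<lambda>w. \<Sum>i. F i w) sequentially"
      using \<delta> by blast
  qed
  show "summable (\<lambda>n. F n s)" if "Re s > \<sigma>"
  proof -
    define \<delta> where "\<delta> = Re s - \<sigma>"
    have \<delta>: "\<delta> > 0" using that by (simp add: \<delta>_def)
    obtain C where "\<And>n w. Re w \<ge> \<sigma> + \<delta> \<Longrightarrow> norm w \<le> norm s \<Longrightarrow>
                  norm (F n w) \<le> C * real (Suc n) powr (- 1 - \<delta>)"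
      using bd[OF \<delta>, of "norm s"] by blast
    then have "norm (F n s) \<le> C * real (Suc n) powr (- 1 - \<delta>)" for n
      by (simp add: \<delta>_def)
    then show ?thesis
      by (intro summable_comparison_test'[OF sm[OF \<delta>, of C], of 0])
  qed
qed

lemma norm_of_nat_powr: "norm (of_nat (Suc n) powr (s :: complex)) = real (Suc n) powr Re s"
  by (subst norm_powr_real_powr) (auto simp: Reals_of_nat simp del: of_nat_Suc)

lemma zeta_base_aux:
  shows "(\<lambda>s. \<Sum>n. of_nat (Suc n) powr (- s)) holomorphic_on {s. Re s > 1}"
    and "Re s > 1 \<Longrightarrow> summable (\<lambda>n. of_nat (Suc n) powr (- s) :: complex)"
proof -
  have 1: "(\<lambda>s. of_nat (Suc n) powr (- s)) holomorphic_on {s. Re s > 1}" for n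
    by (intro holomorphic_intros) (auto simp del: of_nat_Suc)
  have 2: "\<exists>C. \<forall>n s. Re s \<ge> 1 + \<delta> \<and> norm s \<le> B \<longrightarrow>
      norm (of_nat (Suc n) powr (- s)) \<le> C * real (Suc n) powr (- 1 - \<delta>)"
    if "\<delta> > 0" for B \<delta> :: real
    by (rule exI[of _ 1]) (auto simp: norm_of_nat_powr simp del: of_nat_Suc intro!: powr_mono)
  show "(\<lambda>s. \<Sum>n. of_nat (Suc n) powr (- s)) holomorphic_on {s. Re s > 1}"
    and "Re s > 1 \<Longrightarrow> summable (\<lambda>n. of_nat (Suc n) powr (- s) :: complex)"
    using holomorphic_series_aux[OF 1 2] by blast+
qed

lemma holomorphic_gbinomial_aux: "(\<lambda>s. (1 - s) gchoose k) holomorphic_on A"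
  unfolding gbinomial_prod_rev by (intro holomorphic_intros) auto

text \<open>
  Expanding \<open>(n + 1)\<close> to the power \<open>1 - s\<close> around \<open>n\<close> and summing over \<open>n \<ge> 1\<close> expresses
  \<open>(s - 1) \<zeta>(s)\<close> through \<open>\<zeta>(s + 1), \<zeta>(s + 2), \<dots>\<close> and a remainder that converges further to the
  left; iterating this continues zeta to the whole plane.
\<close>

definition taylor_rem :: "nat \<Rightarrow> nat \<Rightarrow> complex \<Rightarrow> complex" where
  "taylor_rem K n s = of_nat (Suc (Suc n)) powr (1 - s) -
     (\<Sum>k\<le>K. ((1 - s) gchoose k) * of_nat (Suc n) powr (1 - s - of_nat k))"

lemma taylor_rem_bound:
  assumes "\<delta> > 0"
  shows "\<exists>C. \<forall>n s. Re s \<ge> (1 - real K) + \<delta> \<and> norm s \<le> B \<longrightarrow>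
           norm (taylor_rem K n s) \<le> C * real (Suc n) powr (- 1 - \<delta>)"
proof -
  have "continuous_on (cball 0 B) (\<lambda>s::complex. (1 - s) gchoose (Suc K))"
    by (intro holomorphic_on_imp_continuous_on holomorphic_gbinomial_aux)
  then have "bounded ((\<lambda>s::complex. (1 - s) gchoose (Suc K)) ` cball 0 B)"
    by (intro compact_imp_bounded compact_continuous_image compact_cball)
  then obtain D where D: "\<And>s::complex. norm s \<le> B \<Longrightarrow> norm ((1 - s) gchoose (Suc K)) \<le> D"
    unfolding bounded_iff by (metis imageI mem_cball_0)
  have "norm (taylor_rem K n s) \<le> (D * fact (Suc K) / fact K) * real (Suc n) powr (- 1 - \<delta>)"
    if s: "Re s \<ge> (1 - real K) + \<delta>" "norm s \<le> B" for n s
  proof -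
    define N where "N = real (Suc n)"
    have N: "N \<ge> 1" by (simp add: N_def)
    define f where "f = (\<lambda>i (z::complex). fact i * ((1 - s) gchoose i) * z powr (1 - s - of_nat i))"
    define S where "S = closed_segment (complex_of_real N) (of_real (N + 1))"
    have S: "z \<in> \<real> \<and> Re z \<ge> N" if "z \<in> S" for z
      using that closed_segment_same_Im[of "complex_of_real N" "complex_of_real (N+1)"]
      unfolding S_def
      by (auto simp: closed_segment_of_real closed_segment_eq_real_ivl complex_is_Real_iff)
    have D0: "0 \<le> D" using D[OF s(2)] norm_ge_zero order_trans by blast
    have "norm (f 0 (of_real (N + 1)) -
             (\<Sum>i\<le>K. f i (of_real N) * (of_real (N + 1) - of_real N) ^ i / fact i)) \<le>
          (D * fact (Suc K) * N powr (- 1 - \<delta>)) * norm (of_real (N + 1) - of_real N :: complex) ^ Suc K / fact K"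
    proof (rule field_Taylor[where S = S])
      show "convex S" by (simp add: S_def)
      show "complex_of_real N \<in> S" "complex_of_real (N + 1) \<in> S"
        by (simp_all add: S_def)
    next
      fix i z assume z: "z \<in> S" "i \<le> K"
      have z0: "z \<notin> \<real>\<^sub>\<le>\<^sub>0"
        using S[OF z(1)] N by (auto simp: complex_nonpos_Reals_iff)
      have "(f i has_field_derivative
              fact i * ((1 - s) gchoose i) * ((1 - s - of_nat i) * z powr (1 - s - of_nat i - 1))) (at z within S)"
        unfolding f_def
        by (intro DERIV_cmult has_field_derivative_at_within[OF has_field_derivative_powr] z0)
      also have "fact i * ((1 - s) gchoose i) * ((1 - s - of_nat i) * z powr (1 - s - of_nat i - 1)) = f (Suc i) z"
        unfolding f_def gbinomial_mult_fact by (simp add: algebra_simps)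
      finally show "(f i has_field_derivative f (Suc i) z) (at z within S)" .
    next
      fix z assume z: "z \<in> S"
      have z': "z \<in> \<real>" "Re z \<ge> N" using S[OF z] by auto
      have "norm (z powr (1 - s - of_nat (Suc K))) = Re z powr (- Re s - real K)"
        using z' N by (subst norm_powr_real_powr) auto
      also have "\<dots> \<le> Re z powr (- 1 - \<delta>)"
        using z' N s(1) by (intro powr_mono) auto
      also have "\<dots> \<le> N powr (- 1 - \<delta>)"
        using z' N assms by (intro powr_mono2') auto
      finally have *: "norm (z powr (1 - s - of_nat (Suc K))) \<le> N powr (- 1 - \<delta>)" .
      have "norm (f (Suc K) z) = norm ((1 - s) gchoose (Suc K)) * fact (Suc K) * norm (z powr (1 - s - of_nat (Suc K)))"
        unfolding f_def by (simp only: norm_mult norm_fact mult_ac)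
      also have "\<dots> \<le> D * fact (Suc K) * N powr (- 1 - \<delta>)"
        using * D[OF s(2)] D0 by (intro mult_mono) auto
      finally show "norm (f (Suc K) z) \<le> D * fact (Suc K) * N powr (- 1 - \<delta>)" .
    qed
    moreover have "f 0 (of_real (N + 1)) -
             (\<Sum>i\<le>K. f i (of_real N) * (of_real (N + 1) - of_real N) ^ i / fact i) = taylor_rem K n s"
      by (simp add: f_def taylor_rem_def N_def add_ac)
    ultimately show ?thesis
      by (simp add: N_def field_simps del: fact_Suc)
  qed
  then show ?thesis by blast
qed

lemma taylor_rem_series:
  shows "(\<lambda>s. \<Sum>n. taylor_rem K n s) holomorphic_on {s. Re s > 1 - real K}"
    and "Re s > 1 - real K \<Longrightarrow> summable (\<lambda>n. taylor_rem K n s)"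
proof -
  have 1: "taylor_rem K n holomorphic_on {s. Re s > 1 - real K}" for n
    unfolding taylor_rem_def
    by (intro holomorphic_intros holomorphic_gbinomial_aux) (auto simp del: of_nat_Suc)
  show "(\<lambda>s. \<Sum>n. taylor_rem K n s) holomorphic_on {s. Re s > 1 - real K}"
    and "Re s > 1 - real K \<Longrightarrow> summable (\<lambda>n. taylor_rem K n s)"
    using holomorphic_series_aux[OF 1 taylor_rem_bound] by blast+
qed

lemma taylor_rem_recurrence:
  fixes s :: complex
  defines "Z \<equiv> (\<lambda>s::complex. \<Sum>n. of_nat (Suc n) powr (- s))"
  assumes s: "Re s > 1"
  shows "(s - 1) * Z s = 1 + (\<Sum>j<m. ((1 - s) gchoose (j + 2)) * Z (s + of_nat j + 1)) +
           (\<Sum>n. taylor_rem (Suc m) n s)"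
proof -
  have Z: "(\<lambda>n. of_nat (Suc n) powr (- w)) sums Z w" if "Re w > 1" for w
    unfolding Z_def using zeta_base_aux(2)[OF that] by (rule summable_sums)
  have lim: "(\<lambda>n. of_nat (Suc n) powr (1 - s)) \<longlonglongrightarrow> 0"
  proof (rule tendsto_norm_zero_cancel)
    have "(\<lambda>n. real n powr Re (1 - s)) \<longlonglongrightarrow> 0"
      using s by (intro tendsto_neg_powr filterlim_real_sequentially) auto
    then show "(\<lambda>n. norm (of_nat (Suc n) powr (1 - s))) \<longlonglongrightarrow> 0"
      unfolding norm_of_nat_powr by (rule LIMSEQ_Suc)
  qed
  have tele: "(\<lambda>n. of_nat (Suc (Suc n)) powr (1 - s) - of_nat (Suc n) powr (1 - s)) sums (0 - 1)"
    using telescope_sums[OF lim] by simp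
  have A: "(\<lambda>n. ((1 - s) gchoose 1) * of_nat (Suc n) powr (- s)) sums ((1 - s) * Z s)"
    using sums_mult[OF Z[OF s], of "1 - s"] by simp
  have B: "(\<lambda>n. \<Sum>j<m. ((1 - s) gchoose (j + 2)) * of_nat (Suc n) powr (- (s + of_nat j + 1)))
             sums (\<Sum>j<m. ((1 - s) gchoose (j + 2)) * Z (s + of_nat j + 1))"
    using s by (intro sums_sum sums_mult Z) auto
  have eq: "taylor_rem (Suc m) n s =
      (of_nat (Suc (Suc n)) powr (1 - s) - of_nat (Suc n) powr (1 - s)) -
      ((1 - s) gchoose 1) * of_nat (Suc n) powr (- s) -
      (\<Sum>j<m. ((1 - s) gchoose (j + 2)) * of_nat (Suc n) powr (- (s + of_nat j + 1)))" for n
  proof -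
    have "(\<Sum>k\<le>Suc m. ((1 - s) gchoose k) * of_nat (Suc n) powr (1 - s - of_nat k)) =
       of_nat (Suc n) powr (1 - s) + ((1 - s) gchoose 1) * of_nat (Suc n) powr (- s) +
       (\<Sum>j<m. ((1 - s) gchoose (j + 2)) * of_nat (Suc n) powr (- (s + of_nat j + 1)))"
      by (subst lessThan_Suc_atMost[symmetric], simp only: sum.lessThan_Suc_shift)
         (simp add: algebra_simps)
    then show ?thesis by (simp add: taylor_rem_def)
  qed
  have "(\<lambda>n. taylor_rem (Suc m) n s) sums
      ((0 - 1) - (1 - s) * Z s - (\<Sum>j<m. ((1 - s) gchoose (j + 2)) * Z (s + of_nat j + 1)))"
    unfolding eq by (intro sums_diff tele A B)
  then have "(\<Sum>n. taylor_rem (Suc m) n s) =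
      (0 - 1) - (1 - s) * Z s - (\<Sum>j<m. ((1 - s) gchoose (j + 2)) * Z (s + of_nat j + 1))"
    by (rule sums_unique[symmetric])
  then show ?thesis by (simp add: algebra_simps)
qed

lemma zeta_continuation_halfplane:
  "\<exists>g. g holomorphic_on {s. Re s > 1 - real m} \<and>
       (\<forall>s. Re s > 1 \<longrightarrow> g s = (s - 1) * (\<Sum>n. of_nat (Suc n) powr (- s)))"
proof (induction m)
  case 0
  show ?case
    by (rule exI[of _ "\<lambda>s. (s - 1) * (\<Sum>n. of_nat (Suc n) powr (- s))"])
       (use zeta_base_aux(1) in \<open>auto intro!: holomorphic_intros\<close>)
next
  case (Suc m)
  define Z where "Z = (\<lambda>s::complex. \<Sum>n. of_nat (Suc n) powr (- s))"
  from Suc obtain g where g: "g holomorphic_on {s. Re s > 1 - real m}"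
    and gZ: "\<And>s. Re s > 1 \<Longrightarrow> g s = (s - 1) * Z s"
    unfolding Z_def by blast
  define h where "h = (\<lambda>s. 1 - (\<Sum>j<m. ((1 - s) gchoose (j + 1)) / of_nat (j + 2) * g (s + of_nat j + 1)) +
                       (\<Sum>n. taylor_rem (Suc m) n s))"
  have "(\<lambda>s. g (s + of_nat j + 1)) holomorphic_on {s. Re s > 1 - real (Suc m)}" for j
  proof -
    have "(g \<circ> (\<lambda>s. s + of_nat j + 1)) holomorphic_on {s. Re s > 1 - real (Suc m)}"
      by (rule holomorphic_on_compose_gen[OF _ g]) (auto intro!: holomorphic_intros)
    then show ?thesis by (simp add: o_def)
  qed
  then have "h holomorphic_on {s. Re s > 1 - real (Suc m)}"
    unfolding h_def
    by (intro holomorphic_intros holomorphic_gbinomial_aux taylor_rem_series) auto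
  moreover have "h s = (s - 1) * Z s" if s: "Re s > 1" for s
  proof -
    have "((1 - s) gchoose (j + 2)) * Z (s + of_nat j + 1) =
          - (((1 - s) gchoose (j + 1)) / of_nat (j + 2) * g (s + of_nat j + 1))" for j
    proof -
      have c: "((1 - s) gchoose (j + 2)) = ((1 - s) gchoose (j + 1)) * (- (s + of_nat j)) / of_nat (j + 2)"
      proof -
        have "of_nat (j + 2) * ((1 - s) gchoose (j + 2)) = ((1 - s) gchoose (j + 1)) * (- (s + of_nat j))"
        proof -
          have "b * y = x * (- (s + a))" if "(1 - s) * x = (a + 1) * x + b * y" for a b x y :: complex
            using that by algebra
          from this[of _ "of_nat j"] show ?thesis
            using gbinomial_mult_1[of "1 - s" "j + 1"] by simp
        qed
        moreover have "of_nat (j + 2) \<noteq> (0 :: complex)"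
          by (simp only: of_nat_eq_0_iff)
        ultimately show ?thesis by (subst eq_divide_eq) (simp add: mult.commute)
      qed
      have gv: "g (s + of_nat j + 1) = (s + of_nat j) * Z (s + of_nat j + 1)"
        by (subst gZ) (use s in simp_all)
      have "(x * (- y) / b) * z = - (x / b * (y * z))" for x y z b :: complex by simp
      then show ?thesis unfolding c gv .
    qed
    then show ?thesis
      using taylor_rem_recurrence[OF s, of m] by (simp add: h_def Z_def sum_negf)
  qed
  ultimately show ?case unfolding Z_def by blast
qed

lemma zeta_continuation_exists:
  "\<exists>f. f holomorphic_on (- {1}) \<and>
       (\<forall>s. Re s > 1 \<longrightarrow> (\<lambda>n. 1 / of_nat (Suc n) powr s) sums f s)"
proof -
  define Z where "Z = (\<lambda>s::complex. \<Sum>n. of_nat (Suc n) powr (- s))"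
  define U where "U = (\<lambda>m. {s. Re s > 1 - real m})"
  have "\<forall>m. \<exists>g. g holomorphic_on U m \<and> (\<forall>s. Re s > 1 \<longrightarrow> g s = (s - 1) * Z s)"
    unfolding U_def Z_def using zeta_continuation_halfplane by blast
  then obtain G where G: "\<And>m. G m holomorphic_on U m"
    and GZ: "\<And>m s. Re s > 1 \<Longrightarrow> G m s = (s - 1) * Z s"
    by metis
  have agree: "G m s = G m' s" if "m \<le> m'" "s \<in> U m" for m m' s
  proof (rule analytic_continuation_open[where s = "{s. Re s > 1}" and s' = "U m" and f = "G m" and g = "G m'"])
    show "open {s. Re s > 1}" "open (U m)"
      unfolding U_def by (rule open_halfspace_Re_gt)+
    have "(2::complex) \<in> {s. Re s > 1}" by simp
    then show "{s. Re s > 1} \<noteq> ({} :: complex set)" by blast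
    show "connected (U m)"
      unfolding U_def by (intro convex_connected convex_halfspace_Re_gt)
    show "{s. Re s > 1} \<subseteq> U m" by (auto simp: U_def)
    show "G m holomorphic_on U m" by (rule G)
    show "G m' holomorphic_on U m"
      by (rule holomorphic_on_subset[OF G]) (use that in \<open>auto simp: U_def\<close>)
    show "G m z = G m' z" if "z \<in> {s. Re s > 1}" for z
      using that GZ by simp
    show "s \<in> U m" by fact
  qed
  define idx where "idx = (\<lambda>s. nat \<lceil>2 - Re s\<rceil>)"
  have idx: "s \<in> U (idx s)" for s unfolding U_def idx_def by simp linarith
  define g where "g = (\<lambda>s. G (idx s) s)"
  have gG: "g s = G m s" if "s \<in> U m" for s m
    unfolding g_def using agree[of m "idx s" s] agree[of "idx s" m s] idx[of s] that
    by (metis nle_le)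
  have "g holomorphic_on (\<Union>m. U m)"
  proof (rule holomorphic_on_UN_open)
    fix m
    have "g holomorphic_on U m \<longleftrightarrow> G m holomorphic_on U m"
      by (intro holomorphic_cong refl gG)
    then show "g holomorphic_on U m" using G by simp
    show "open (U m)" unfolding U_def by (rule open_halfspace_Re_gt)
  qed
  moreover have "- {1} \<subseteq> (\<Union>m. U m)" using idx by blast
  ultimately have "g holomorphic_on (- {1})"
    by (rule holomorphic_on_subset)
  then have "(\<lambda>s. g s / (s - 1)) holomorphic_on (- {1})"
    by (intro holomorphic_intros) auto
  moreover have "(\<lambda>n. 1 / of_nat (Suc n) powr s) sums (g s / (s - 1))" if "Re s > 1" for s
  proof -
    have "g s = (s - 1) * Z s"
      using gG[of s 0] GZ[OF that, of 0] that by (simp add: U_def)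
    moreover have "s \<noteq> 1" using that by auto
    ultimately have "g s / (s - 1) = Z s" by simp
    then show ?thesis
      using summable_sums[OF zeta_base_aux(2)[OF that]]
      by (simp add: Z_def powr_minus_divide del: of_nat_Suc)
  qed
  ultimately show ?thesis
    by (intro exI[of _ "\<lambda>s. g s / (s - 1)"]) auto
qed


text \<open>
  The Riemann zeta-function is the analytic continuation of its Dirichlet series to the plane
  punctured at \<open>1\<close>.  The value at the pole itself is left unspecified.
\<close>

definition zeta :: "complex \<Rightarrow> complex" where
  "zeta = (SOME f. f holomorphic_on (- {1}) \<and>
             (\<forall>s. Re s > 1 \<longrightarrow> (\<lambda>n. 1 / of_nat (Suc n) powr s) sums f s))"

lemma zeta_holomorphic: "zeta holomorphic_on (- {1})"
  and zeta_sums: "Re s > 1 \<Longrightarrow> (\<lambda>n. 1 / of_nat (Suc n) powr s) sums zeta s"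
  using someI_ex[OF zeta_continuation_exists, folded zeta_def] by blast+

definition Riemann_Hypothesis :: bool where
  "Riemann_Hypothesis \<longleftrightarrow>
     (\<forall>s. s \<noteq> 1 \<and> zeta s = 0 \<and> (\<nexists>n::nat. n > 0 \<and> s = - 2 * of_nat n) \<longrightarrow> Re s = 1 / 2)"

lemma zeta_has_sum:
  assumes "Re s > 1"
  shows "((\<lambda>n. of_nat n powr (- s)) has_sum zeta s) {0<..}"
proof -
  have "summable (\<lambda>n. norm (of_nat (Suc n) powr (- s)))"
  proof -
    have "summable (\<lambda>n. real n powr Re (- s))"
      using assms by (subst summable_real_powr_iff) auto
    then show ?thesis
      unfolding norm_of_nat_powr by (subst summable_Suc_iff)
  qed
  moreover have "(\<lambda>n. of_nat (Suc n) powr (- s)) sums zeta s"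
    using zeta_sums[OF assms] by (simp only: powr_minus_divide)
  ultimately have "((\<lambda>n. of_nat (Suc n) powr (- s)) has_sum zeta s) UNIV"
    by (rule norm_summable_imp_has_sum)
  moreover have "bij_betw Suc UNIV {0<..}"
    by (rule bij_betw_byWitness[of _ "\<lambda>n. n - 1"]) auto
  ultimately show ?thesis
    using has_sum_reindex_bij_betw[of Suc UNIV "{0<..}" "\<lambda>n. of_nat n powr (- s)"] by blast
qed

lemma dirichlet_convolution_has_sum:
  fixes f g :: "nat \<Rightarrow> real" and s :: complex
  assumes F: "((\<lambda>n. of_real (f n) * of_nat n powr (- s)) has_sum A) {0<..}"
    and G: "((\<lambda>n. of_real (g n) * of_nat n powr (- s)) has_sum B) {0<..}"
  shows "((\<lambda>n. of_real (\<Sum>d | d dvd n. f d * g (n div d)) * of_nat n powr (- s)) has_sum (A * B)) {0<..}"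
proof -
  define f' where "f' = (\<lambda>n. of_real (f n) * of_nat n powr (- s))"
  define g' where "g' = (\<lambda>n. of_real (g n) * of_nat n powr (- s))"
  define P where "P = (\<lambda>(m, n). f' m * g' n)"
  have F': "(f' has_sum A) {0<..}" and G': "(g' has_sum B) {0<..}"
    using F G by (simp_all add: f'_def g'_def)
  have sf: "(\<lambda>n. norm (f' n)) summable_on {0<..}"
    using F' summable_on_iff_abs_summable_on_complex[of f' "{0<..}"] by (auto simp: summable_on_def)
  have sg: "(\<lambda>n. norm (g' n)) summable_on {0<..}"
    using G' summable_on_iff_abs_summable_on_complex[of g' "{0<..}"] by (auto simp: summable_on_def)
  have "(\<lambda>x. norm (P x)) summable_on ({0<..} \<times> {0<..})"
    unfolding Infinite_Sum.abs_summable_on_Sigma_iff P_def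
    by (auto simp: norm_mult infsum_cmult_right sg abs_mult
             intro!: summable_on_cmult_right summable_on_cmult_left sf sg)
  then have "P summable_on ({0<..} \<times> {0<..})"
    by (rule abs_summable_summable)
  moreover have "((\<lambda>n. P (m, n)) has_sum (f' m * B)) {0<..}" for m
    using has_sum_cmult_right[OF G', of "f' m"] by (simp add: P_def)
  moreover have "((\<lambda>m. f' m * B) has_sum (A * B)) {0<..}"
    by (rule has_sum_cmult_left[OF F'])
  ultimately have "(P has_sum (A * B)) ({0<..} \<times> {0<..})"
    by (intro has_sum_SigmaI) auto
  moreover have "bij_betw (\<lambda>(n::nat, d). (d, n div d)) (SIGMA n:{0<..}. {d. d dvd n}) ({0<..} \<times> {0<..})"
    by (rule bij_betw_byWitness[of _ "\<lambda>(d, e). (d * e, d)"])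
       (auto simp: dvd_div_eq_0_iff dvd_pos_nat elim!: dvdE)
  ultimately have "((\<lambda>nd. P ((\<lambda>(n, d). (d, n div d)) nd)) has_sum (A * B)) (SIGMA n:{0<..}. {d. d dvd n})"
    using has_sum_reindex_bij_betw by blast
  then show ?thesis
  proof (rule has_sum_Sigma')
    fix n :: nat assume "n \<in> {0<..}"
    then have n: "n > 0" by simp
    have "(\<Sum>d | d dvd n. P (d, n div d)) = (\<Sum>d | d dvd n. of_real (f d * g (n div d)) * of_nat n powr (- s))"
    proof (rule sum.cong[OF refl])
      fix d assume "d \<in> {d. d dvd n}"
      then obtain e where e: "n = d * e" by auto
      then have "d > 0" "e > 0" using n by auto
      then show "P (d, n div d) = of_real (f d * g (n div d)) * of_nat n powr (- s)"
        by (simp add: P_def f'_def g'_def e powr_times_real mult_ac)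
    qed
    also have "\<dots> = of_real (\<Sum>d | d dvd n. f d * g (n div d)) * of_nat n powr (- s)"
      by (simp add: sum_distrib_right)
    finally have eq: "(\<Sum>d | d dvd n. P (d, n div d)) = \<dots>" .
    have "finite {d. d dvd n}" using n by simp
    from has_sum_finite[OF this, of "\<lambda>d. P (d, n div d)"]
    show "((\<lambda>d. P (case (n, d) of (n, d) \<Rightarrow> (d, n div d))) has_sum
            of_real (\<Sum>d | d dvd n. f d * g (n div d)) * of_nat n powr (- s)) {d. d dvd n}"
      by (simp only: prod.case eq)
  qed
qed

definition moebius_mu :: "nat \<Rightarrow> real" where
  "moebius_mu n = (if squarefree n then (- 1) ^ card (prime_factors n) else 0)"

lemma moebius_mu_1: "moebius_mu 1 = 1"
  by (simp add: moebius_mu_def del: One_nat_def)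

lemma sum_moebius_dvd:
  assumes n: "n > 0"
  shows "(\<Sum>d | d dvd n. moebius_mu d) = (if n = 1 then 1 else 0)"
proof -
  have fin: "finite {d. d dvd n}" using n by simp
  have X: "prime_factorization (\<Prod>X) = mset_set X" if "X \<subseteq> prime_factors n" for X
  proof -
    have "finite X" using that finite_subset by blast
    then have "\<Prod>X = prod_mset (mset_set X)"
      by (simp add: prod_unfold_prod_mset)
    also have "prime_factorization \<dots> = mset_set X"
      using that \<open>finite X\<close> by (intro prime_factorization_prod_mset_primes) auto
    finally show ?thesis .
  qed
  have "(\<Sum>d | d dvd n. moebius_mu d) = (\<Sum>d | d dvd n \<and> squarefree d. (- 1) ^ card (prime_factors d))"
    unfolding moebius_mu_def using fin by (subst sum.If_cases) (auto intro!: sum.cong)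
  also have "\<dots> = (\<Sum>X\<in>Pow (prime_factors n). (- 1) ^ card X)"
  proof (rule sum.reindex_bij_witness[of _ "\<lambda>X. \<Prod>X" prime_factors])
    fix d assume "d \<in> {d. d dvd n \<and> squarefree d}"
    then have d: "d dvd n" "squarefree d" "d \<noteq> 0" using n by auto
    have "(\<Prod>p \<in> prime_factors d. p ^ multiplicity p d) = (\<Prod>p \<in> prime_factors d. p)"
      using squarefree_factorial_semiring'[OF d(3)] d(2) by (intro prod.cong) auto
    then show "\<Prod>(prime_factors d) = d"
      using prod_prime_factors[OF d(3)] by simp
    show "prime_factors d \<in> Pow (prime_factors n)"
      using d n dvd_prime_factors by blast
  next
    fix X assume "X \<in> Pow (prime_factors n)"
    then have X': "X \<subseteq> prime_factors n" by simp
    then have fX: "finite X" using finite_subset by blast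
    show "prime_factors (\<Prod>X) = X"
      using X[OF X'] fX by simp
    have 0: "\<Prod>X \<noteq> 0"
      using X' fX by (auto dest: in_prime_factors_imp_prime)
    have "prime_factorization (\<Prod>X) \<subseteq># prime_factorization n"
      unfolding X[OF X']
      using subset_imp_msubset_mset_set[OF X'] mset_set_set_mset_msubset[of "prime_factorization n"]
      by (meson finite_set_mset subset_mset.order_trans)
    then have "\<Prod>X dvd n"
      using 0 n by (subst prime_factorization_subset_iff_dvd[symmetric]) auto
    moreover have "squarefree (\<Prod>X)"
      unfolding squarefree_factorial_semiring'[OF 0]
    proof
      fix p assume p: "p \<in> prime_factors (\<Prod>X)"
      then have "multiplicity p (\<Prod>X) = count (prime_factorization (\<Prod>X)) p"
        using count_prime_factorization_prime in_prime_factors_imp_prime by metis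
      also have "\<dots> = 1"
        using p fX unfolding X[OF X'] by simp
      finally show "multiplicity p (\<Prod>X) = 1" .
    qed
    ultimately show "\<Prod>X \<in> {d. d dvd n \<and> squarefree d}" by simp
  qed auto
  also have "\<dots> = (\<Prod>p\<in>prime_factors n. 1 - 1)"
    by (subst prod_diff_conv_sum) auto
  also have "\<dots> = (if n = 1 then 1 else 0)"
  proof (cases "n = 1")
    case False
    then obtain p where "prime p" "p dvd n"
      using prime_factor_nat by blast
    then have "p \<in> prime_factors n"
      using n by (simp add: prime_factors_dvd)
    then have "(\<Prod>p\<in>prime_factors n. 1 - 1 :: real) = 0"
      by (subst prod_zero_iff) auto
    with False show ?thesis by simp
  qed simp
  finally show ?thesis .
qed

lemma moebius_has_sum:
  assumes s: "Re s > 1"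
  shows "((\<lambda>n. of_real (moebius_mu n) * of_nat n powr (- s)) has_sum (1 / zeta s)) {0<..}"
proof -
  have "(\<lambda>n. of_nat n powr (- s)) summable_on {0<..}"
    using zeta_has_sum[OF s] by (auto simp: summable_on_def)
  then have "(\<lambda>n. norm (of_nat n powr (- s))) summable_on {0<..}"
    by (simp only: summable_on_iff_abs_summable_on_complex)
  then have "(\<lambda>n. norm (of_real (moebius_mu n) * of_nat n powr (- s))) summable_on {0<..}"
    by (rule Infinite_Sum.abs_summable_on_comparison_test') (simp add: moebius_mu_def norm_mult norm_power)
  then have "(\<lambda>n. of_real (moebius_mu n) * of_nat n powr (- s)) summable_on {0<..}"
    by (rule Infinite_Sum.abs_summable_summable)
  then obtain A where A: "((\<lambda>n. of_real (moebius_mu n) * of_nat n powr (- s)) has_sum A) {0<..}"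
    unfolding summable_on_def by blast
  have "((\<lambda>n. of_real 1 * of_nat n powr (- s)) has_sum zeta s) {0<..}"
    using zeta_has_sum[OF s] by simp
  from dirichlet_convolution_has_sum[OF A this]
  have "((\<lambda>n. of_real (\<Sum>d | d dvd n. moebius_mu d) * of_nat n powr (- s)) has_sum (A * zeta s)) {0<..}"
    by simp
  moreover have "((\<lambda>n. of_real (\<Sum>d | d dvd n. moebius_mu d) * of_nat n powr (- s)) has_sum 1) {0<..}"
  proof -
    have "((\<lambda>n. of_real (\<Sum>d | d dvd n. moebius_mu d) * of_nat n powr (- s)) has_sum 1) {0<..} \<longleftrightarrow>
          ((\<lambda>n. of_nat n powr (- s)) has_sum 1) {1::nat}"
      by (rule has_sum_cong_neutral) (auto simp: sum_moebius_dvd[unfolded One_nat_def] moebius_mu_1[unfolded One_nat_def]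
            simp del: of_real_sum)
    also have \<dots>
      using has_sum_finite[of "{1::nat}" "\<lambda>n. of_nat n powr (- s)"] by simp
    finally show ?thesis .
  qed
  ultimately have "A * zeta s = 1"
    by (rule has_sum_unique)
  then have "A = 1 / zeta s"
    by (metis eq_divide_eq mult_zero_right zero_neq_one)
  with A show ?thesis by simp
qed

lemma mu_exists:
  "\<exists>f :: nat \<Rightarrow> real. \<forall>s. Re s > 1 \<longrightarrow>
     ((\<lambda>n. of_real (f n) * of_nat n powr (- s)) has_sum (1 / zeta s ^ k)) {0<..}"
proof (induction k)
  case 0
  have "((\<lambda>n. of_real (if n = 1 then 1 else 0) * of_nat n powr (- s)) has_sum 1) {0<..}" for s :: complex
  proof -
    have "((\<lambda>n. of_real (if n = 1 then 1 else 0) * of_nat n powr (- s)) has_sum 1) {0<..} \<longleftrightarrow>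
          ((\<lambda>n. of_nat n powr (- s)) has_sum 1) {1::nat}"
      by (rule has_sum_cong_neutral) auto
    also have \<dots>
      using has_sum_finite[of "{1::nat}" "\<lambda>n. of_nat n powr (- s)"] by simp
    finally show ?thesis .
  qed
  then show ?case
    by (intro exI[of _ "\<lambda>n. if n = 1 then 1 else 0"]) simp
next
  case (Suc k)
  then obtain f :: "nat \<Rightarrow> real" where f: "\<And>s. Re s > 1 \<Longrightarrow>
     ((\<lambda>n. of_real (f n) * of_nat n powr (- s)) has_sum (1 / zeta s ^ k)) {0<..}"
    by blast
  show ?case
    using dirichlet_convolution_has_sum[OF moebius_has_sum f]
    by (intro exI[of _ "\<lambda>n. \<Sum>d | d dvd n. moebius_mu d * f (n div d)"]) auto
qed

lemma dirichlet_series_unique: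
  fixes f g :: "nat \<Rightarrow> real"
  assumes f: "\<And>s. Re s > 1 \<Longrightarrow> (\<lambda>n. complex_of_real (f n) / of_nat (Suc n) powr s) sums F s"
    and g: "\<And>s. Re s > 1 \<Longrightarrow> (\<lambda>n. complex_of_real (g n) / of_nat (Suc n) powr s) sums F s"
  shows "f = g"
proof (rule ccontr)
  assume "f \<noteq> g"
  define h where "h = (\<lambda>n. f n - g n)"
  define m where "m = (LEAST n. h n \<noteq> 0)"
  have "\<exists>n. h n \<noteq> 0" using \<open>f \<noteq> g\<close> by (auto simp: h_def)
  then have hm: "h m \<noteq> 0" unfolding m_def by (rule LeastI_ex)
  have hl: "h n = 0" if "n < m" for n
    using not_less_Least that unfolding m_def by blast
  have h: "(\<lambda>n. h n / real (Suc n) ^ t) sums 0" if "t \<ge> 2" for t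
  proof -
    have "(\<lambda>n. complex_of_real (h n / real (Suc n) ^ t)) sums of_real 0"
      using sums_diff[OF f[of "of_nat t"] g[of "of_nat t"]] that
      by (simp add: h_def powr_nat diff_divide_distrib del: of_nat_Suc)
    then show ?thesis by (simp only: sums_of_real_iff)
  qed
  have "Bseq (\<lambda>n. h n / real (Suc n) ^ 2)"
    using h[of 2] sums_summable summable_LIMSEQ_zero convergentI convergent_imp_Bseq by blast
  then obtain C where C: "\<And>n. \<bar>h n / real (Suc n) ^ 2\<bar> \<le> C" and C0: "C > 0"
    unfolding Bseq_def real_norm_def by blast
  define M where "M = real (Suc m)"
  define q where "q = M / (M + 1)"
  have M: "M \<ge> 1" by (simp add: M_def)
  have q: "0 < q" "q < 1" using M by (auto simp: q_def)
  define K where "K = (\<Sum>n. 1 / real (Suc (n + Suc m)) ^ 2)"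
  have "summable (\<lambda>n. 1 / real n ^ 2)"
    using inverse_power_summable[of 2, where 'a = real] by (simp add: field_simps)
  then have sK: "summable (\<lambda>n. 1 / real (Suc (n + Suc m)) ^ 2)"
    using summable_iff_shift[of "\<lambda>n. 1 / real n ^ 2" "Suc (Suc m)"] by simp
  have bound: "\<bar>h m\<bar> \<le> C * M ^ 4 * K * q ^ t" for t
  proof -
    define a where "a = (\<lambda>n. M ^ (t + 4) * (h n / real (Suc n) ^ (t + 4)))"
    have "a sums 0"
      unfolding a_def using sums_mult[OF h[of "t + 4"], of "M ^ (t + 4)"] by simp
    then have "(\<lambda>n. a (n + Suc m)) sums (0 - (\<Sum>i<Suc m. a i))"
      by (subst sums_iff_shift) simp
    moreover have "(\<Sum>i<Suc m. a i) = h m"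
      using M by (simp add: a_def hl M_def)
    ultimately have a: "(\<lambda>n. a (n + Suc m)) sums (- h m)" by (simp only: diff_0)
    have ab: "norm (a (n + Suc m)) \<le> C * M ^ 4 * q ^ t * (1 / real (Suc (n + Suc m)) ^ 2)" for n
    proof -
      define N where "N = real (Suc (n + Suc m))"
      have N: "N \<ge> M + 1" by (simp add: N_def M_def)
      have "a (n + Suc m) = M ^ (t + 4) * (h (n + Suc m) / N ^ (t + 4))"
        by (simp only: a_def N_def)
      then have "norm (a (n + Suc m)) = M ^ (t + 4) * (\<bar>h (n + Suc m)\<bar> / N ^ (t + 4))"
        using M N by (simp add: abs_mult)
      also have "\<dots> = \<bar>h (n + Suc m) / N ^ 2\<bar> * M ^ 4 * (M / N) ^ t * (1 / N ^ 2)"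
        using M N by (simp add: power_add power_divide power_numeral_reduce mult_ac)
      also have "\<dots> \<le> C * M ^ 4 * q ^ t * (1 / N ^ 2)"
        using M N C0 C[of "n + Suc m", folded N_def]
        by (intro mult_mono power_mono) (auto simp: q_def N_def[symmetric] intro!: divide_left_mono)
      finally show ?thesis by (simp add: N_def)
    qed
    have "\<bar>h m\<bar> = norm (\<Sum>n. a (n + Suc m))"
      using sums_unique[OF a] by simp
    also have "\<dots> \<le> (\<Sum>n. C * M ^ 4 * q ^ t * (1 / real (Suc (n + Suc m)) ^ 2))"
      by (rule norm_suminf_le[OF ab summable_mult[OF sK]])
    also have "\<dots> = C * M ^ 4 * q ^ t * K"
      unfolding K_def by (rule suminf_mult[OF sK])
    finally show ?thesis by (simp add: mult_ac)
  qed
  have "(\<lambda>t. C * M ^ 4 * K * q ^ t) \<longlonglongrightarrow> C * M ^ 4 * K * 0"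
    using q by (intro tendsto_mult_left LIMSEQ_power_zero) auto
  then have "\<bar>h m\<bar> \<le> C * M ^ 4 * K * 0"
    by (rule LIMSEQ_le_const) (use bound in blast)
  with hm show False by simp
qed

text \<open>
  The coefficients are determined by the Dirichlet series only for positive indices, hence the
  normalisation at \<open>0\<close>.
\<close>

definition mu :: "nat \<Rightarrow> nat \<Rightarrow> real" where
  "mu k = (THE f. f 0 = 0 \<and>
             (\<forall>s. Re s > 1 \<longrightarrow>
                (\<lambda>n. complex_of_real (f (Suc n)) / of_nat (Suc n) powr s) sums (1 / zeta s ^ k)))"

lemma mu_sums:
  assumes "Re s > 1"
  shows "(\<lambda>n. complex_of_real (mu k (Suc n)) / of_nat (Suc n) powr s) sums (1 / zeta s ^ k)"
proof -
  let ?P = "\<lambda>f. f 0 = 0 \<and> (\<forall>s. Re s > 1 \<longrightarrow>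
                (\<lambda>n. complex_of_real (f (Suc n)) / of_nat (Suc n) powr s) sums (1 / zeta s ^ k))"
  obtain f0 :: "nat \<Rightarrow> real" where f0: "\<And>s. Re s > 1 \<Longrightarrow>
     ((\<lambda>n. of_real (f0 n) * of_nat n powr (- s)) has_sum (1 / zeta s ^ k)) {0<..}"
    using mu_exists[of k] by blast
  define f where "f = (\<lambda>n. if n = 0 then 0 else f0 n)"
  have bij: "bij_betw Suc UNIV {0<..}"
    by (rule bij_betw_byWitness[of _ "\<lambda>n. n - 1"]) auto
  have "(\<lambda>n. complex_of_real (f (Suc n)) / of_nat (Suc n) powr s) sums (1 / zeta s ^ k)"
    if "Re s > 1" for s
  proof -
    have "((\<lambda>n. of_real (f0 (Suc n)) * of_nat (Suc n) powr (- s)) has_sum (1 / zeta s ^ k)) UNIV"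
      using f0[OF that]
        has_sum_reindex_bij_betw[OF bij, of "\<lambda>n. of_real (f0 n) * of_nat n powr (- s)"] by blast
    from has_sum_imp_sums[OF this] show ?thesis
      by (simp add: f_def powr_minus_divide del: of_nat_Suc)
  qed
  then have f: "?P f" by (simp add: f_def)
  have "\<exists>!f. ?P f"
  proof (rule ex1I[of ?P, OF f])
    fix g assume g: "?P g"
    have "(\<lambda>n. g (Suc n)) = (\<lambda>n. f (Suc n))"
      using f g by (intro dirichlet_series_unique) auto
    then have "g n = f n" for n
      using f g by (cases n) (auto dest: fun_cong)
    then show "g = f" by blast
  qed
  from theI'[OF this, folded mu_def] assms show ?thesis by blast
qed

definition sawtooth :: "real \<Rightarrow> real" where
  "sawtooth t = frac t - 1 / 2"

definition u_coeff :: "nat \<Rightarrow> nat \<Rightarrow> nat \<Rightarrow> nat \<Rightarrow> real" where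
  "u_coeff k a c n = (\<Sum>(l, d) \<in> {(l, d). l > 0 \<and> d > 0 \<and> l ^ a * d ^ c = n}. mu k d)"

text \<open>Taking the real part loses nothing, since zeta is real-valued on \<open>{1<..}\<close>.\<close>

definition Delta :: "nat \<Rightarrow> nat \<Rightarrow> nat \<Rightarrow> real \<Rightarrow> real" where
  "Delta k a c x =
     (\<Sum>n | n > 0 \<and> real n \<le> x. u_coeff k a c n) -
     x powr (1 / real a) / Re (zeta (of_real (real c / real a))) ^ k"

end

theory Submission
  imports Defs "HOL-Library.Nat_Bijection"
begin

text \<open>
  For \<open>l \<le> y\<close> the lattice points \<open>m\<^sup>a l\<^sup>c \<le> x\<close> are counted directly; this produces the sawtooth sum, and
  \<open>\<Sum>l\<le>y. \<mu>\<^sub>k(l)\<close>, which is small under the Riemann Hypothesis.  The part \<open>l > y\<close> is the summatory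
  function of the Dirichlet series \<open>\<zeta>(as) f\<^sub>y(cs)\<close> with \<open>f\<^sub>y(s) = \<zeta>(s)\<^sup>-\<^sup>k - \<Sum>l\<le>y. \<mu>\<^sub>k(l) l\<^sup>-\<^sup>s\<close>: by Perron's formula
  it is the residue \<open>x\<^sup>1\<^sup>/\<^sup>a f\<^sub>y(c/a)\<close> at \<open>s = 1/a\<close> plus an integral over a line just to the right of
  \<open>Re s = 1/(2a)\<close>.  There \<open>\<zeta>\<close> grows more slowly than any power of \<open>Im s\<close>, and so does \<open>f\<^sub>y\<close>, which in addition is
  of size about \<open>y\<close> to the power \<open>1/2 - Re s\<close>, by a second application of Perron's formula.

  Instead of \<open>X\<^sup>s\<close> the Perron integrals use a mean of \<open>u\<^sup>s\<close> over \<open>N \<le> u \<le> N + 1\<close>.  Since the summatory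
  function is constant on this interval, nothing is lost, and all integrals converge absolutely.
\<close>

section \<open>Integrals over vertical lines\<close>

text \<open>The two parts match because \<open>\<lfloor>t\<rfloor>\<close> is
  \<open>t - sawtooth t - 1 / 2\<close>. For l \<le> y the terms t add up to x^(1/a) times a partial
  sum of the series of 1/zeta^k at c/a; with the main term subtracted in \<open>Delta\<close> they
  leave -x^(1/a) f_y(c/a), to be cancelled by the Perron residue. The terms 1/2 produce the sum of
  the coefficients up to y. The kernel at w is at most a constant times N^(Re w + \<eta>)
  |w|^(-\<eta>) for every \<eta> in [0, 1], because the averaging interval has logarithmic length
  about 1/N. So the decay beyond 1/|w| that makes the integrals converge costs only N^\<delta>,
  which the \<epsilon> of the theorem allows. Growth of zeta and 1/zeta enters with exponents
  \<delta>/4 and uses up only part of this decay. The price of averaging is that the residue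
  contains a mean of u^(1/a) instead of x^(1/a). As 1/a \<le> 1 they differ by at most 1, and the
  factor f_y(c/a) keeps the discrepancy within the second error term. Constants must be uniform in N
  and y where an integral is estimated; for moving a line, any bound with vertical decay is
  enough.\<close>

definition decay :: "real \<Rightarrow> real \<Rightarrow> real" where
  "decay p t = (1 + \<bar>t\<bar>) powr (- p)"

text \<open>The normalisation is that of \<open>1/(2\<pi>i) \<integral> f(w) dw\<close>; the factor \<open>i\<close> cancels against \<open>dw = i dt\<close>.\<close>

definition vert_integral :: "real \<Rightarrow> (complex \<Rightarrow> complex) \<Rightarrow> complex" where
  "vert_integral \<kappa> f = (1 / (2 * pi)) *\<^sub>R (LBINT t. f (Complex \<kappa> t))"

lemma decay_nonneg: "decay p t \<ge> 0"
  by (simp add: decay_def)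

lemma measurable_decay [measurable]: "decay p \<in> borel_measurable borel"
  unfolding decay_def by measurable

lemma integrable_decay:
  assumes "p > 1"
  shows "integrable lborel (decay p)"
proof -
  have pos: "integrable lborel (\<lambda>t. decay p t * indicator {0..} t)"
  proof (rule integrableI_nn_integral_finite)
    define F where "F = (\<lambda>t. (1 + t) powr (1 - p) / (1 - p))"
    have "(\<integral>\<^sup>+t. ennreal (decay p t) * indicator {0..} t \<partial>lborel) = ennreal (0 - F 0)"
    proof (rule nn_integral_FTC_atLeast[where F = F])
      show "(F has_real_derivative decay p t) (at t)" if "0 \<le> t" for t
      proof -
        have "(F has_real_derivative (1 + t) powr (- p)) (at t)"
        proof -
          have "((\<lambda>x. (1 + x) powr (1 - p)) has_real_derivative ((1 - p) * (1 + t) powr (1 - p - of_nat 1) * 1)) (at t)"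
            by (rule DERIV_fun_powr) (use that in \<open>auto intro!: derivative_eq_intros\<close>)
          then have "(F has_real_derivative ((1 - p) * (1 + t) powr (1 - p - of_nat 1) * 1) / (1 - p)) (at t)"
            unfolding F_def by (rule DERIV_cdivide)
          then show ?thesis using assms by simp
        qed
        then show ?thesis using that by (simp add: decay_def)
      qed
      show "(F \<longlongrightarrow> 0) at_top"
        unfolding F_def using assms by real_asymp
    qed (auto simp: decay_nonneg)
    moreover have "(\<lambda>t. ennreal (decay p t) * indicator {0..} t) = (\<lambda>t. ennreal (decay p t * indicator {0..} t))"
      by (auto simp: fun_eq_iff indicator_def)
    ultimately show "(\<integral>\<^sup>+t. ennreal (decay p t * indicator {0..} t) \<partial>lborel) = ennreal (0 - F 0)"
      by simp
    show "(\<lambda>t. decay p t * indicator {0..} t) \<in> borel_measurable lborel" by simp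
    show "AE t in lborel. 0 \<le> decay p t * indicator {0..} t" by (simp add: decay_nonneg)
  qed
  have neg: "integrable lborel (\<lambda>t. decay p t * indicator {0..} (-t))"
    using lborel_integrable_real_affine[OF pos, of "-1" 0] by (simp add: decay_def)
  show ?thesis
    by (rule Bochner_Integration.integrable_bound[OF Bochner_Integration.integrable_add[OF pos neg]])
       (auto simp: decay_nonneg indicator_def)
qed

text \<open>Negative exponents express growth, so estimating an integrand reduces to adding the
  exponents of its factors; the total has to exceed 1.\<close>

lemma decay_mult: "decay p t * decay q t = decay (p + q) t"
  by (simp add: decay_def powr_add [symmetric])

lemma vert_integral_norm_le:
  assumes "p > 1" "\<And>t. norm (f (Complex \<kappa> t)) \<le> D * decay p t"
  shows "norm (vert_integral \<kappa> f) \<le> D * (LBINT t. decay p t)"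
proof -
  have D: "D \<ge> 0" using order_trans[OF norm_ge_zero assms(2)[of 0]] by (simp add: decay_def)
  have "norm (LBINT t. f (Complex \<kappa> t)) \<le> (LBINT t. D * decay p t)"
  proof (cases "integrable lborel (\<lambda>t. f (Complex \<kappa> t))")
    case True
    then show ?thesis
      by (intro Bochner_Integration.integral_norm_bound_integral integrable_mult_right integrable_decay assms)
  next
    \<comment> \<open>The integral of a non-integrable function has the default value 0, so the
      bound holds without any regularity of \<open>f\<close>.\<close>
    case False
    then show ?thesis
      using D by (simp add: not_integrable_integral_eq decay_nonneg)
  qed
  then have *: "norm (LBINT t. f (Complex \<kappa> t)) \<le> D * (LBINT t. decay p t)"
    by simp
  have "norm (vert_integral \<kappa> f) = (1 / (2 * pi)) * norm (LBINT t. f (Complex \<kappa> t))"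
    by (simp add: vert_integral_def)
  also have "\<dots> \<le> 1 * (D * (LBINT t. decay p t))"
  proof (rule mult_mono[OF _ *])
    show "1 / (2 * pi) \<le> 1" using pi_gt3 by (simp add: divide_simps)
  qed auto
  finally show ?thesis by simp
qed

lemma continuous_on_vertical_line:
  assumes "continuous_on S f" "\<And>t. Complex \<kappa> t \<in> S"
  shows "continuous_on UNIV (\<lambda>t. f (Complex \<kappa> t))"
proof -
  have "continuous_on UNIV (f \<circ> Complex \<kappa>)"
  proof (rule continuous_on_compose)
    show "continuous_on UNIV (Complex \<kappa>)"
      unfolding Complex_eq by (intro continuous_intros)
    show "continuous_on (range (Complex \<kappa>)) f"
      by (rule continuous_on_subset[OF assms(1)]) (use assms(2) in auto)
  qed
  then show ?thesis by (simp add: o_def)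
qed

text \<open>Bounds on the lines are often known only for \<open>\<bar>t\<bar> \<ge> 1\<close>, away
  from a pole near the real axis. Compactness fills the gap with an uncontrolled constant, which is
  enough for integrability.\<close>

lemma decay_bound_everywhere:
  fixes g :: "real \<Rightarrow> complex"
  assumes "continuous_on UNIV g" "\<And>t. \<bar>t\<bar> \<ge> 1 \<Longrightarrow> norm (g t) \<le> D * decay p t" "p > 0"
  obtains D' where "\<And>t. norm (g t) \<le> D' * decay p t"
proof -
  have "bounded (g ` {-1..1})"
    by (intro compact_imp_bounded compact_continuous_image continuous_on_subset[OF assms(1)]) auto
  then obtain B where B: "\<And>t. t \<in> {-1..1} \<Longrightarrow> norm (g t) \<le> B"
    unfolding bounded_iff by blast
  have B0: "B \<ge> 0" using order_trans[OF norm_ge_zero B[of 0]] by simp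
  have D0: "D \<ge> 0"
  proof -
    have "0 \<le> D * decay p 1" using order_trans[OF norm_ge_zero assms(2)[of 1]] by simp
    then show ?thesis by (simp add: decay_def zero_le_mult_iff)
  qed
  have "norm (g t) \<le> (B * 2 powr p + D) * decay p t" for t
  proof (cases "\<bar>t\<bar> \<ge> 1")
    case True
    have "D * decay p t \<le> (B * 2 powr p + D) * decay p t"
      using B0 by (intro mult_right_mono) (auto simp: decay_nonneg)
    with assms(2)[OF True] show ?thesis by linarith
  next
    case False
    then have "(1 + \<bar>t\<bar>) powr p \<le> 2 powr p" using assms by (intro powr_mono2) auto
    then have "1 \<le> 2 powr p * decay p t"
      by (simp add: decay_def powr_minus field_simps)
    then have "B * 1 \<le> B * (2 powr p * decay p t)"
      using B0 by (intro mult_left_mono)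
    moreover have "norm (g t) \<le> B" by (rule B) (use False in auto)
    moreover have "0 \<le> D * decay p t" using D0 by (simp add: decay_nonneg)
    ultimately show ?thesis by (simp add: algebra_simps)
  qed
  then show ?thesis by (rule that)
qed

lemma integrable_vertical:
  fixes f :: "complex \<Rightarrow> complex"
  assumes "p > 1" "continuous_on UNIV (\<lambda>t. f (Complex \<kappa> t))"
    "\<And>t. \<bar>t\<bar> \<ge> 1 \<Longrightarrow> norm (f (Complex \<kappa> t)) \<le> D * decay p t"
  shows "integrable lborel (\<lambda>t. f (Complex \<kappa> t))"
proof -
  obtain D' where D': "\<And>t. norm (f (Complex \<kappa> t)) \<le> D' * decay p t"
    by (rule decay_bound_everywhere[OF assms(2,3)]) (use assms(1) in auto)
  have "integrable lborel (\<lambda>t. D' * decay p t)"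
    by (intro integrable_mult_right integrable_decay assms)
  then show ?thesis
  proof (rule Bochner_Integration.integrable_bound)
    show "(\<lambda>t. f (Complex \<kappa> t)) \<in> borel_measurable lborel"
      using borel_measurable_continuous_onI[OF assms(2)] by simp
    show "AE t in lborel. norm (f (Complex \<kappa> t)) \<le> norm (D' * decay p t)"
    proof (rule AE_I2)
      fix t
      show "norm (f (Complex \<kappa> t)) \<le> norm (D' * decay p t)"
        using D'[of t] by (simp del: norm_mult)
    qed
  qed
qed

text \<open>Contour integrals produce gauge integrals over [-T, T], whereas
  \<open>vert_integral\<close> is a Lebesgue integral. Dominated convergence with majorant
  \<open>norm (g t)\<close> links the two.\<close>

lemma truncated_vertical_tendsto:
  fixes g :: "real \<Rightarrow> complex"
  assumes "integrable lborel g" "continuous_on UNIV g"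
  shows "((\<lambda>T. integral {-T..T} g) \<longlongrightarrow> (LBINT t. g t)) at_top"
proof -
  have "((\<lambda>T. LBINT t. indicator {-T..T} t *\<^sub>R g t) \<longlongrightarrow> (LBINT t. g t)) at_top"
  proof (rule integral_dominated_convergence_at_top[where w = "\<lambda>t. norm (g t)"])
    show "AE t in lborel. ((\<lambda>T. indicator {-T..T} t *\<^sub>R g t) \<longlongrightarrow> g t) at_top"
    proof (intro AE_I2 tendsto_eventually)
      fix t :: real
      show "\<forall>\<^sub>F T in at_top. indicator {-T..T} t *\<^sub>R g t = g t"
        using eventually_ge_at_top[of "\<bar>t\<bar>"] by eventually_elim (auto simp: indicator_def)
    qed
    show "\<forall>\<^sub>F T in at_top. AE t in lborel. norm (indicator {-T..T} t *\<^sub>R g t) \<le> norm (g t)"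
      by (intro always_eventually allI AE_I2) (auto simp: indicator_def)
  qed (use assms in auto)
  moreover have "(LBINT t. indicator {-T..T} t *\<^sub>R g t) = integral {-T..T} g" for T :: real
  proof -
    have "set_integrable lborel {-T..T} g"
      by (intro borel_integrable_atLeastAtMost' continuous_on_subset[OF assms(2)]) auto
    from set_borel_integral_eq_integral(2)[OF this] show ?thesis
      by (simp add: set_lebesgue_integral_def)
  qed
  ultimately show ?thesis by simp
qed

lemma contour_integral_rectangle:
  assumes "f contour_integrable_on linepath (Complex a (-T)) (Complex b (-T))"
    "f contour_integrable_on linepath (Complex b (-T)) (Complex b T)"
    "f contour_integrable_on linepath (Complex b T) (Complex a T)"
    "f contour_integrable_on linepath (Complex a T) (Complex a (-T))" "T > 0"
  shows "contour_integral (rectpath (Complex a (-T)) (Complex b T)) f =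
     contour_integral (linepath (Complex a (-T)) (Complex b (-T))) f
     + \<i> * integral {-T..T} (\<lambda>t. f (Complex b t))
     - contour_integral (linepath (Complex a T) (Complex b T)) f
     - \<i> * integral {-T..T} (\<lambda>t. f (Complex a t))"
proof -
  have 1: "contour_integral (linepath (Complex b T) (Complex a T)) f =
      - contour_integral (linepath (Complex a T) (Complex b T)) f"
    using contour_integral_reversepath[of "linepath (Complex a T) (Complex b T)" f] by simp
  have 2: "contour_integral (linepath (Complex a T) (Complex a (-T))) f =
      - contour_integral (linepath (Complex a (-T)) (Complex a T)) f"
    using contour_integral_reversepath[of "linepath (Complex a (-T)) (Complex a T)" f] by simp
  have 3: "contour_integral (linepath (Complex b (-T)) (Complex b T)) f = \<i> * integral {-T..T} (\<lambda>t. f (Complex b t))"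
     "contour_integral (linepath (Complex a (-T)) (Complex a T)) f = \<i> * integral {-T..T} (\<lambda>t. f (Complex a t))"
    by (rule contour_integral_linepath_same_Re; use assms in simp)+
  show ?thesis
    unfolding rectpath_def Let_def using assms 
    by (simp add: contour_integrable_joinI 1 2 3)
qed

text \<open>Only one simple pole is crossed, and writing the integrand as
  \<open>G w / (w - p)\<close> makes \<open>G p\<close> its residue. Hence Cauchy's integral formula
  on rectangles of height T, with T tending to infinity, suffices. The margins A < \<alpha> and
  \<beta> < B put the closed rectangles into the open strip where \<open>G\<close> is
  holomorphic.\<close>

lemma vert_integral_shift:
  assumes holo: "G holomorphic_on {w. A < Re w \<and> Re w < B}"
    and AB: "A < \<alpha>" "\<alpha> < Re p" "Re p < \<beta>" "\<beta> < B" and q: "q > 1"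
    and bd: "\<And>w. \<alpha> \<le> Re w \<Longrightarrow> Re w \<le> \<beta> \<Longrightarrow> \<bar>Im w\<bar> \<ge> 1 \<Longrightarrow> norm (G w / (w - p)) \<le> D * decay q (Im w)"
  shows "vert_integral \<beta> (\<lambda>w. G w / (w - p)) - vert_integral \<alpha> (\<lambda>w. G w / (w - p)) = G p"
proof -
  define S where "S = {w. A < Re w \<and> Re w < B}"
  define h where "h = (\<lambda>w. G w / (w - p))"
  have opS: "open S" unfolding S_def
    by (intro open_Collect_conj open_halfspace_Re_gt open_halfspace_Re_lt)
  have "S = {w. Re w > A} \<inter> {w. Re w < B}" by (auto simp: S_def)
  then have convS: "convex S"
    by (simp only:) (intro convex_Int convex_halfspace_Re_gt convex_halfspace_Re_lt)
  have pS: "p \<in> interior S" using AB opS by (simp add: interior_open S_def)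
  have holoS: "G holomorphic_on S" using holo by (simp add: S_def)
  have conth: "continuous_on (S - {p}) h"
    unfolding h_def
    by (intro holomorphic_on_imp_continuous_on holomorphic_intros holomorphic_on_subset[OF holoS]) auto
  have cont: "continuous_on UNIV (\<lambda>t. h (Complex \<sigma> t))" if "\<sigma> = \<alpha> \<or> \<sigma> = \<beta>" for \<sigma>
    by (rule continuous_on_vertical_line[OF conth]) (use AB that in \<open>auto simp: S_def\<close>)
  have integ: "integrable lborel (\<lambda>t. h (Complex \<sigma> t))" if "\<sigma> = \<alpha> \<or> \<sigma> = \<beta>" for \<sigma>
  proof (rule integrable_vertical[OF q cont[OF that]])
    show "norm (h (Complex \<sigma> t)) \<le> D * decay q t" if "\<bar>t\<bar> \<ge> 1" for t
      using bd[of "Complex \<sigma> t"] AB \<open>\<sigma> = \<alpha> \<or> \<sigma> = \<beta>\<close> that unfolding h_def by auto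
  qed
  have lim: "((\<lambda>T. integral {-T..T} (\<lambda>t. h (Complex \<sigma> t))) \<longlongrightarrow> (LBINT t. h (Complex \<sigma> t))) at_top"
    if "\<sigma> = \<alpha> \<or> \<sigma> = \<beta>" for \<sigma>
    by (rule truncated_vertical_tendsto[OF integ[OF that] cont[OF that]])
  define H where "H = (\<lambda>T. contour_integral (linepath (Complex \<alpha> T) (Complex \<beta> T)) h)"
  have Hbd: "norm (H T) \<le> D * decay q T * (\<beta> - \<alpha>)" if "\<bar>T\<bar> \<ge> 1" "T \<noteq> Im p" for T
  proof -
    have "norm (H T) \<le> D * decay q T * norm (Complex \<beta> T - Complex \<alpha> T)"
      unfolding H_def
    proof (rule contour_integral_bound_linepath)
      have seg: "closed_segment (Complex \<alpha> T) (Complex \<beta> T) \<subseteq> {w. \<alpha> \<le> Re w \<and> Re w \<le> \<beta> \<and> Im w = T}"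
        using AB by (auto simp: closed_segment_same_Im closed_segment_eq_real_ivl)
      show "h contour_integrable_on linepath (Complex \<alpha> T) (Complex \<beta> T)"
      proof (intro contour_integrable_continuous_linepath continuous_on_subset[OF conth] subsetI)
        fix w assume "w \<in> closed_segment (Complex \<alpha> T) (Complex \<beta> T)"
        then have "\<alpha> \<le> Re w" "Re w \<le> \<beta>" "Im w = T" using seg by auto
        then show "w \<in> S - {p}" using AB \<open>T \<noteq> Im p\<close> by (auto simp: S_def)
      qed
      show "norm (h w) \<le> D * decay q T" if "w \<in> closed_segment (Complex \<alpha> T) (Complex \<beta> T)" for w
        using bd[of w] seg that \<open>\<bar>T\<bar> \<ge> 1\<close> by (auto simp: h_def)
      have "0 \<le> norm (h (Complex \<alpha> T))" by simp
      also have "norm (h (Complex \<alpha> T)) \<le> D * decay q T"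
        using bd[of "Complex \<alpha> T"] AB \<open>\<bar>T\<bar> \<ge> 1\<close> by (auto simp: h_def)
      finally show "0 \<le> D * decay q T" .
    qed
    also have "norm (Complex \<beta> T - Complex \<alpha> T) = \<beta> - \<alpha>"
      using AB by (simp add: cmod_def)
    finally show ?thesis .
  qed
  \<comment> \<open>The factor \<open>m\<close> treats the top edge (1) and the bottom edge (-1)
    together.\<close>
  have Hlim: "((\<lambda>T. H (m * T)) \<longlongrightarrow> 0) at_top" if m: "m = 1 \<or> m = -1" for m
  proof (rule tendsto_norm_zero_cancel, rule tendsto_sandwich[OF _ _ tendsto_const])
    show "\<forall>\<^sub>F T in at_top. 0 \<le> norm (H (m * T))" by simp
    show "\<forall>\<^sub>F T in at_top. norm (H (m * T)) \<le> D * (1 + T) powr (- q) * (\<beta> - \<alpha>)"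
      using eventually_gt_at_top[of "\<bar>Im p\<bar> + 1"]
    proof eventually_elim
      case (elim T)
      then show ?case using Hbd[of "m * T"] m by (auto simp: decay_def)
    qed
    show "((\<lambda>T. D * (1 + T) powr (- q) * (\<beta> - \<alpha>)) \<longlongrightarrow> 0) at_top"
    proof -
      have "((\<lambda>T. (1 + T) powr (- q)) \<longlongrightarrow> 0) at_top" using q by real_asymp
      then have "((\<lambda>T. D * (1 + T) powr (- q) * (\<beta> - \<alpha>)) \<longlongrightarrow> D * 0 * (\<beta> - \<alpha>)) at_top"
        by (intro tendsto_mult tendsto_const)
      then show ?thesis by simp
    qed
  qed
  have eq: "\<forall>\<^sub>F T in at_top. H (-1 * T) + \<i> * integral {-T..T} (\<lambda>t. h (Complex \<beta> t)) - H (1 * T)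
       - \<i> * integral {-T..T} (\<lambda>t. h (Complex \<alpha> t)) = 2 * pi * \<i> * G p"
    using eventually_gt_at_top[of "\<bar>Im p\<bar> + 1"]
  proof eventually_elim
    case (elim T)
    let ?r = "rectpath (Complex \<alpha> (-T)) (Complex \<beta> T)"
    have im: "path_image ?r \<subseteq> S - {p}"
      using AB elim by (subst path_image_rectpath) (auto simp: S_def)
    have pib: "p \<in> box (Complex \<alpha> (-T)) (Complex \<beta> T)"
      using AB elim by (auto simp: in_box_complex_iff)
    have "(h has_contour_integral (2 * pi * \<i> * winding_number ?r p * G p)) ?r"
      unfolding h_def
      by (rule Cauchy_integral_formula_convex_simple[OF convS holoS pS _ im]) auto
    then have "contour_integral ?r h = 2 * pi * \<i> * G p"
      using winding_number_rectpath[OF pib] by (simp add: contour_integral_unique)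
    moreover have "contour_integral ?r h = H (-T) + \<i> * integral {-T..T} (\<lambda>t. h (Complex \<beta> t)) - H T
       - \<i> * integral {-T..T} (\<lambda>t. h (Complex \<alpha> t))"
      unfolding H_def
    proof (rule contour_integral_rectangle)
      have "path_image ?r = closed_segment (Complex \<alpha> (-T)) (Complex \<beta> (-T))
           \<union> closed_segment (Complex \<beta> (-T)) (Complex \<beta> T)
           \<union> closed_segment (Complex \<beta> T) (Complex \<alpha> T)
           \<union> closed_segment (Complex \<alpha> T) (Complex \<alpha> (-T))"
        by (auto simp: rectpath_def Let_def path_image_join)
      then show "h contour_integrable_on linepath (Complex \<alpha> (-T)) (Complex \<beta> (-T))"
        "h contour_integrable_on linepath (Complex \<beta> (-T)) (Complex \<beta> T)"
        "h contour_integrable_on linepath (Complex \<beta> T) (Complex \<alpha> T)"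
        "h contour_integrable_on linepath (Complex \<alpha> T) (Complex \<alpha> (-T))"
        using im by (auto intro!: contour_integrable_continuous_linepath intro: continuous_on_subset[OF conth])
    qed (use elim in auto)
    ultimately show ?case by simp
  qed
  have "((\<lambda>T. H (-1 * T) + \<i> * integral {-T..T} (\<lambda>t. h (Complex \<beta> t)) - H (1 * T)
       - \<i> * integral {-T..T} (\<lambda>t. h (Complex \<alpha> t))) \<longlongrightarrow>
      0 + \<i> * (LBINT t. h (Complex \<beta> t)) - 0 - \<i> * (LBINT t. h (Complex \<alpha> t))) at_top"
    by (intro tendsto_intros Hlim lim) auto
  with eq have "((\<lambda>T::real. 2 * pi * \<i> * G p) \<longlongrightarrow>
      0 + \<i> * (LBINT t. h (Complex \<beta> t)) - 0 - \<i> * (LBINT t. h (Complex \<alpha> t))) at_top"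
    by (rule Lim_transform_eventually[rotated])
  then have "\<i> * (2 * pi * G p) = \<i> * ((LBINT t. h (Complex \<beta> t)) - (LBINT t. h (Complex \<alpha> t)))"
    by (simp add: tendsto_const_iff algebra_simps)
  then have "2 * pi * G p = (LBINT t. h (Complex \<beta> t)) - (LBINT t. h (Complex \<alpha> t))"
    by simp
  moreover have "vert_integral \<beta> h - vert_integral \<alpha> h =
      (1 / (2 * pi)) *\<^sub>R ((LBINT t. h (Complex \<beta> t)) - (LBINT t. h (Complex \<alpha> t)))"
    by (simp add: vert_integral_def scaleR_diff_right)
  ultimately have "vert_integral \<beta> h - vert_integral \<alpha> h = (1 / (2 * pi)) *\<^sub>R (2 * pi * G p)"
    by simp
  then show ?thesis
    by (simp add: h_def scaleR_conv_of_real)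
qed

section \<open>Perron's formula at integers\<close>

text \<open>An artificial pole is placed at the real midpoint \<open>p\<close> of the two lines and
  cancelled by the factor \<open>w - p\<close> in \<open>G\<close>; its residue \<open>G p\<close>
  is 0.\<close>

lemma vert_integral_shift_holomorphic:
  assumes holo: "f holomorphic_on {w. A < Re w \<and> Re w < B}"
    and AB: "A < \<alpha>" "\<alpha> < \<beta>" "\<beta> < B" and q: "q > 1"
    and bd: "\<And>w. \<alpha> \<le> Re w \<Longrightarrow> Re w \<le> \<beta> \<Longrightarrow> \<bar>Im w\<bar> \<ge> 1 \<Longrightarrow> norm (f w) \<le> D * decay q (Im w)"
  shows "vert_integral \<beta> f = vert_integral \<alpha> f"
proof -
  define p where "p = complex_of_real ((\<alpha> + \<beta>) / 2)"
  define G where "G = (\<lambda>w. f w * (w - p))"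
  have Gf: "G w / (w - p) = f w" if "w \<noteq> p" for w
    using that by (simp add: G_def)
  have "vert_integral \<beta> (\<lambda>w. G w / (w - p)) - vert_integral \<alpha> (\<lambda>w. G w / (w - p)) = G p"
  proof (rule vert_integral_shift[OF _ AB(1) _ _ AB(3) q])
    show "G holomorphic_on {w. A < Re w \<and> Re w < B}"
      unfolding G_def by (intro holomorphic_intros holo)
    show "\<alpha> < Re p" "Re p < \<beta>" using AB by (simp_all add: p_def)
    show "norm (G w / (w - p)) \<le> D * decay q (Im w)"
      if "\<alpha> \<le> Re w" "Re w \<le> \<beta>" "\<bar>Im w\<bar> \<ge> 1" for w
    proof -
      have "w \<noteq> p"
      proof
        assume "w = p"
        then have "Im w = 0" by (simp only: p_def Im_complex_of_real)
        with that show False by simp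
      qed
      with bd[OF that] Gf show ?thesis by metis
    qed
  qed
  moreover have "vert_integral \<sigma> (\<lambda>w. G w / (w - p)) = vert_integral \<sigma> f" if "\<sigma> = \<alpha> \<or> \<sigma> = \<beta>" for \<sigma>
  proof -
    have "Complex \<sigma> t \<noteq> p" for t
      using AB that by (auto simp: p_def complex_eq_iff)
    then show ?thesis by (simp add: vert_integral_def Gf)
  qed
  ultimately show ?thesis by (simp add: G_def)
qed

section \<open>The averaged Perron kernel and its bounds\<close>

text \<open>This is the integral of exp (t z) over 0 \<le> t \<le> 1 in closed form, an entire
  function.\<close>

definition expq :: "complex \<Rightarrow> complex" where
  "expq z = (if z = 0 then 1 else (exp z - 1) / z)"

lemma expq_holomorphic: "expq holomorphic_on UNIV"
proof -
  have "(\<lambda>z. if z = 0 then deriv exp 0 else (exp z - exp 0) / (z - 0)) holomorphic_on (UNIV :: complex set)"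
    by (rule pole_lemma) (auto intro: holomorphic_intros)
  moreover have "deriv exp (0::complex) = 1"
    using DERIV_imp_deriv[OF DERIV_exp[of "0::complex"]] by simp
  moreover have "expq = (\<lambda>z. if z = 0 then deriv exp 0 else (exp z - exp 0) / (z - 0))"
    using calculation(2) by (simp add: expq_def fun_eq_iff)
  ultimately show ?thesis by simp
qed

text \<open>The increment of exp along the segment from 0 to z is controlled by the largest modulus
  of its derivative there.\<close>

lemma norm_expq_le_max: "norm (expq z) \<le> max 1 (exp (Re z))"
proof (cases "z = 0")
  case False
  have "norm (exp z - exp 0) \<le> max 1 (exp (Re z)) * norm (z - 0)"
  proof (rule field_differentiable_bound)
    show "convex (closed_segment 0 z)" by simp
    show "(exp has_field_derivative exp w) (at w within closed_segment 0 z)" for w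
      by (rule has_field_derivative_at_within) (rule DERIV_exp)
    show "norm (exp w) \<le> max 1 (exp (Re z))" if "w \<in> closed_segment 0 z" for w
    proof -
      from that obtain u where u: "w = of_real u * z" "0 \<le> u" "u \<le> 1"
        by (auto simp: in_segment scaleR_conv_of_real)
      have "u * Re z \<le> max 0 (Re z)"
        using u mult_right_mono[of u 1 "Re z"] mult_nonneg_nonpos[of u "Re z"] by (cases "Re z \<ge> 0") auto
      then have "exp (u * Re z) \<le> exp (max 0 (Re z))" by simp
      also have "\<dots> = max 1 (exp (Re z))" by (simp add: max_def)
      finally show ?thesis using u by simp
    qed
  qed auto
  then show ?thesis
    using False by (simp add: expq_def norm_divide divide_le_eq)
qed (auto simp: expq_def)

text \<open>Interpolates between a constant bound, used for |z| < 1, and 1/|z|, used for |z| \<ge>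
  1. The free exponent is essential: with z = \<open>log_step N * w\<close>, a decay of order \<eta>
  in w costs about N^\<eta>, so \<eta> can be taken small.\<close>

lemma norm_expq_le:
  assumes "0 \<le> \<eta>" "\<eta> \<le> 1" "z \<noteq> 0"
  shows "norm (expq z) \<le> (1 + exp (Re z)) * norm z powr (- \<eta>)"
proof (cases "norm z \<ge> 1")
  case True
  have "norm (exp z - 1) \<le> 1 + exp (Re z)"
    using norm_triangle_ineq4[of "exp z" 1] by simp
  then have "norm (expq z) \<le> (1 + exp (Re z)) * norm z powr (-1)"
    using assms by (simp add: expq_def norm_divide powr_minus divide_right_mono flip: divide_inverse)
  also have "\<dots> \<le> (1 + exp (Re z)) * norm z powr (- \<eta>)"
    using True assms by (intro mult_left_mono powr_mono) (auto intro: add_nonneg_nonneg)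
  finally show ?thesis .
next
  case False
  have "norm z powr \<eta> \<le> 1"
    using False assms by (intro powr_le1) auto
  then have "1 \<le> norm z powr (- \<eta>)"
    using assms by (simp add: powr_minus field_simps)
  moreover have "max 1 (exp (Re z)) \<le> 1 + exp (Re z)" by simp
  ultimately have "max 1 (exp (Re z)) * 1 \<le> (1 + exp (Re z)) * norm z powr (- \<eta>)"
    by (intro mult_mono) auto
  then show ?thesis using norm_expq_le_max[of z] by linarith
qed

text \<open>
  The kernel is the mean of \<open>u\<^sup>w\<close> over \<open>N \<le> u \<le> N + 1\<close> with respect to \<open>du/u\<close>.  With this weight (rather than \<open>du\<close>,
  which gives a denominator \<open>w + 1\<close>) the only removable singularity is at \<open>w = 0\<close>.
\<close>

definition log_step :: "nat \<Rightarrow> real" where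
  "log_step N = ln (real (Suc N) / real N)"

definition perron_kernel :: "nat \<Rightarrow> complex \<Rightarrow> complex" where
  "perron_kernel N w = of_nat N powr w * expq (of_real (log_step N) * w)"

lemma log_step_bounds:
  assumes "N > 0"
  shows "1 / (2 * real N) \<le> log_step N" "log_step N \<le> ln 2" "log_step N > 0"
proof -
  have "ln (real N / real (Suc N)) \<le> real N / real (Suc N) - 1"
    using assms by (intro ln_le_minus_one) auto
  also have "\<dots> \<le> - (1 / (2 * real N))"
    using assms by (simp add: field_simps)
  also have "ln (real N / real (Suc N)) = - log_step N"
    using assms by (simp add: log_step_def ln_div)
  finally show *: "1 / (2 * real N) \<le> log_step N" by simp
  show "log_step N \<le> ln 2"
    using assms unfolding log_step_def by (subst ln_le_cancel_iff) (auto simp: field_simps)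
  have "0 < 1 / (2 * real N)" using assms by simp
  with * show "log_step N > 0" by linarith
qed

lemma perron_kernel_holomorphic:
  assumes "N > 0"
  shows "perron_kernel N holomorphic_on A"
proof -
  have "(expq \<circ> (\<lambda>w. of_real (log_step N) * w)) holomorphic_on A"
    by (rule holomorphic_on_compose_gen[OF _ expq_holomorphic]) (auto intro: holomorphic_intros)
  then show ?thesis
    unfolding perron_kernel_def o_def using assms by (intro holomorphic_intros) auto
qed

lemma perron_kernel_0: "N > 0 \<Longrightarrow> perron_kernel N 0 = 1"
  by (simp add: perron_kernel_def expq_def)

lemma norm_of_pos_nat_powr: "N > 0 \<Longrightarrow> norm (of_nat N powr (s :: complex)) = real N powr Re s"
  using norm_of_nat_powr[of "N - 1" s] by simp

lemma norm_perron_kernel_le: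
  assumes "N > 0" "0 \<le> \<eta>" "\<eta> \<le> 1" "w \<noteq> 0" "\<bar>Re w\<bar> \<le> B"
  shows "norm (perron_kernel N w) \<le> 2 * (1 + 2 powr B) * real N powr (Re w + \<eta>) * norm w powr (- \<eta>)"
proof -
  have h: "1 / (2 * real N) \<le> log_step N" "log_step N \<le> ln 2" "log_step N > 0"
    using log_step_bounds[OF assms(1)] .
  \<comment> \<open>The upper bound \<open>ln 2\<close> for \<open>log_step N\<close> keeps the
    exponential factor independent of N.\<close>
  have "log_step N * Re w \<le> ln 2 * B"
    using h assms by (intro order_trans[OF mult_left_mono mult_right_mono]) auto
  then have e: "exp (log_step N * Re w) \<le> 2 powr B"
    by (simp add: powr_def mult.commute)
  have "(log_step N) powr (- \<eta>) \<le> (1 / (2 * real N)) powr (- \<eta>)"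
    using h assms by (intro powr_mono2') auto
  also have "\<dots> = 2 powr \<eta> * real N powr \<eta>"
    using assms by (simp add: powr_minus powr_divide powr_mult field_simps)
  also have "\<dots> \<le> 2 * real N powr \<eta>"
    using assms powr_mono[of \<eta> 1 2] by (intro mult_right_mono) auto
  finally have hp: "(log_step N) powr (- \<eta>) \<le> 2 * real N powr \<eta>" .
  have "norm (perron_kernel N w) = real N powr Re w * norm (expq (of_real (log_step N) * w))"
    using assms by (simp add: perron_kernel_def norm_mult norm_of_pos_nat_powr)
  also have "\<dots> \<le> real N powr Re w * ((1 + exp (log_step N * Re w)) * norm (of_real (log_step N) * w) powr (- \<eta>))"
    using norm_expq_le[of \<eta> "of_real (log_step N) * w"] h assms by (intro mult_left_mono) auto
  also have "norm (of_real (log_step N) * w) powr (- \<eta>) = (log_step N) powr (- \<eta>) * norm w powr (- \<eta>)"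
    using h by (simp add: norm_mult powr_mult)
  also have "real N powr Re w * ((1 + exp (log_step N * Re w)) * ((log_step N) powr (- \<eta>) * norm w powr (- \<eta>)))
      \<le> real N powr Re w * ((1 + 2 powr B) * ((2 * real N powr \<eta>) * norm w powr (- \<eta>)))"
    using e hp by (intro mult_left_mono mult_mono) (auto intro: add_nonneg_nonneg)
  also have "\<dots> = 2 * (1 + 2 powr B) * real N powr (Re w + \<eta>) * norm w powr (- \<eta>)"
    by (simp add: powr_add mult_ac)
  finally show ?thesis .
qed

text \<open>The average of the bounds |w| \<ge> \<delta> and |w| \<ge> \<delta> |Im w|. With
  \<open>powr_neg_le_decay\<close> it turns powers of 1/|w|, at distance \<delta> from the imaginary
  axis, into \<open>decay\<close>.\<close>

lemma norm_ge_of_Re: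
  assumes "\<bar>Re w\<bar> \<ge> \<delta>" "0 < \<delta>" "\<delta> \<le> 1"
  shows "norm w \<ge> \<delta> / 2 * (1 + \<bar>Im w\<bar>)"
proof -
  have "norm w \<ge> \<delta>" "norm w \<ge> \<bar>Im w\<bar>"
    using abs_Re_le_cmod[of w] abs_Im_le_cmod[of w] assms by linarith+
  moreover have "\<delta> * \<bar>Im w\<bar> \<le> 1 * \<bar>Im w\<bar>" using assms by (intro mult_right_mono) auto
  ultimately show ?thesis by (simp add: algebra_simps)
qed

lemma norm_ge_of_Im:
  assumes "\<bar>Im w\<bar> \<ge> 1"
  shows "norm w \<ge> 1 / 2 * (1 + \<bar>Im w\<bar>)"
  using abs_Im_le_cmod[of w] assms by simp

lemma powr_neg_le_decay:
  assumes "norm w \<ge> \<delta> / 2 * (1 + \<bar>t\<bar>)" "0 < \<delta>" "s \<ge> 0"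
  shows "norm w powr (- s) \<le> (2 / \<delta>) powr s * decay s t"
proof -
  have "norm w powr (- s) \<le> (\<delta> / 2 * (1 + \<bar>t\<bar>)) powr (- s)"
    using assms by (intro powr_mono2') (auto intro!: mult_pos_pos add_pos_nonneg)
  also have "\<dots> = (\<delta> / 2) powr (- s) * decay s t"
    using assms by (simp only: decay_def) (subst powr_mult, auto)
  also have "(\<delta> / 2) powr (- s) = (2 / \<delta>) powr s"
    using assms by (simp add: powr_minus powr_divide field_simps)
  finally show ?thesis .
qed

lemma perron_kernel_eq:
  assumes "N > 0" "w \<noteq> 0"
  shows "perron_kernel N w = (of_nat (Suc N) powr w - of_nat N powr w) / (of_real (log_step N) * w)"
proof -
  have "of_nat (Suc N) powr w = of_nat N powr w * exp (of_real (log_step N) * w)"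
  proof -
    have "exp (of_real (log_step N) * w) = of_real (real (Suc N) / real N) powr w"
      using assms by (simp add: powr_def log_step_def Ln_of_real[symmetric] mult.commute del: of_nat_Suc of_real_divide)
    moreover have "of_nat (Suc N) powr w = of_real (real N * (real (Suc N) / real N)) powr w"
      using assms by (simp del: of_nat_Suc)
    ultimately show ?thesis
      using assms by (simp only: of_real_mult) (subst powr_times_real, auto)
  qed
  then show ?thesis
    using assms log_step_bounds(3)[of N]
    by (simp add: perron_kernel_def expq_def algebra_simps diff_divide_distrib)
qed


text \<open>In contrast to \<open>norm_perron_kernel_le\<close> there is no constant depending on a
  bound for Re w, so the line may be moved to infinity in either direction.\<close>

lemma norm_perron_kernel_le_inverse:
  assumes "N > 0" "w \<noteq> 0"
  shows "norm (perron_kernel N w) \<le> 2 * real N * (real (Suc N) powr Re w + real N powr Re w) / norm w"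
proof -
  have h: "1 / log_step N \<le> 2 * real N" "log_step N > 0"
    using log_step_bounds(1,3)[of N] assms by (auto simp: field_simps)
  have "norm (perron_kernel N w) = norm (of_nat (Suc N) powr w - of_nat N powr w) * (1 / log_step N) / norm w"
    using assms h by (simp add: perron_kernel_eq norm_divide norm_mult)
  also have "\<dots> \<le> (real (Suc N) powr Re w + real N powr Re w) * (2 * real N) / norm w"
    using norm_triangle_ineq4[of "of_nat (Suc N) powr w" "of_nat N powr w"] assms h
    by (intro divide_right_mono mult_mono) (auto simp: norm_of_pos_nat_powr simp del: of_nat_Suc)
  finally show ?thesis by (simp add: mult_ac)
qed

text \<open>The power |w|^(-2) is split into |w|^(-1/2), which tends to 0 as the line moves away,
  and |w|^(-3/2), which is integrable along it.\<close>

lemma inverse_norm_square_le: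
  assumes "\<bar>Re w\<bar> \<ge> R" "R \<ge> 1"
  shows "1 / (norm w)\<^sup>2 \<le> R powr (-1/2) * 2 powr (3/2) * decay (3/2) (Im w)"
proof -
  have w: "norm w \<ge> R" using abs_Re_le_cmod[of w] assms by linarith
  have "1 / (norm w)\<^sup>2 = norm w powr (- (1/2)) * norm w powr (- (3/2))"
    using w assms by (subst powr_add [symmetric]) (simp add: powr_minus powr_numeral field_simps)
  also have "\<dots> \<le> R powr (- (1/2)) * ((2 / 1) powr (3/2) * decay (3/2) (Im w))"
  proof (intro mult_mono)
    show "norm w powr (- (1/2)) \<le> R powr (- (1/2))"
      using w assms by (intro powr_mono2') auto
    show "norm w powr (- (3/2)) \<le> (2 / 1) powr (3/2) * decay (3/2) (Im w)"
      using norm_ge_of_Re[of 1 w] assms by (intro powr_neg_le_decay) auto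
  qed auto
  finally show ?thesis by (simp add: mult_ac)
qed

section \<open>The discontinuous integral and Perron's formula\<close>

definition perron_term :: "nat \<Rightarrow> nat \<Rightarrow> complex \<Rightarrow> complex" where
  "perron_term N n w = of_nat n powr (- w) * perron_kernel N w / w"

lemma perron_term_bound:
  assumes "N > 0" "n > 0" "w \<noteq> 0"
  shows "norm (perron_term N n w) \<le>
    2 * real N * ((real (Suc N) / real n) powr Re w + (real N / real n) powr Re w) / (norm w)\<^sup>2"
proof -
  have "norm (perron_term N n w) = real n powr (- Re w) * norm (perron_kernel N w) / norm w"
    using assms by (simp add: perron_term_def norm_mult norm_divide norm_of_pos_nat_powr)
  also have "\<dots> \<le> real n powr (- Re w) * (2 * real N * (real (Suc N) powr Re w + real N powr Re w) / norm w) / norm w"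
    using norm_perron_kernel_le_inverse[OF assms(1,3)]
    by (intro divide_right_mono mult_left_mono) auto
  also have "\<dots> = 2 * real N * ((real (Suc N) / real n) powr Re w + (real N / real n) powr Re w) / (norm w)\<^sup>2"
    using assms by (simp add: powr_divide powr_minus power2_eq_square field_simps)
  finally show ?thesis .
qed

text \<open>Integrality matters: n > N means n \<ge> N + 1, so no n lies strictly inside the
  averaging interval. Hence N/n and (N + 1)/n are both at most 1 if n > N and both at least 1 if n
  \<le> N, and their powers stay bounded on the side where \<sigma> lies.\<close>

lemma perron_term_far_line:
  assumes "N > 0" "n > 0" "\<bar>\<sigma>\<bar> \<ge> 1"
    and "\<sigma> > 0 \<and> n > N \<or> \<sigma> < 0 \<and> n \<le> N"
  shows "norm (vert_integral \<sigma> (perron_term N n)) \<le>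
     4 * real N * 2 powr (3/2) * (LBINT t. decay (3/2) t) * \<bar>\<sigma>\<bar> powr (-1/2)"
proof -
  have "norm (vert_integral \<sigma> (perron_term N n)) \<le>
     (4 * real N * (\<bar>\<sigma>\<bar> powr (-1/2) * 2 powr (3/2))) * (LBINT t. decay (3/2) t)"
  proof (rule vert_integral_norm_le)
    fix t
    have le1: "(real m / real n) powr \<sigma> \<le> 1" if "m = N \<or> m = Suc N" for m
      using assms(4)
    proof
      assume "\<sigma> > 0 \<and> n > N"
      then show ?thesis using that assms by (intro powr_le1) (auto simp: divide_le_eq)
    next
      assume *: "\<sigma> < 0 \<and> n \<le> N"
      then have "1 powr (-\<sigma>) \<le> (real m / real n) powr (-\<sigma>)"
        using that assms by (intro powr_mono2) (auto simp: le_divide_eq)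
      then have "1 \<le> inverse ((real m / real n) powr \<sigma>)" by (simp only: powr_minus powr_one_eq_one inverse_1)
      then show ?thesis using one_le_inverse_iff[of "(real m / real n) powr \<sigma>"] by linarith
    qed
    have "Complex \<sigma> t \<noteq> 0" using assms by (auto simp: complex_eq_iff)
    from perron_term_bound[OF assms(1,2) this]
    have "norm (perron_term N n (Complex \<sigma> t)) \<le>
       2 * real N * ((real (Suc N) / real n) powr \<sigma> + (real N / real n) powr \<sigma>) * (1 / (norm (Complex \<sigma> t))\<^sup>2)"
      by simp
    also have "\<dots> \<le> 2 * real N * (1 + 1) * (\<bar>\<sigma>\<bar> powr (-1/2) * 2 powr (3/2) * decay (3/2) t)"
      using le1 inverse_norm_square_le[of "\<bar>\<sigma>\<bar>" "Complex \<sigma> t"] assms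
      by (intro mult_mono add_mono) (auto simp del: of_nat_Suc)
    finally show "norm (perron_term N n (Complex \<sigma> t)) \<le>
      4 * real N * (\<bar>\<sigma>\<bar> powr (-1/2) * 2 powr (3/2)) * decay (3/2) t" by (simp add: mult_ac)
  qed simp
  then show ?thesis by (simp add: mult_ac)
qed

lemma eq_zero_of_powr_bound:
  fixes v :: complex
  assumes "\<And>R. R \<ge> R0 \<Longrightarrow> norm v \<le> C * R powr (-1/2)"
  shows "v = 0"
proof -
  have "((\<lambda>R. R powr (-1/2 :: real)) \<longlongrightarrow> 0) at_top" by real_asymp
  then have "((\<lambda>R. C * R powr (-1/2 :: real)) \<longlongrightarrow> C * 0) at_top"
    by (intro tendsto_intros)
  moreover have "\<forall>\<^sub>F R in at_top. norm v \<le> C * R powr (-1/2 :: real)"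
    using eventually_ge_at_top[of R0] by eventually_elim (use assms in auto)
  ultimately have "norm v \<le> C * 0"
    by (intro tendsto_lowerbound[of "\<lambda>R. C * R powr (-1/2 :: real)"]) auto
  then show ?thesis by simp
qed

lemma perron_term_decay:
  assumes "N > 0" "n > 0" "\<alpha> \<le> \<beta>"
  shows "\<exists>D. \<forall>w. \<alpha> \<le> Re w \<and> Re w \<le> \<beta> \<and> \<bar>Im w\<bar> \<ge> 1 \<longrightarrow> norm (perron_term N n w) \<le> D * decay 2 (Im w)"
proof -
  \<comment> \<open>For \<sigma> between \<alpha> and \<beta>, x^\<sigma> is at most the larger of
    the two end powers, whether x is below or above 1.\<close>
  define M where "M = (\<lambda>x. x powr \<alpha> + x powr \<beta> :: real)"
  have M: "x powr \<sigma> \<le> M x" if "x > 0" "\<alpha> \<le> \<sigma>" "\<sigma> \<le> \<beta>" for x \<sigma> :: real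
  proof (cases "x \<ge> 1")
    case True
    then have "x powr \<sigma> \<le> x powr \<beta>" using that by (intro powr_mono) auto
    then show ?thesis unfolding M_def using powr_ge_zero[of x \<alpha>] by linarith
  next
    case False
    then have "x powr \<sigma> \<le> x powr \<alpha>" using that by (intro powr_mono') auto
    then show ?thesis unfolding M_def using powr_ge_zero[of x \<beta>] by linarith
  qed
  have "norm (perron_term N n w) \<le>
      (2 * real N * (M (real (Suc N) / real n) + M (real N / real n)) * 4) * decay 2 (Im w)"
    if w: "\<alpha> \<le> Re w" "Re w \<le> \<beta>" "\<bar>Im w\<bar> \<ge> 1" for w
  proof -
    have w0: "w \<noteq> 0" using w by auto
    have "norm w powr (- 2) \<le> (2 / 1) powr 2 * decay 2 (Im w)"
      using norm_ge_of_Im[OF w(3)] by (intro powr_neg_le_decay) auto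
    then have "1 / (norm w)\<^sup>2 \<le> 4 * decay 2 (Im w)"
      using w0 by (simp add: powr_minus powr_numeral field_simps)
    then have "2 * real N * ((real (Suc N) / real n) powr Re w + (real N / real n) powr Re w) * (1 / (norm w)\<^sup>2)
       \<le> 2 * real N * (M (real (Suc N) / real n) + M (real N / real n)) * (4 * decay 2 (Im w))"
      using assms w by (intro mult_mono add_mono M) (auto simp: M_def intro!: add_nonneg_nonneg)
    then show ?thesis using perron_term_bound[OF assms(1,2) w0]
      by (simp only: times_divide_eq_right mult_1_right mult.assoc order_trans)
  qed
  then show ?thesis by blast
qed

lemma perron_term_holomorphic:
  "N > 0 \<Longrightarrow> n > 0 \<Longrightarrow> 0 \<notin> A \<Longrightarrow> perron_term N n holomorphic_on A"
  unfolding perron_term_def by (intro holomorphic_intros perron_kernel_holomorphic) auto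

text \<open>For n \<le> N the line moves to the far left across the pole at 0, whose residue is 1;
  for n > N it moves to the far right and meets no pole. The remaining integral is O(R^(-1/2)), so
  the value is exact, also at n = N.\<close>

lemma vert_integral_perron_term:
  assumes N: "N > 0" and n: "n > 0" and \<kappa>: "\<kappa> > 0"
  shows "vert_integral \<kappa> (perron_term N n) = (if n \<le> N then 1 else 0)"
proof (cases "n \<le> N")
  case True
  have "norm (vert_integral \<kappa> (perron_term N n) - 1) \<le>
     4 * real N * 2 powr (3/2) * (LBINT t. decay (3/2) t) * R powr (-1/2)" if R: "R \<ge> 1" for R
  proof -
    define G where "G = (\<lambda>w. of_nat n powr (- w) * perron_kernel N w)"
    obtain D where D: "\<And>w. - R \<le> Re w \<Longrightarrow> Re w \<le> \<kappa> \<Longrightarrow> \<bar>Im w\<bar> \<ge> 1 \<Longrightarrow> norm (perron_term N n w) \<le> D * decay 2 (Im w)"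
      using perron_term_decay[OF N n, of "-R" \<kappa>] R \<kappa> by auto
    have eq: "perron_term N n = (\<lambda>w. G w / (w - 0))" by (simp add: fun_eq_iff perron_term_def G_def)
    have "vert_integral \<kappa> (perron_term N n) - vert_integral (-R) (perron_term N n) = G 0"
      unfolding eq
    proof (rule vert_integral_shift[where A = "-R-1" and B = "\<kappa>+1" and q = 2 and D = D])
      show "G holomorphic_on {w. - R - 1 < Re w \<and> Re w < \<kappa> + 1}"
        unfolding G_def using n by (intro holomorphic_intros perron_kernel_holomorphic N) auto
    qed (use R \<kappa> D in \<open>auto simp: eq\<close>)
    moreover have "G 0 = 1" using n by (simp add: G_def perron_kernel_0[OF N])
    ultimately have "vert_integral \<kappa> (perron_term N n) - 1 = vert_integral (-R) (perron_term N n)"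
      by (simp add: diff_eq_eq add.commute)
    then show ?thesis
      using perron_term_far_line[OF N n, of "-R"] R True by simp
  qed
  from eq_zero_of_powr_bound[OF this] True show ?thesis by simp
next
  case False
  have "norm (vert_integral \<kappa> (perron_term N n)) \<le>
     4 * real N * 2 powr (3/2) * (LBINT t. decay (3/2) t) * R powr (-1/2)" if R: "R \<ge> \<kappa> + 1" for R
  proof -
    obtain D where D: "\<And>w. \<kappa> \<le> Re w \<Longrightarrow> Re w \<le> R \<Longrightarrow> \<bar>Im w\<bar> \<ge> 1 \<Longrightarrow> norm (perron_term N n w) \<le> D * decay 2 (Im w)"
      using perron_term_decay[OF N n, of \<kappa> R] R by auto
    have "vert_integral R (perron_term N n) = vert_integral \<kappa> (perron_term N n)"
      by (rule vert_integral_shift_holomorphic[where A = 0 and B = "R + 1" and q = 2 and D = D])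
         (use R \<kappa> D N n in \<open>auto intro!: perron_term_holomorphic\<close>)
    then show ?thesis
      using perron_term_far_line[OF N n, of R] R \<kappa> False by simp
  qed
  from eq_zero_of_powr_bound[OF this] False show ?thesis by simp
qed

text \<open>Absolute convergence permits integration term by term and leaves no truncation error.
  The frequencies \<open>l i\<close> may repeat and need no order, so that double series can be
  treated after enumerating the pairs.\<close>

theorem perron_formula:
  fixes a :: "nat \<Rightarrow> complex" and l :: "nat \<Rightarrow> nat"
  assumes l: "\<And>i. l i > 0" and \<kappa>: "\<kappa> > 0" and N: "N > 0"
    and sm: "summable (\<lambda>i. norm (a i) * real (l i) powr (- \<kappa>))"
    and F: "\<And>w. Re w = \<kappa> \<Longrightarrow> (\<lambda>i. a i * of_nat (l i) powr (- w)) sums F w"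
  shows "(\<lambda>i. if l i \<le> N then a i else 0) sums vert_integral \<kappa> (\<lambda>w. F w * perron_kernel N w / w)"
proof -
  define g where "g = (\<lambda>i t. a i * perron_term N (l i) (Complex \<kappa> t))"
  define h where "h = (\<lambda>w. perron_kernel N w / w)"
  define \<delta> where "\<delta> = min 1 \<kappa>"
  \<comment> \<open>The kernel bound is taken with \<eta> = 1. \<open>C\<close> may depend on N, as
    it only justifies exchanging sum and integral.\<close>
  define C where "C = 2 * (1 + 2 powr \<kappa>) * real N powr (\<kappa> + 1) * (2 / \<delta>) powr 2"
  have C0: "C \<ge> 0" by (simp add: C_def)
  have \<delta>: "0 < \<delta>" "\<delta> \<le> 1" "\<delta> \<le> \<kappa>" using \<kappa> by (auto simp: \<delta>_def)
  have nz: "Complex \<kappa> t \<noteq> 0" for t using \<kappa> by (auto simp: complex_eq_iff)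
  have h: "norm (h (Complex \<kappa> t)) \<le> C * decay 2 t" for t
  proof -
    have "norm (h (Complex \<kappa> t)) \<le>
        2 * (1 + 2 powr \<kappa>) * real N powr (\<kappa> + 1) * norm (Complex \<kappa> t) powr (- 1) / norm (Complex \<kappa> t)"
      using norm_perron_kernel_le[of N 1 "Complex \<kappa> t" \<kappa>] N \<kappa> nz
      unfolding h_def norm_divide by (intro divide_right_mono) auto
    also have "\<dots> = 2 * (1 + 2 powr \<kappa>) * real N powr (\<kappa> + 1) * norm (Complex \<kappa> t) powr (- 2)"
      using nz[of t] by (simp add: powr_minus powr_numeral power2_eq_square field_simps)
    also have "\<dots> \<le> 2 * (1 + 2 powr \<kappa>) * real N powr (\<kappa> + 1) * ((2 / \<delta>) powr 2 * decay 2 t)"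
      using norm_ge_of_Re[of \<delta> "Complex \<kappa> t"] \<delta>
      by (intro mult_left_mono powr_neg_le_decay) auto
    finally show ?thesis by (simp add: C_def mult_ac)
  qed
  have geq: "g i t = a i * of_nat (l i) powr (- Complex \<kappa> t) * h (Complex \<kappa> t)" for i t
    by (simp add: g_def h_def perron_term_def)
  have gb: "norm (g i t) \<le> norm (a i) * real (l i) powr (- \<kappa>) * (C * decay 2 t)" for i t
    using h[of t] l[of i] by (auto simp: geq norm_mult norm_of_pos_nat_powr intro!: mult_left_mono)
  have int: "integrable lborel (g i)" for i
  proof -
    have "continuous_on {w. Re w > 0} (\<lambda>w. a i * perron_term N (l i) w)"
      by (intro continuous_intros holomorphic_on_imp_continuous_on perron_term_holomorphic N l) auto
    then have "continuous_on UNIV (g i)"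
      unfolding g_def by (rule continuous_on_vertical_line[where f = "\<lambda>w. a i * perron_term N (l i) w"]) (use \<kappa> in auto)
    then show ?thesis
      using integrable_vertical[where f = "\<lambda>w. a i * perron_term N (l i) w" and \<kappa> = \<kappa> and p = 2
          and D = "norm (a i) * real (l i) powr (- \<kappa>) * C"] gb[of i]
      by (simp add: g_def mult_ac)
  qed
  have sums: "(\<lambda>i. LBINT t. g i t) sums (LBINT t. (\<Sum>i. g i t))"
  proof (rule sums_integral[OF int])
    have "summable (\<lambda>i. norm (g i t))" for t
      by (rule summable_comparison_test'[OF summable_mult2[OF sm, of "C * decay 2 t"], of 0]) (use gb in auto)
    then show "AE t in lborel. summable (\<lambda>i. norm (g i t))" by simp
    show "summable (\<lambda>i. LBINT t. norm (g i t))"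
    proof (rule summable_comparison_test'[OF summable_mult2[OF sm, of "C * (LBINT t. decay 2 t)"], of 0])
      fix i
      have "(LBINT t. norm (g i t)) \<le> (LBINT t. norm (a i) * real (l i) powr (- \<kappa>) * C * decay 2 t)"
        using gb[of i] by (intro integral_mono integrable_norm int integrable_mult_right integrable_decay) (auto simp: mult_ac)
      then show "norm (LBINT t. norm (g i t)) \<le> norm (a i) * real (l i) powr (- \<kappa>) * (C * (LBINT t. decay 2 t))"
        by (simp add: mult_ac)
    qed
  qed
  have "(\<Sum>i. g i t) = F (Complex \<kappa> t) * perron_kernel N (Complex \<kappa> t) / Complex \<kappa> t" for t
    using sums_unique[OF sums_mult2[OF F[of "Complex \<kappa> t"], of "h (Complex \<kappa> t)"]]
    by (simp add: geq h_def)
  with sums have s: "(\<lambda>i. LBINT t. g i t) sums (LBINT t. F (Complex \<kappa> t) * perron_kernel N (Complex \<kappa> t) / Complex \<kappa> t)"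
    by simp
  have "(\<lambda>i. (1 / (2 * pi)) *\<^sub>R (LBINT t. g i t)) sums vert_integral \<kappa> (\<lambda>w. F w * perron_kernel N w / w)"
    unfolding vert_integral_def by (intro sums_scaleR_right s)
  moreover have "(1 / (2 * pi)) *\<^sub>R (LBINT t. g i t) = (if l i \<le> N then a i else 0)" for i
  proof -
    have "(1 / (2 * pi)) *\<^sub>R (LBINT t. g i t) = a i * vert_integral \<kappa> (perron_term N (l i))"
      by (simp add: g_def vert_integral_def)
    then show ?thesis by (simp add: vert_integral_perron_term[OF N l \<kappa>])
  qed
  ultimately show ?thesis by simp
qed

section \<open>Growth of zeta under the Riemann Hypothesis\<close>

text \<open>This is \<open>(w - 1) \<zeta>(w)\<close>, also at \<open>w = 1\<close>, where the value of \<open>zeta\<close> itself is unspecified.\<close>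

definition zeta_reg :: "complex \<Rightarrow> complex" where
  "zeta_reg w = 1 + (\<Sum>n. taylor_rem 1 n w)"

lemma zeta_reg_holomorphic: "zeta_reg holomorphic_on {w. Re w > 0}"
  using taylor_rem_series(1)[of 1] unfolding zeta_reg_def [abs_def] by (intro holomorphic_intros) simp

lemma zeta_eq_suminf: "Re s > 1 \<Longrightarrow> (\<Sum>n. of_nat (Suc n) powr (- s)) = zeta s"
  using sums_unique[OF zeta_sums[of s]] by (simp add: powr_minus_divide del: of_nat_Suc)

text \<open>For Re s > 1 this is \<open>taylor_rem_recurrence\<close> with m = 0. It extends because
  the half-plane stays connected when 1 is removed.\<close>

lemma zeta_reg_eq:
  assumes "Re s > 0" "s \<noteq> 1"
  shows "zeta_reg s = (s - 1) * zeta s"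
proof (rule analytic_continuation_open[where s = "{s. Re s > 1}" and s' = "{s. Re s > 0} - {1}"
      and f = zeta_reg and g = "\<lambda>s. (s - 1) * zeta s"])
  show "open {s. Re s > 1}" "open ({s. Re s > 0} - {1})"
    by (auto intro!: open_halfspace_Re_gt open_Diff)
  have "(2::complex) \<in> {s. Re s > 1}" by simp
  then show "{s. Re s > 1} \<noteq> ({} :: complex set)" by blast
  show "connected ({s. Re s > 0} - {1})"
    by (intro connected_open_delete open_halfspace_Re_gt convex_connected convex_halfspace_Re_gt) simp
  show "{s. Re s > 1} \<subseteq> {s. Re s > 0} - {1}" by auto
  show "zeta_reg holomorphic_on {s. Re s > 0} - {1}"
    by (rule holomorphic_on_subset[OF zeta_reg_holomorphic]) auto
  show "(\<lambda>s. (s - 1) * zeta s) holomorphic_on {s. Re s > 0} - {1}"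
    by (intro holomorphic_intros holomorphic_on_subset[OF zeta_holomorphic]) auto
  show "zeta_reg z = (z - 1) * zeta z" if "z \<in> {s. Re s > 1}" for z
    using taylor_rem_recurrence[of z 0] that by (simp add: zeta_reg_def zeta_eq_suminf del: of_nat_Suc)
  show "s \<in> {s. Re s > 0} - {1}" using assms by simp
qed

text \<open>This value is the residue of zeta at 1; it enters the residue of the Perron integrand at
  1/a.\<close>

lemma zeta_reg_1: "zeta_reg 1 = 1"
proof -
  have "taylor_rem 1 n 1 = 0" for n
    by (simp add: taylor_rem_def del: of_nat_Suc)
  then show ?thesis by (simp add: zeta_reg_def)
qed

text \<open>The constant in \<open>taylor_rem_bound\<close> depends on a bound for |s|, whereas
  growth in vertical strips needs the dependence on s explicitly. It comes from the second
  derivative of z^(1-s) in the first-order Taylor formula.\<close>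

lemma norm_taylor_rem_1_le:
  "norm (taylor_rem 1 n s) \<le> norm s * norm (s - 1) * real (Suc n) powr (- Re s - 1)" if "Re s \<ge> -1"
proof -
  define N where "N = real (Suc n)"
  have N: "N \<ge> 1" by (simp add: N_def)
  define f where "f = (\<lambda>(i::nat) (z::complex). if i = 0 then z powr (1 - s) else
      if i = 1 then (1 - s) * z powr (- s) else (1 - s) * ((- s) * z powr (- s - 1)))"
  define S where "S = closed_segment (complex_of_real N) (of_real (N + 1))"
  have S: "z \<in> \<real> \<and> Re z \<ge> N" if "z \<in> S" for z
    using that closed_segment_same_Im[of "complex_of_real N" "complex_of_real (N+1)"]
    unfolding S_def
    by (auto simp: closed_segment_of_real closed_segment_eq_real_ivl complex_is_Real_iff)
  have "norm (f 0 (of_real (N + 1)) -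
           (\<Sum>i\<le>1. f i (of_real N) * (of_real (N + 1) - of_real N) ^ i / fact i)) \<le>
        (norm s * norm (s - 1) * N powr (- Re s - 1)) * norm (of_real (N + 1) - of_real N :: complex) ^ Suc 1 / fact 1"
  proof (rule field_Taylor[where S = S])
    show "convex S" by (simp add: S_def)
    show "complex_of_real N \<in> S" "complex_of_real (N + 1) \<in> S"
      by (simp_all add: S_def)
  next
    fix i :: nat and z assume z: "z \<in> S" "i \<le> 1"
    have z0: "z \<notin> \<real>\<^sub>\<le>\<^sub>0"
      using S[OF z(1)] N by (auto simp: complex_nonpos_Reals_iff)
    have "((\<lambda>z. z powr (1 - s)) has_field_derivative (1 - s) * z powr (1 - s - 1)) (at z within S)"
      by (intro has_field_derivative_at_within[OF has_field_derivative_powr] z0)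
    moreover have "((\<lambda>z. (1 - s) * z powr (- s)) has_field_derivative (1 - s) * ((- s) * z powr (- s - 1))) (at z within S)"
      by (intro DERIV_cmult has_field_derivative_at_within[OF has_field_derivative_powr] z0)
    ultimately show "(f i has_field_derivative f (Suc i) z) (at z within S)"
      using z(2) by (cases i) (auto simp: f_def)
  next
    fix z assume z: "z \<in> S"
    have z': "z \<in> \<real>" "Re z \<ge> N" using S[OF z] by auto
    have "norm (z powr (- s - 1)) = Re z powr (- Re s - 1)"
      using z' N by (subst norm_powr_real_powr) auto
    also have "\<dots> \<le> N powr (- Re s - 1)"
      using z' N that by (intro powr_mono2') auto
    finally have "norm (z powr (- s - 1)) \<le> N powr (- Re s - 1)" .
    then have "norm s * norm (s - 1) * norm (z powr (- s - 1)) \<le> norm s * norm (s - 1) * N powr (- Re s - 1)"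
      by (intro mult_left_mono) auto
    then show "norm (f (Suc 1) z) \<le> norm s * norm (s - 1) * N powr (- Re s - 1)"
      by (simp add: f_def norm_mult norm_minus_commute mult_ac)
  qed
  moreover have "f 0 (of_real (N + 1)) -
           (\<Sum>i\<le>1. f i (of_real N) * (of_real (N + 1) - of_real N) ^ i / fact i) = taylor_rem 1 n s"
    by (simp add: f_def taylor_rem_def N_def add_ac)
  ultimately show ?thesis
    by (simp add: N_def)
qed

lemma norm_zeta_reg_le:
  "\<exists>C\<ge>0. \<forall>s. Re s \<ge> 1/2 \<longrightarrow> norm (zeta_reg s) \<le> 1 + C * norm s * norm (s - 1)"
proof -
  have "summable (\<lambda>n. real n powr (-3/2))"
    by (subst summable_real_powr_iff) auto
  then have sm: "summable (\<lambda>n. real (Suc n) powr (-3/2))"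
    by (subst summable_Suc_iff)
  define C where "C = (\<Sum>n. real (Suc n) powr (-3/2))"
  have "C \<ge> 0" unfolding C_def by (intro suminf_nonneg sm) auto
  moreover have "norm (zeta_reg s) \<le> 1 + C * norm s * norm (s - 1)" if s: "Re s \<ge> 1/2" for s
  proof -
    have "norm (\<Sum>n. taylor_rem 1 n s) \<le> (\<Sum>n. norm s * norm (s - 1) * real (Suc n) powr (-3/2))"
    proof (rule norm_suminf_le[OF _ summable_mult[OF sm]])
      fix n
      have "norm (taylor_rem 1 n s) \<le> norm s * norm (s - 1) * real (Suc n) powr (- Re s - 1)"
        using s by (intro norm_taylor_rem_1_le) auto
      also have "\<dots> \<le> norm s * norm (s - 1) * real (Suc n) powr (-3/2)"
        using s by (intro mult_left_mono powr_mono) auto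
      finally show "norm (taylor_rem 1 n s) \<le> norm s * norm (s - 1) * real (Suc n) powr (-3/2)" .
    qed
    also have "\<dots> = norm s * norm (s - 1) * C"
      unfolding C_def by (rule suminf_mult[OF sm])
    finally show ?thesis
      unfolding zeta_reg_def using norm_triangle_ineq[of 1 "\<Sum>n. taylor_rem 1 n s"] by (simp add: mult_ac)
  qed
  ultimately show ?thesis by blast
qed

text \<open>For n \<ge> 2 one has n^(-3) \<le> 1 / (2 (n - 1) n), and the sum of the right-hand
  sides telescopes to 1/2.\<close>

lemma norm_zeta_minus_1_le:
  assumes "Re s \<ge> 3"
  shows "norm (zeta s - 1) \<le> 1/2"
proof -
  have "(\<lambda>n. 1 / of_nat (Suc (Suc n)) powr s) sums (zeta s - 1)"
    using zeta_sums[of s] assms by (subst sums_Suc_iff) simp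
  have tele: "(\<lambda>n. 1/2 * (1 / real (Suc n) - 1 / real (Suc (Suc n)))) sums (1/2 * (1 / real (Suc 0) - 0))"
    by (intro sums_mult telescope_sums' LIMSEQ_Suc lim_1_over_n)
  have "norm (\<Sum>n. 1 / of_nat (Suc (Suc n)) powr s) \<le> (\<Sum>n. 1/2 * (1 / real (Suc n) - 1 / real (Suc (Suc n))))"
  proof (rule norm_suminf_le[OF _ sums_summable[OF tele]])
    fix n
    define N where "N = real (Suc (Suc n))"
    have N: "N \<ge> 2" by (simp add: N_def)
    have "norm (1 / of_nat (Suc (Suc n)) powr s) = 1 / N powr Re s"
      by (simp add: norm_divide norm_of_nat_powr N_def del: of_nat_Suc)
    also have "\<dots> \<le> 1 / N powr 3"
      using assms N by (intro divide_left_mono powr_mono) auto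
    also have "\<dots> = 1 / N ^ 3" using N by simp
    also have "\<dots> \<le> 1 / (2 * ((N - 1) * N))"
    proof (rule divide_left_mono)
      have "2 * ((N - 1) * N) \<le> N * (N * N)" using N by (intro mult_mono) auto
      then show "2 * ((N - 1) * N) \<le> N ^ 3" by (simp add: power3_eq_cube)
    qed (use N in auto)
    also have "\<dots> = 1/2 * (1 / (N - 1) - 1 / N)" using N by (simp add: field_simps)
    finally show "norm (1 / of_nat (Suc (Suc n)) powr s) \<le> 1/2 * (1 / real (Suc n) - 1 / real (Suc (Suc n)))"
      by (simp add: N_def)
  qed
  also have "\<dots> = 1/2" using sums_unique[OF tele] by simp
  finally show ?thesis
    using sums_unique[OF \<open>_ sums (zeta s - 1)\<close>] by simp
qed

lemma abs_ln_norm_zeta_le: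
  assumes "Re s \<ge> 3"
  shows "\<bar>ln (norm (zeta s))\<bar> \<le> ln 2"
proof -
  have *: "norm (zeta s) \<ge> 1/2" "norm (zeta s) \<le> 2"
    using norm_zeta_minus_1_le[OF assms] norm_triangle_ineq2[of 1 "1 - zeta s"]
      norm_triangle_ineq[of 1 "zeta s - 1"] by (auto simp: norm_minus_commute)
  then have "ln (1/2) \<le> ln (norm (zeta s))" by (subst ln_le_cancel_iff) auto
  moreover have "ln (norm (zeta s)) \<le> ln 2" using * by (subst ln_le_cancel_iff) auto
  ultimately show ?thesis by (simp add: ln_div)
qed

lemma zeta_nonzero_RH:
  assumes "Riemann_Hypothesis" "Re s > 1/2" "s \<noteq> 1"
  shows "zeta s \<noteq> 0"
proof
  assume "zeta s = 0"
  moreover have "\<nexists>n::nat. n > 0 \<and> s = - 2 * of_nat n" using assms(2) by auto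
  ultimately have "Re s = 1/2" using assms unfolding Riemann_Hypothesis_def by blast
  with assms show False by simp
qed

text \<open>If \<open>g\<close> were not constant on U, the open image would contain the point (1 +
  e/2) g(z), of modulus greater than 1.\<close>

lemma holomorphic_norm_1_constant:
  assumes "g holomorphic_on S" "open S" "connected S" "open U" "connected U" "U \<noteq> {}" "U \<subseteq> S"
    and "\<And>z. z \<in> U \<Longrightarrow> norm (g z) = 1"
  obtains c where "norm c = 1" "\<And>z. z \<in> S \<Longrightarrow> g z = c"
proof -
  have "g constant_on U"
  proof (rule ccontr)
    assume "\<not> g constant_on U"
    then have "open (g ` U)"
      using assms by (intro open_mapping_thm[of g U U]) (auto intro: holomorphic_on_subset)
    moreover obtain z where z: "z \<in> U" using assms(6) by blast
    ultimately obtain e where e: "e > 0" "ball (g z) e \<subseteq> g ` U"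
      using open_contains_ball by blast
    define w where "w = g z + of_real (e / 2) * g z"
    have "w \<in> ball (g z) e"
      using e(1) assms(8)[OF z] by (simp add: w_def dist_norm norm_mult)
    then have "norm w = 1" using e(2) assms(8) by fastforce
    moreover have "w = of_real (1 + e / 2) * g z" by (simp add: w_def algebra_simps)
    ultimately have "\<bar>1 + e / 2\<bar> = 1"
      using assms(8)[OF z] by (simp only: norm_mult norm_of_real mult_1_right)
    with e(1) show False by simp
  qed
  then obtain c where c: "\<And>z. z \<in> U \<Longrightarrow> g z = c" unfolding constant_on_def by blast
  show ?thesis
  proof (rule that[of c])
    obtain z where "z \<in> U" using assms(6) by blast
    then show "norm c = 1" using assms(8)[of z] c[of z] by simp
    show "g z = c" if "z \<in> S" for z
      by (rule analytic_continuation_open[OF assms(4,2,6,3,7,1) holomorphic_on_const c that])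
  qed
qed

text \<open>The exponent 1 is immaterial: in \<open>zeta_subpolynomial\<close> only the logarithm of
  this bound, divided by ln |Im s|, has to stay bounded.\<close>

lemma norm_zeta_le_linear:
  "\<exists>C\<ge>1. \<forall>s. 1/2 \<le> Re s \<and> Re s \<le> B \<and> \<bar>Im s\<bar> \<ge> 1 \<longrightarrow> norm (zeta s) \<le> C * \<bar>Im s\<bar>"
proof -
  obtain C where C: "C \<ge> 0" "\<And>s. Re s \<ge> 1/2 \<Longrightarrow> norm (zeta_reg s) \<le> 1 + C * norm s * norm (s - 1)"
    using norm_zeta_reg_le by blast
  have "norm (zeta s) \<le> (2 + C * (\<bar>B\<bar> + 1)) * \<bar>Im s\<bar>" if s: "1/2 \<le> Re s" "Re s \<le> B" "\<bar>Im s\<bar> \<ge> 1" for s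
  proof -
    have s1: "norm (s - 1) \<ge> 1" using abs_Im_le_cmod[of "s - 1"] s by simp
    then have "s \<noteq> 1" by auto
    have "\<bar>B\<bar> * 1 \<le> \<bar>B\<bar> * \<bar>Im s\<bar>" using s by (intro mult_left_mono) auto
    moreover have "norm s \<le> \<bar>B\<bar> + \<bar>Im s\<bar>"
      using cmod_le[of s] s by linarith
    ultimately have ns: "norm s \<le> (\<bar>B\<bar> + 1) * \<bar>Im s\<bar>"
      unfolding distrib_right by linarith
    have "norm (s - 1) * norm (zeta s) = norm (zeta_reg s)"
      using zeta_reg_eq[of s] s \<open>s \<noteq> 1\<close> by (simp add: norm_mult)
    also have "\<dots> \<le> 1 + C * norm s * norm (s - 1)" using C(2) s by simp
    also have "\<dots> \<le> norm (s - 1) * (1 + C * norm s)" using s1 by (simp add: algebra_simps)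
    finally have "norm (zeta s) \<le> 1 + C * norm s"
      using s1 by (subst (asm) mult_le_cancel_left_pos) auto
    also have "\<dots> \<le> 2 * \<bar>Im s\<bar> + C * ((\<bar>B\<bar> + 1) * \<bar>Im s\<bar>)"
      using ns s C(1) by (intro add_mono mult_left_mono) auto
    finally show ?thesis by (simp add: algebra_simps)
  qed
  then show ?thesis using C(1) by (intro exI[of _ "2 + C * (\<bar>B\<bar> + 1)"]) (auto intro!: order_trans[OF _ add_mono[of 2 2 0]])
qed


text \<open>
  If the bound failed along \<open>s\<^sub>n\<close> with \<open>t\<^sub>n = Im s\<^sub>n \<rightarrow> \<infinity>\<close>, apply Montel's theorem to the branches of
  \<open>\<zeta>(z + it\<^sub>n)\<close> to the power \<open>1 / ln t\<^sub>n\<close>, which are bounded because zeta is of polynomial growth.  A limit function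
  has modulus 1 for \<open>Re z > 3\<close>, hence is constant, and so \<open>ln |\<zeta>(s\<^sub>n)| / ln t\<^sub>n \<rightarrow> 0\<close> along a subsequence.
\<close>

lemma zeta_subpolynomial:
  assumes RH: "Riemann_Hypothesis" and \<delta>: "\<delta> > 0" and \<epsilon>: "\<epsilon> > 0"
  shows "\<exists>T\<ge>1. \<forall>s. 1/2 + \<delta> \<le> Re s \<and> Re s \<le> B \<and> \<bar>Im s\<bar> \<ge> T \<longrightarrow>
           \<bar>ln (norm (zeta s))\<bar> \<le> \<epsilon> * ln \<bar>Im s\<bar>"
proof (rule ccontr)
  assume contra: "\<not> ?thesis"
  \<comment> \<open>The offset 3 exceeds e, which gives \<open>L n \<ge> 1\<close>, and it leaves
    imaginary parts of size at least 2 after a displacement by less than 1.\<close>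
  have "\<exists>s. 1/2 + \<delta> \<le> Re s \<and> Re s \<le> B \<and> \<bar>Im s\<bar> \<ge> real n + 3 \<and>
           \<bar>ln (norm (zeta s))\<bar> > \<epsilon> * ln \<bar>Im s\<bar>" for n
    using contra[simplified, rule_format, of "real n + 3"] by (auto simp: not_le)
  then obtain u where u: "\<And>n. 1/2 + \<delta> \<le> Re (u n)" "\<And>n. Re (u n) \<le> B" "\<And>n. \<bar>Im (u n)\<bar> \<ge> real n + 3"
    "\<And>n. \<bar>ln (norm (zeta (u n)))\<bar> > \<epsilon> * ln \<bar>Im (u n)\<bar>"
    by metis
  define \<tau> where "\<tau> = (\<lambda>n. Im (u n))"
  define L where "L = (\<lambda>n. ln \<bar>\<tau> n\<bar>)"
  have \<tau>3: "\<bar>\<tau> n\<bar> \<ge> 3" for n using u(3)[of n] by (simp add: \<tau>_def)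
  have L1: "L n \<ge> 1" for n
  proof -
    have "ln (exp 1) \<le> L n"
      unfolding L_def using \<tau>3[of n] exp_le by (subst ln_le_cancel_iff) auto
    then show ?thesis by simp
  qed
  have L_lim: "filterlim L at_top sequentially"
  proof (rule filterlim_at_top_mono)
    show "filterlim (\<lambda>n::nat. ln (real n + 3)) at_top sequentially" by real_asymp
    show "\<forall>\<^sub>F n in sequentially. ln (real n + 3) \<le> L n"
    proof (intro always_eventually allI)
      fix n
      show "ln (real n + 3) \<le> L n"
        unfolding L_def \<tau>_def using u(3)[of n] by (intro ln_mono) auto
    qed
  qed
  \<comment> \<open>With B > 1/2, the edge \<open>B + 5\<close> makes the strip reach beyond Re z =
    3, where the limit function can be identified.\<close>
  define S where "S = {z. 1/2 < Re z \<and> Re z < B + 5 \<and> \<bar>Im z\<bar> < 1}"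
  define U where "U = {z. 3 < Re z \<and> Re z < B + 5 \<and> \<bar>Im z\<bar> < 1}"
  have box: "{z. a < Re z \<and> Re z < b \<and> \<bar>Im z\<bar> < 1} = box (Complex a (-1)) (Complex b 1)" for a b
    by (auto simp: in_box_complex_iff)
  have S: "open S" "convex S" "connected S" and U: "open U" "connected U"
    unfolding S_def U_def box by (auto simp: convex_box convex_connected)
  have B: "B > 1/2" using u(1,2)[of 0] \<delta> by linarith
  have "Complex 4 0 \<in> U" using B by (simp add: U_def)
  then have U0: "U \<noteq> {}" by blast
  have US: "U \<subseteq> S" by (auto simp: U_def S_def)
  define v where "v = (\<lambda>n z. z + \<i> * of_real (\<tau> n))"
  have v: "Re (v n z) = Re z" "\<bar>Im (v n z)\<bar> \<ge> 2" "\<bar>Im (v n z)\<bar> \<le> 2 * \<bar>\<tau> n\<bar>" "v n z \<noteq> 1" "Re (v n z) > 1/2" "Re (v n z) \<le> B + 5"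
    if "z \<in> S" for n z
  proof -
    show *: "\<bar>Im (v n z)\<bar> \<ge> 2" "\<bar>Im (v n z)\<bar> \<le> 2 * \<bar>\<tau> n\<bar>" using that \<tau>3[of n] by (auto simp: v_def S_def)
    from *(1) show "v n z \<noteq> 1" by auto
  qed (use that in \<open>auto simp: v_def S_def\<close>)
  have nz: "zeta (v n z) \<noteq> 0" if "z \<in> S" for n z
    using zeta_nonzero_RH[OF RH] v[OF that] by blast
  have "\<exists>h. h holomorphic_on S \<and> (\<forall>z\<in>S. zeta (v n z) = exp (h z))" for n
  proof -
    have "(zeta \<circ> v n) holomorphic_on S"
    proof (rule holomorphic_on_compose_gen[OF _ zeta_holomorphic])
      show "v n holomorphic_on S" unfolding v_def by (intro holomorphic_intros)
    qed (use v(4) in auto)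
    from contractible_imp_holomorphic_log[OF this convex_imp_contractible[OF S(2)]]
    show ?thesis using nz by (metis comp_apply)
  qed
  then obtain h where h: "\<And>n. h n holomorphic_on S" "\<And>n z. z \<in> S \<Longrightarrow> zeta (v n z) = exp (h n z)"
    by metis
  define g where "g = (\<lambda>n z. exp (h n z / of_real (L n)))"
  have ng: "norm (g n z) = exp (ln (norm (zeta (v n z))) / L n)" if "z \<in> S" for n z
    using h(2)[OF that, of n] by (simp add: g_def)
  obtain C where C: "C \<ge> 1" "\<And>s. 1/2 \<le> Re s \<Longrightarrow> Re s \<le> B + 5 \<Longrightarrow> \<bar>Im s\<bar> \<ge> 1 \<Longrightarrow> norm (zeta s) \<le> C * \<bar>Im s\<bar>"
    using norm_zeta_le_linear[of "B + 5"] by blast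
  have gbd: "norm (g n z) \<le> exp (ln (C * 2) + 1)" if z: "z \<in> S" for n z
  proof -
    have "norm (zeta (v n z)) \<le> C * \<bar>Im (v n z)\<bar>" using v[OF z, of n] by (intro C) auto
    also have "\<dots> \<le> C * (2 * \<bar>\<tau> n\<bar>)" using v[OF z, of n] C by (intro mult_left_mono) auto
    finally have "ln (norm (zeta (v n z))) \<le> ln (C * 2 * \<bar>\<tau> n\<bar>)"
      using nz[OF z, of n] by (subst ln_le_cancel_iff) (use C \<tau>3[of n] in \<open>auto simp: mult_ac\<close>)
    also have "\<dots> = ln (C * 2) + L n" unfolding L_def using C \<tau>3[of n] by (subst ln_mult) auto
    finally have "ln (norm (zeta (v n z))) / L n \<le> (ln (C * 2) + L n) / L n"
      using L1[of n] by (intro divide_right_mono) auto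
    also have "\<dots> = ln (C * 2) / L n + 1" using L1[of n] by (simp add: field_simps)
    also have "ln (C * 2) / L n \<le> ln (C * 2) / 1"
      using L1[of n] C by (intro divide_left_mono) auto
    finally show ?thesis using ng[OF z, of n] by simp
  qed
  obtain G r where G: "G holomorphic_on S" "strict_mono (r :: nat \<Rightarrow> nat)"
    "\<And>x. x \<in> S \<Longrightarrow> ((\<lambda>n. g (r n) x) \<longlongrightarrow> G x) sequentially"
    "\<And>K. compact K \<Longrightarrow> K \<subseteq> S \<Longrightarrow> uniform_limit K (g \<circ> r) G sequentially"
  proof (rule Montel[OF S(1), of "range g" g])
    show "f holomorphic_on S" if "f \<in> range g" for f
      using that h(1) by (auto simp: g_def intro!: holomorphic_intros)
    show "\<exists>B. \<forall>f\<in>range g. \<forall>z\<in>K. norm (f z) \<le> B" if "compact K" "K \<subseteq> S" for K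
      using gbd that by blast
  qed auto
  have "norm (G z) = 1" if "z \<in> U" for z
  proof (rule LIMSEQ_unique)
    show "(\<lambda>n. norm (g (r n) z)) \<longlonglongrightarrow> norm (G z)"
      using G(3) that US by (intro tendsto_norm) auto
    have "(\<lambda>n. ln (norm (zeta (v (r n) z))) / L (r n)) \<longlonglongrightarrow> 0"
    proof (rule tendsto_rabs_zero_cancel, rule tendsto_sandwich[OF _ _ tendsto_const])
      show "\<forall>\<^sub>F n in sequentially. 0 \<le> \<bar>ln (norm (zeta (v (r n) z))) / L (r n)\<bar>" by simp
      show "\<forall>\<^sub>F n in sequentially. \<bar>ln (norm (zeta (v (r n) z))) / L (r n)\<bar> \<le> ln 2 / L (r n)"
      proof (intro always_eventually allI)
        fix n
        have "\<bar>ln (norm (zeta (v (r n) z)))\<bar> \<le> ln 2"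
          using that by (intro abs_ln_norm_zeta_le) (auto simp: v_def U_def)
        then show "\<bar>ln (norm (zeta (v (r n) z))) / L (r n)\<bar> \<le> ln 2 / L (r n)"
          using L1[of "r n"] by (simp add: divide_right_mono)
      qed
      have "filterlim (\<lambda>n. L (r n)) at_top sequentially"
        by (rule filterlim_compose[OF L_lim filterlim_subseq[OF G(2)]])
      then show "(\<lambda>n. ln 2 / L (r n)) \<longlonglongrightarrow> 0"
        by (intro tendsto_divide_0[OF tendsto_const] filterlim_at_top_imp_at_infinity)
    qed
    then have "(\<lambda>n. exp (ln (norm (zeta (v (r n) z))) / L (r n))) \<longlonglongrightarrow> exp 0"
      by (rule tendsto_exp)
    then show "(\<lambda>n. norm (g (r n) z)) \<longlonglongrightarrow> 1"
      using ng[of z] that US by (auto simp: subset_iff)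
  qed
  \<comment> \<open>Only an upper bound for zeta was put in, but modulus 1 of the limit controls the
    logarithm from both sides and so covers 1/zeta too.\<close>
  then obtain c where c: "norm c = 1" "\<And>z. z \<in> S \<Longrightarrow> G z = c"
    using holomorphic_norm_1_constant[OF G(1) S(1,3) U U0 US] by metis
  \<comment> \<open>The real parts of the points \<open>u n\<close> vary with n, so uniform
    convergence on a real segment containing all of them is needed.\<close>
  define K where "K = cbox (Complex (1/2 + \<delta>) 0) (Complex B 0)"
  have KS: "K \<subseteq> S" using \<delta> by (auto simp: K_def S_def in_cbox_complex_iff)
  have "uniform_limit K (g \<circ> r) G sequentially"
    by (rule G(4)[OF _ KS]) (simp add: K_def compact_cbox)
  \<comment> \<open>This threshold is chosen because |q| > \<epsilon> forces |exp q - 1| to exceed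
    it: directly if q < -\<epsilon>, and through exp \<epsilon> - 1 \<ge> \<epsilon> \<ge> 1 - exp
    (-\<epsilon>) if q > \<epsilon>.\<close>
  moreover have "1 - exp (-\<epsilon>) > 0" using \<epsilon> by simp
  ultimately have "\<forall>\<^sub>F n in sequentially. \<forall>x\<in>K. dist ((g \<circ> r) n x) (G x) < 1 - exp (-\<epsilon>)"
    unfolding uniform_limit_iff by blast
  then obtain n where n: "\<forall>x\<in>K. dist (g (r n) x) (G x) < 1 - exp (-\<epsilon>)"
    unfolding eventually_sequentially by auto
  define x where "x = Complex (Re (u (r n))) 0"
  have xK: "x \<in> K" using u(1,2)[of "r n"] by (auto simp: K_def x_def in_cbox_complex_iff)
  then have xS: "x \<in> S" using KS by blast
  have vx: "v (r n) x = u (r n)" by (auto simp: v_def x_def \<tau>_def complex_eq_iff)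
  define q where "q = ln (norm (zeta (u (r n)))) / L (r n)"
  have "\<bar>norm (g (r n) x) - norm (G x)\<bar> < 1 - exp (-\<epsilon>)"
    using n xK norm_triangle_ineq3[of "g (r n) x" "G x"] by (auto simp: dist_norm intro: le_less_trans)
  then have close: "\<bar>exp q - 1\<bar> < 1 - exp (-\<epsilon>)"
    using c xS ng[OF xS] vx by (simp add: q_def)
  have "\<bar>q\<bar> > \<epsilon>"
    using u(4)[of "r n"] L1[of "r n"] by (simp add: q_def L_def \<tau>_def pos_less_divide_eq abs_of_pos)
  then consider "q > \<epsilon>" | "q < -\<epsilon>" by linarith
  then show False
  proof cases
    case 1
    then have "exp q > exp \<epsilon>" by simp
    moreover have "exp \<epsilon> \<ge> 1 + \<epsilon>" "exp (-\<epsilon>) \<ge> 1 - \<epsilon>"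
      using exp_ge_add_one_self[of \<epsilon>] exp_ge_add_one_self[of "-\<epsilon>"] by auto
    ultimately show False using close by linarith
  next
    case 2
    then have "exp q < exp (-\<epsilon>)" by simp
    then show False using close by linarith
  qed
qed


text \<open>This is \<open>1/\<zeta>\<close>, continued by \<open>0\<close> to the pole of zeta.\<close>

definition zeta_inv :: "complex \<Rightarrow> complex" where
  "zeta_inv w = (w - 1) / zeta_reg w"

lemma zeta_inv_eq: "Re w > 0 \<Longrightarrow> w \<noteq> 1 \<Longrightarrow> zeta_inv w = 1 / zeta w"
  by (simp add: zeta_inv_def zeta_reg_eq)

lemma zeta_reg_nonzero:
  assumes "Riemann_Hypothesis" "Re w > 1/2"
  shows "zeta_reg w \<noteq> 0"
proof (cases "w = 1")
  case False
  then show ?thesis using zeta_nonzero_RH[OF assms False] zeta_reg_eq[of w] assms by auto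
qed (simp add: zeta_reg_1)

lemma zeta_inv_holomorphic:
  assumes "Riemann_Hypothesis"
  shows "zeta_inv holomorphic_on {w. Re w > 1/2}"
  unfolding zeta_inv_def
  by (intro holomorphic_intros holomorphic_on_subset[OF zeta_reg_holomorphic])
     (use zeta_reg_nonzero[OF assms] in auto)

text \<open>The rectangle below height T is compact, and e \<ge> 0 keeps the growth factor at least
  1 there.\<close>

lemma strip_growth_bound:
  fixes f :: "complex \<Rightarrow> complex"
  assumes cont: "continuous_on {w. \<alpha> \<le> Re w \<and> Re w \<le> B} f" and e: "e \<ge> 0"
    and bd: "\<And>w. \<alpha> \<le> Re w \<Longrightarrow> Re w \<le> B \<Longrightarrow> \<bar>Im w\<bar> \<ge> T \<Longrightarrow> norm (f w) \<le> C * (1 + \<bar>Im w\<bar>) powr e"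
  shows "\<exists>C\<ge>0. \<forall>w. \<alpha> \<le> Re w \<and> Re w \<le> B \<longrightarrow> norm (f w) \<le> C * (1 + \<bar>Im w\<bar>) powr e"
proof -
  have "bounded (f ` cbox (Complex \<alpha> (-T)) (Complex B T))"
    by (intro compact_imp_bounded compact_continuous_image compact_cbox continuous_on_subset[OF cont])
       (auto simp: in_cbox_complex_iff)
  then obtain M where M: "\<And>w. w \<in> cbox (Complex \<alpha> (-T)) (Complex B T) \<Longrightarrow> norm (f w) \<le> M"
    unfolding bounded_iff by blast
  have "norm (f w) \<le> (\<bar>M\<bar> + \<bar>C\<bar>) * (1 + \<bar>Im w\<bar>) powr e" if w: "\<alpha> \<le> Re w" "Re w \<le> B" for w
  proof (cases "\<bar>Im w\<bar> \<ge> T")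
    case True
    have "C * (1 + \<bar>Im w\<bar>) powr e \<le> (\<bar>M\<bar> + \<bar>C\<bar>) * (1 + \<bar>Im w\<bar>) powr e"
      by (intro mult_right_mono) auto
    with bd[OF w True] show ?thesis by linarith
  next
    case False
    then have "norm (f w) \<le> M" using w by (intro M) (auto simp: in_cbox_complex_iff)
    moreover have "1 \<le> (1 + \<bar>Im w\<bar>) powr e" using e by (intro ge_one_powr_ge_zero) auto
    then have "(\<bar>M\<bar> + \<bar>C\<bar>) * 1 \<le> (\<bar>M\<bar> + \<bar>C\<bar>) * (1 + \<bar>Im w\<bar>) powr e" by (intro mult_left_mono) auto
    moreover have "M \<le> \<bar>M\<bar> + \<bar>C\<bar>" by linarith
    ultimately show ?thesis by simp
  qed
  then show ?thesis by (intro exI[of _ "\<bar>M\<bar> + \<bar>C\<bar>"]) auto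
qed

text \<open>Both bounds follow from \<open>zeta_subpolynomial\<close>, which controls ln |zeta| from
  both sides; the factor w - 1 in \<open>zeta_reg\<close> accounts for the additional exponent
  1.\<close>

lemma
  assumes RH: "Riemann_Hypothesis" and \<delta>: "\<delta> > 0" and \<epsilon>: "\<epsilon> > 0"
  shows zeta_inv_growth: "\<exists>C\<ge>0. \<forall>w. 1/2 + \<delta> \<le> Re w \<and> Re w \<le> B \<longrightarrow> norm (zeta_inv w) \<le> C * (1 + \<bar>Im w\<bar>) powr \<epsilon>"
    and zeta_reg_growth: "\<exists>C\<ge>0. \<forall>w. 1/2 + \<delta> \<le> Re w \<and> Re w \<le> B \<longrightarrow> norm (zeta_reg w) \<le> C * (1 + \<bar>Im w\<bar>) powr (1 + \<epsilon>)"
proof -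
  obtain T where T: "T \<ge> 1" "\<And>s. 1/2 + \<delta> \<le> Re s \<Longrightarrow> Re s \<le> B \<Longrightarrow> \<bar>Im s\<bar> \<ge> T \<Longrightarrow> \<bar>ln (norm (zeta s))\<bar> \<le> \<epsilon> * ln \<bar>Im s\<bar>"
    using zeta_subpolynomial[OF RH \<delta> \<epsilon>, of B] by blast
  have large: "norm (zeta w) \<le> (1 + \<bar>Im w\<bar>) powr \<epsilon>" "1 / norm (zeta w) \<le> (1 + \<bar>Im w\<bar>) powr \<epsilon>" "w \<noteq> 1"
    if w: "1/2 + \<delta> \<le> Re w" "Re w \<le> B" "\<bar>Im w\<bar> \<ge> T" for w
  proof -
    show "w \<noteq> 1" using w T(1) by auto
    then have nz: "zeta w \<noteq> 0" using zeta_nonzero_RH[OF RH] w \<delta> by simp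
    have le: "exp (\<epsilon> * ln \<bar>Im w\<bar>) \<le> (1 + \<bar>Im w\<bar>) powr \<epsilon>"
    proof -
      have "exp (\<epsilon> * ln \<bar>Im w\<bar>) = \<bar>Im w\<bar> powr \<epsilon>" using w T(1) by (simp add: powr_def)
      also have "\<dots> \<le> (1 + \<bar>Im w\<bar>) powr \<epsilon>" using \<epsilon> by (intro powr_mono2) auto
      finally show ?thesis .
    qed
    have ln: "ln (norm (zeta w)) \<le> \<epsilon> * ln \<bar>Im w\<bar>" "- ln (norm (zeta w)) \<le> \<epsilon> * ln \<bar>Im w\<bar>"
      using T(2)[OF w] by auto
    have "norm (zeta w) = exp (ln (norm (zeta w)))" using nz by simp
    also have "\<dots> \<le> exp (\<epsilon> * ln \<bar>Im w\<bar>)" using ln by (simp only: exp_le_cancel_iff)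
    finally show "norm (zeta w) \<le> (1 + \<bar>Im w\<bar>) powr \<epsilon>" using le by linarith
    have "1 / norm (zeta w) = exp (- ln (norm (zeta w)))" using nz by (simp add: exp_minus field_simps)
    also have "\<dots> \<le> exp (\<epsilon> * ln \<bar>Im w\<bar>)" using ln by (simp only: exp_le_cancel_iff)
    finally show "1 / norm (zeta w) \<le> (1 + \<bar>Im w\<bar>) powr \<epsilon>" using le by linarith
  qed
  show "\<exists>C\<ge>0. \<forall>w. 1/2 + \<delta> \<le> Re w \<and> Re w \<le> B \<longrightarrow> norm (zeta_inv w) \<le> C * (1 + \<bar>Im w\<bar>) powr \<epsilon>"
  proof (rule strip_growth_bound[where T = T and C = 1])
    show "continuous_on {w. 1/2 + \<delta> \<le> Re w \<and> Re w \<le> B} zeta_inv"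
      by (intro holomorphic_on_imp_continuous_on holomorphic_on_subset[OF zeta_inv_holomorphic[OF RH]])
         (use \<delta> in auto)
    show "norm (zeta_inv w) \<le> 1 * (1 + \<bar>Im w\<bar>) powr \<epsilon>"
      if w: "1/2 + \<delta> \<le> Re w" "Re w \<le> B" "\<bar>Im w\<bar> \<ge> T" for w
      using large(2,3)[OF w] zeta_inv_eq[of w] w \<delta> by (simp add: norm_divide)
  qed (use \<epsilon> in auto)
  show "\<exists>C\<ge>0. \<forall>w. 1/2 + \<delta> \<le> Re w \<and> Re w \<le> B \<longrightarrow> norm (zeta_reg w) \<le> C * (1 + \<bar>Im w\<bar>) powr (1 + \<epsilon>)"
  proof (rule strip_growth_bound[where T = T and C = "\<bar>B\<bar> + 1"])
    show "continuous_on {w. 1/2 + \<delta> \<le> Re w \<and> Re w \<le> B} zeta_reg"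
      by (intro holomorphic_on_imp_continuous_on holomorphic_on_subset[OF zeta_reg_holomorphic])
         (use \<delta> in auto)
    show "norm (zeta_reg w) \<le> (\<bar>B\<bar> + 1) * (1 + \<bar>Im w\<bar>) powr (1 + \<epsilon>)"
      if w: "1/2 + \<delta> \<le> Re w" "Re w \<le> B" "\<bar>Im w\<bar> \<ge> T" for w
    proof -
      have "norm (w - 1) \<le> \<bar>Re w - 1\<bar> + \<bar>Im w\<bar>" using cmod_le[of "w - 1"] by simp
      also have "\<bar>Re w - 1\<bar> \<le> \<bar>B\<bar> + 1" using w \<delta> by linarith
      also have "\<bar>B\<bar> + 1 + \<bar>Im w\<bar> \<le> (\<bar>B\<bar> + 1) * (1 + \<bar>Im w\<bar>)"
        by (simp add: algebra_simps)
      finally have *: "norm (w - 1) \<le> (\<bar>B\<bar> + 1) * (1 + \<bar>Im w\<bar>)" by simp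
      have "norm (zeta_reg w) = norm (w - 1) * norm (zeta w)"
        using zeta_reg_eq[of w] large(3)[OF w] w \<delta> by (simp add: norm_mult)
      also have "\<dots> \<le> ((\<bar>B\<bar> + 1) * (1 + \<bar>Im w\<bar>)) * (1 + \<bar>Im w\<bar>) powr \<epsilon>"
        using * large(1)[OF w] by (intro mult_mono) auto
      also have "\<dots> = (\<bar>B\<bar> + 1) * (1 + \<bar>Im w\<bar>) powr (1 + \<epsilon>)"
        by (simp add: powr_add)
      finally show ?thesis .
    qed
  qed (use \<epsilon> in auto)
qed

section \<open>Partial sums of the coefficients of a power of 1/zeta\<close>

text \<open>\<open>mu_sums\<close> only states convergence in the given order. Absolute convergence
  comes from the coefficients constructed in \<open>mu_exists\<close>, which agree with
  \<open>mu k\<close> by uniqueness of Dirichlet series.\<close>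

lemma mu_abs_summable:
  assumes "\<sigma> > 1"
  shows "summable (\<lambda>n. \<bar>mu k (Suc n)\<bar> * real (Suc n) powr (- \<sigma>))"
proof -
  obtain f :: "nat \<Rightarrow> real" where f: "\<And>s. Re s > 1 \<Longrightarrow>
     ((\<lambda>n. of_real (f n) * of_nat n powr (- s)) has_sum (1 / zeta s ^ k)) {0<..}"
    using mu_exists[of k] by blast
  have bij: "bij_betw Suc UNIV {0<..}"
    by (rule bij_betw_byWitness[of _ "\<lambda>n. n - 1"]) auto
  have f': "((\<lambda>n. of_real (f (Suc n)) * of_nat (Suc n) powr (- s)) has_sum (1 / zeta s ^ k)) UNIV"
    if "Re s > 1" for s
    using f[OF that] has_sum_reindex_bij_betw[OF bij, of "\<lambda>n. of_real (f n) * of_nat n powr (- s)"] by blast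
  have "(\<lambda>n. f (Suc n)) = (\<lambda>n. mu k (Suc n))"
  proof (rule dirichlet_series_unique[where F = "\<lambda>s. 1 / zeta s ^ k"])
    show "(\<lambda>n. complex_of_real (f (Suc n)) / of_nat (Suc n) powr s) sums (1 / zeta s ^ k)"
      if "Re s > 1" for s
      using has_sum_imp_sums[OF f'[OF that]] by (simp add: powr_minus_divide del: of_nat_Suc)
  qed (rule mu_sums)
  then have eq: "f (Suc n) = mu k (Suc n)" for n by (rule fun_cong)
  have "(\<lambda>n. of_real (f (Suc n)) * of_nat (Suc n) powr (- complex_of_real \<sigma>)) summable_on UNIV"
    using f'[of "of_real \<sigma>"] assms by (auto simp: summable_on_def)
  then have "(\<lambda>n. norm (of_real (f (Suc n)) * of_nat (Suc n) powr (- complex_of_real \<sigma>))) summable_on UNIV"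
    by (simp only: summable_on_iff_abs_summable_on_complex)
  then have "summable (\<lambda>n. norm (of_real (f (Suc n)) * of_nat (Suc n) powr (- complex_of_real \<sigma>)))"
    by (rule summable_on_imp_summable)
  then show ?thesis
    by (simp add: norm_mult norm_of_nat_powr eq del: of_nat_Suc)
qed

lemma mu_series:
  assumes "Re s > 1"
  shows "(\<lambda>n. of_real (mu k (Suc n)) * of_nat (Suc n) powr (- s)) sums (zeta_inv s ^ k)"
proof -
  have "zeta_inv s = 1 / zeta s" using assms by (intro zeta_inv_eq) auto
  then show ?thesis
    using mu_sums[OF assms, of k] by (simp add: powr_minus_divide power_one_over del: of_nat_Suc)
qed

text \<open>This is f_y for M = \<open>\<lfloor>y\<rfloor>\<close>: the shifted index n < M stands
  for 1 \<le> l \<le> M. With \<open>zeta_inv\<close> it is holomorphic at 1 as well.\<close>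

definition mu_tail :: "nat \<Rightarrow> nat \<Rightarrow> complex \<Rightarrow> complex" where
  "mu_tail k M s = zeta_inv s ^ k - (\<Sum>n<M. of_real (mu k (Suc n)) * of_nat (Suc n) powr (- s))"

lemma mu_tail_holomorphic:
  assumes "Riemann_Hypothesis"
  shows "mu_tail k M holomorphic_on {w. Re w > 1/2}"
  unfolding mu_tail_def
  by (intro holomorphic_intros zeta_inv_holomorphic assms) (auto simp del: of_nat_Suc)

lemma zeta_inv_power_growth:
  assumes RH: "Riemann_Hypothesis" and \<delta>: "\<delta> > 0" and \<epsilon>: "\<epsilon> > 0"
  shows "\<exists>C\<ge>0. \<forall>w. 1/2 + \<delta> \<le> Re w \<and> Re w \<le> B \<longrightarrow> norm (zeta_inv w ^ k) \<le> C * (1 + \<bar>Im w\<bar>) powr \<epsilon>"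
proof -
  \<comment> \<open>Dividing by \<open>Suc k\<close> avoids a case distinction at k = 0, and the
    k-th power still has exponent at most \<epsilon>.\<close>
  have "\<epsilon> / Suc k > 0" using \<epsilon> by simp
  from zeta_inv_growth[OF RH \<delta> this, of B] obtain C where C: "C \<ge> 0"
    "\<And>w. 1/2 + \<delta> \<le> Re w \<Longrightarrow> Re w \<le> B \<Longrightarrow> norm (zeta_inv w) \<le> C * (1 + \<bar>Im w\<bar>) powr (\<epsilon> / Suc k)"
    by blast
  have "norm (zeta_inv w ^ k) \<le> C ^ k * (1 + \<bar>Im w\<bar>) powr \<epsilon>" if w: "1/2 + \<delta> \<le> Re w" "Re w \<le> B" for w
  proof -
    have "norm (zeta_inv w ^ k) \<le> (C * (1 + \<bar>Im w\<bar>) powr (\<epsilon> / Suc k)) ^ k"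
      unfolding norm_power using C(2)[OF w] by (intro power_mono) auto
    also have "\<dots> = C ^ k * (1 + \<bar>Im w\<bar>) powr (k * (\<epsilon> / Suc k))"
      by (simp add: power_mult_distrib powr_power mult.commute)
    also have "\<dots> \<le> C ^ k * (1 + \<bar>Im w\<bar>) powr \<epsilon>"
      using C(1) \<epsilon> by (intro mult_left_mono powr_mono) (auto simp: field_simps)
    finally show ?thesis .
  qed
  then show ?thesis using C(1) by (intro exI[of _ "C ^ k"]) auto
qed

text \<open>Taking \<eta> = \<delta>, the kernel contributes |w|^(-\<delta>) and the denominator
  1/|w|: an integrable weight for the price of N^\<delta>.\<close>

lemma perron_kernel_div_bound:
  assumes N: "N > 0" and \<delta>: "0 < \<delta>" "\<delta> \<le> 1" and B: "\<bar>Re w\<bar> \<le> B" and w: "norm w \<ge> \<delta> / 2 * (1 + \<bar>Im w\<bar>)"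
  shows "norm (perron_kernel N w / w) \<le> 2 * (1 + 2 powr B) * (2 / \<delta>) powr (1 + \<delta>) * real N powr (Re w + \<delta>) * decay (1 + \<delta>) (Im w)"
proof -
  have "0 < \<delta> / 2 * (1 + \<bar>Im w\<bar>)" using \<delta> by (intro mult_pos_pos) auto
  then have w0: "w \<noteq> 0" using w by auto
  have "norm (perron_kernel N w / w) \<le> 2 * (1 + 2 powr B) * real N powr (Re w + \<delta>) * norm w powr (- \<delta>) / norm w"
    unfolding norm_divide using N \<delta> B w0 by (intro divide_right_mono norm_perron_kernel_le) auto
  also have "\<dots> = 2 * (1 + 2 powr B) * real N powr (Re w + \<delta>) * norm w powr (- (1 + \<delta>))"
    using w0 by (simp add: powr_diff field_simps powr_minus)
  also have "\<dots> \<le> 2 * (1 + 2 powr B) * real N powr (Re w + \<delta>) * ((2 / \<delta>) powr (1 + \<delta>) * decay (1 + \<delta>) (Im w))"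
    using w \<delta> by (intro mult_left_mono powr_neg_le_decay) (auto intro: add_nonneg_nonneg)
  finally show ?thesis by (simp only: mult_ac)
qed

text \<open>Separates Im s from the variable of integration when a growth bound is applied at s +
  w.\<close>

lemma powr_one_plus_abs_add:
  assumes "e \<ge> 0"
  shows "(1 + \<bar>s + t\<bar>) powr e \<le> (1 + \<bar>s\<bar>) powr e * (1 + \<bar>t :: real\<bar>) powr e"
proof -
  have "(1 + \<bar>s + t\<bar>) \<le> (1 + \<bar>s\<bar>) * (1 + \<bar>t\<bar>)"
    using abs_triangle_ineq[of s t] mult_nonneg_nonneg[of "\<bar>s\<bar>" "\<bar>t\<bar>"]
    unfolding distrib_left distrib_right by linarith
  then have "(1 + \<bar>s + t\<bar>) powr e \<le> ((1 + \<bar>s\<bar>) * (1 + \<bar>t\<bar>)) powr e"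
    using assms by (intro powr_mono2) auto
  also have "\<dots> = (1 + \<bar>s\<bar>) powr e * (1 + \<bar>t\<bar>) powr e" by (rule powr_mult)
  finally show ?thesis .
qed

text \<open>The growth exponent \<delta>/4 in Im w leaves 1 + 3/4 \<delta> of the decay 1 + \<delta>
  of the kernel. The lower bound on |w| keeps the pole at 0 away.\<close>

lemma mu_perron_integrand_bound:
  assumes RH: "Riemann_Hypothesis" and \<delta>: "0 < \<delta>" "\<delta> \<le> 1"
  shows "\<exists>C\<ge>0. \<forall>N s w. N > 0 \<and> 1/2 + \<delta> \<le> Re (s + w) \<and> Re (s + w) \<le> B \<and> \<bar>Re w\<bar> \<le> B \<and> norm w \<ge> \<delta> / 2 * (1 + \<bar>Im w\<bar>) \<longrightarrow>
     norm (zeta_inv (s + w) ^ k * perron_kernel N w / w) \<le>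
       C * (1 + \<bar>Im s\<bar>) powr (\<delta>/4) * real N powr (Re w + \<delta>) * decay (1 + 3/4 * \<delta>) (Im w)"
proof -
  obtain C where C: "C \<ge> 0" "\<And>w. 1/2 + \<delta> \<le> Re w \<Longrightarrow> Re w \<le> B \<Longrightarrow> norm (zeta_inv w ^ k) \<le> C * (1 + \<bar>Im w\<bar>) powr (\<delta>/4)"
    using zeta_inv_power_growth[OF RH \<delta>(1), of "\<delta>/4" B k] \<delta> by auto
  define C2 where "C2 = 2 * (1 + 2 powr B) * (2 / \<delta>) powr (1 + \<delta>)"
  have C2: "C2 \<ge> 0" by (auto simp: C2_def intro!: mult_nonneg_nonneg add_nonneg_nonneg)
  have "norm (zeta_inv (s + w) ^ k * perron_kernel N w / w) \<le>
       C * C2 * (1 + \<bar>Im s\<bar>) powr (\<delta>/4) * real N powr (Re w + \<delta>) * decay (1 + 3/4 * \<delta>) (Im w)"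
    if "N > 0" "1/2 + \<delta> \<le> Re (s + w)" "Re (s + w) \<le> B" "\<bar>Re w\<bar> \<le> B" "norm w \<ge> \<delta> / 2 * (1 + \<bar>Im w\<bar>)" for N s w
  proof -
    have "norm (zeta_inv (s + w) ^ k * perron_kernel N w / w) = norm (zeta_inv (s + w) ^ k) * norm (perron_kernel N w / w)"
      by (simp add: norm_mult norm_divide)
    also have "\<dots> \<le> (C * ((1 + \<bar>Im s\<bar>) powr (\<delta>/4) * (1 + \<bar>Im w\<bar>) powr (\<delta>/4))) * (C2 * real N powr (Re w + \<delta>) * decay (1 + \<delta>) (Im w))"
    proof (intro mult_mono)
      have "norm (zeta_inv (s + w) ^ k) \<le> C * (1 + \<bar>Im s + Im w\<bar>) powr (\<delta>/4)" using C(2)[of "s + w"] that by simp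
      also have "\<dots> \<le> C * ((1 + \<bar>Im s\<bar>) powr (\<delta>/4) * (1 + \<bar>Im w\<bar>) powr (\<delta>/4))"
        using C(1) \<delta> by (intro mult_left_mono powr_one_plus_abs_add) auto
      finally show "norm (zeta_inv (s + w) ^ k) \<le> C * ((1 + \<bar>Im s\<bar>) powr (\<delta>/4) * (1 + \<bar>Im w\<bar>) powr (\<delta>/4))" .
      show "norm (perron_kernel N w / w) \<le> C2 * real N powr (Re w + \<delta>) * decay (1 + \<delta>) (Im w)"
        unfolding C2_def using that \<delta> by (intro perron_kernel_div_bound) auto
    qed (use C(1) in auto)
    also have "(1 + \<bar>Im w\<bar>) powr (\<delta>/4) = decay (-\<delta>/4) (Im w)" by (simp add: decay_def)
    also have "(C * ((1 + \<bar>Im s\<bar>) powr (\<delta>/4) * decay (-\<delta>/4) (Im w))) * (C2 * real N powr (Re w + \<delta>) * decay (1 + \<delta>) (Im w))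
       = C * C2 * (1 + \<bar>Im s\<bar>) powr (\<delta>/4) * real N powr (Re w + \<delta>) * (decay (-\<delta>/4) (Im w) * decay (1 + \<delta>) (Im w))"
      by (simp only: mult_ac)
    also have "decay (-\<delta>/4) (Im w) * decay (1 + \<delta>) (Im w) = decay (1 + 3/4 * \<delta>) (Im w)"
      unfolding decay_mult by (rule arg_cong[where f = "\<lambda>p. decay p (Im w)"]) simp
    finally show ?thesis .
  qed
  then show ?thesis using C(1) C2 by (intro exI[of _ "C * C2"]) auto
qed

lemma mu_perron:
  assumes N: "N > 0" and s: "Re s + \<kappa> > 1" "\<kappa> > 0"
  shows "(\<Sum>n<N. of_real (mu k (Suc n)) * of_nat (Suc n) powr (- s)) =
     vert_integral \<kappa> (\<lambda>w. zeta_inv (s + w) ^ k * perron_kernel N w / w)"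
proof -
  define a where "a = (\<lambda>n. complex_of_real (mu k (Suc n)) * of_nat (Suc n) powr (- s))"
  have "(\<lambda>i. if Suc i \<le> N then a i else 0) sums vert_integral \<kappa> (\<lambda>w. zeta_inv (s + w) ^ k * perron_kernel N w / w)"
  proof (rule perron_formula)
    show "summable (\<lambda>i. norm (a i) * real (Suc i) powr (- \<kappa>))"
    proof -
      have "norm (a i) * real (Suc i) powr (- \<kappa>) = \<bar>mu k (Suc i)\<bar> * real (Suc i) powr (- (Re s + \<kappa>))" for i
        by (simp add: a_def norm_mult norm_of_nat_powr powr_add [symmetric] del: of_nat_Suc)
      then show ?thesis using mu_abs_summable[OF s(1), of k] by simp
    qed
    show "(\<lambda>i. a i * of_nat (Suc i) powr (- w)) sums (zeta_inv (s + w) ^ k)" if "Re w = \<kappa>" for w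
      using mu_series[of "s + w" k] that s
      by (simp add: a_def powr_diff powr_minus field_simps powr_add del: of_nat_Suc)
  qed (use assms in auto)
  moreover have "(\<lambda>i. if Suc i \<le> N then a i else 0) sums (\<Sum>i<N. if Suc i \<le> N then a i else 0)"
    by (rule sums_finite) auto
  ultimately show ?thesis
    using sums_unique2 by (fastforce simp: a_def intro!: sum.cong)
qed

lemma zeta_inv_shift_holomorphic:
  assumes "Riemann_Hypothesis" "A \<subseteq> {w. Re (s + w) > 1/2}"
  shows "(\<lambda>w. zeta_inv (s + w) ^ k) holomorphic_on A"
proof -
  have "(zeta_inv \<circ> (\<lambda>w. s + w)) holomorphic_on A"
    by (rule holomorphic_on_compose_gen[OF _ zeta_inv_holomorphic[OF assms(1)]])
       (use assms(2) in \<open>auto intro!: holomorphic_intros\<close>)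
  then show ?thesis unfolding o_def by (intro holomorphic_intros)
qed

text \<open>Moving the line for the partial sum to Re w = 1/2 + \<delta> - Re s crosses w = 0, where
  the residue is 1/zeta^k at s; so the tail is minus the remaining integral. Since Re s \<ge> 1/2 +
  2 \<delta>, the new line has distance at least \<delta> from 0. One \<delta> of the exponent 2
  \<delta> comes from the line, the other from the kernel.\<close>

lemma mu_tail_bound:
  assumes RH: "Riemann_Hypothesis" and \<delta>: "0 < \<delta>" "\<delta> \<le> 1"
  shows "\<exists>C\<ge>0. \<forall>N s. N > 0 \<and> 1/2 + 2 * \<delta> \<le> Re s \<and> Re s \<le> B \<longrightarrow>
     norm (mu_tail k N s) \<le> C * (1 + \<bar>Im s\<bar>) powr (\<delta>/4) * real N powr (1/2 + 2 * \<delta> - Re s)"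
proof -
  obtain C where C: "C \<ge> 0" and bd: "\<And>N s w. N > 0 \<Longrightarrow> 1/2 + \<delta> \<le> Re (s + w) \<Longrightarrow> Re (s + w) \<le> B + 2 \<Longrightarrow> \<bar>Re w\<bar> \<le> B + 2 \<Longrightarrow>
     norm w \<ge> \<delta> / 2 * (1 + \<bar>Im w\<bar>) \<Longrightarrow> norm (zeta_inv (s + w) ^ k * perron_kernel N w / w) \<le>
       C * (1 + \<bar>Im s\<bar>) powr (\<delta>/4) * real N powr (Re w + \<delta>) * decay (1 + 3/4 * \<delta>) (Im w)"
    using mu_perron_integrand_bound[OF RH \<delta>, of "B + 2" k] by blast
  define I where "I = (LBINT t. decay (1 + 3/4 * \<delta>) t)"
  have I: "I \<ge> 0" unfolding I_def by (intro integral_nonneg_AE) (auto simp: decay_nonneg)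
  have "norm (mu_tail k N s) \<le> C * I * (1 + \<bar>Im s\<bar>) powr (\<delta>/4) * real N powr (1/2 + 2 * \<delta> - Re s)"
    if N: "N > 0" and s: "1/2 + 2 * \<delta> \<le> Re s" "Re s \<le> B" for N s
  proof -
    define G where "G = (\<lambda>w. zeta_inv (s + w) ^ k * perron_kernel N w)"
    define h where "h = (\<lambda>w. zeta_inv (s + w) ^ k * perron_kernel N w / w)"
    define \<alpha> where "\<alpha> = 1/2 + \<delta> - Re s"
    have hG: "h = (\<lambda>w. G w / (w - 0))" by (simp add: h_def G_def)
    have "vert_integral 2 h - vert_integral \<alpha> h = G 0"
      unfolding hG
    proof (rule vert_integral_shift[where A = "1/2 - Re s" and B = 3])
      show "G holomorphic_on {w. 1/2 - Re s < Re w \<and> Re w < 3}"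
        unfolding G_def by (intro holomorphic_intros zeta_inv_shift_holomorphic RH perron_kernel_holomorphic N) auto
      show "norm (G w / (w - 0)) \<le> C * (1 + \<bar>Im s\<bar>) powr (\<delta>/4) * real N powr (2 + \<delta>) * decay (1 + 3/4 * \<delta>) (Im w)"
        if w: "\<alpha> \<le> Re w" "Re w \<le> 2" "\<bar>Im w\<bar> \<ge> 1" for w
      proof -
        have "\<delta> / 2 * (1 + \<bar>Im w\<bar>) \<le> 1 / 2 * (1 + \<bar>Im w\<bar>)" using \<delta> by (intro mult_right_mono) auto
        then have "\<delta> / 2 * (1 + \<bar>Im w\<bar>) \<le> norm w" using norm_ge_of_Im[OF w(3)] by linarith
        then have "norm (G w / (w - 0)) \<le> C * (1 + \<bar>Im s\<bar>) powr (\<delta>/4) * real N powr (Re w + \<delta>) * decay (1 + 3/4 * \<delta>) (Im w)"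
          unfolding G_def diff_zero using w s \<delta> N by (intro bd) (auto simp: \<alpha>_def)
        also have "\<dots> \<le> C * (1 + \<bar>Im s\<bar>) powr (\<delta>/4) * real N powr (2 + \<delta>) * decay (1 + 3/4 * \<delta>) (Im w)"
          using w C N by (intro mult_right_mono mult_left_mono powr_mono) (auto simp: decay_nonneg)
        finally show ?thesis .
      qed
    qed (use \<delta> s in \<open>auto simp: \<alpha>_def\<close>)
    moreover have "vert_integral 2 h = (\<Sum>n<N. of_real (mu k (Suc n)) * of_nat (Suc n) powr (- s))"
      unfolding h_def by (rule mu_perron[symmetric]) (use N s \<delta> in auto)
    moreover have "G 0 = zeta_inv s ^ k" by (simp add: G_def perron_kernel_0[OF N])
    ultimately have "mu_tail k N s = - vert_integral \<alpha> h"
      by (simp add: mu_tail_def algebra_simps)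
    then have "norm (mu_tail k N s) = norm (vert_integral \<alpha> h)" by simp
    also have "\<dots> \<le> (C * (1 + \<bar>Im s\<bar>) powr (\<delta>/4) * real N powr (\<alpha> + \<delta>)) * I"
      unfolding I_def
    proof (rule vert_integral_norm_le)
      fix t
      have "\<delta> / 2 * (1 + \<bar>Im (Complex \<alpha> t)\<bar>) \<le> norm (Complex \<alpha> t)"
        using s \<delta> by (intro norm_ge_of_Re) (auto simp: \<alpha>_def)
      then show "norm (h (Complex \<alpha> t)) \<le> C * (1 + \<bar>Im s\<bar>) powr (\<delta>/4) * real N powr (\<alpha> + \<delta>) * decay (1 + 3/4 * \<delta>) t"
        unfolding h_def using bd[of N s "Complex \<alpha> t"] N s \<delta> by (auto simp: \<alpha>_def)
    qed (use \<delta> in auto)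
    also have "\<alpha> + \<delta> = 1/2 + 2 * \<delta> - Re s" by (simp add: \<alpha>_def)
    finally show ?thesis by (simp only: mult_ac)
  qed
  then show ?thesis using C I by (intro exI[of _ "C * I"]) auto
qed

text \<open>The same integral at s = 0, but the line stops at 1/2 + \<delta>, to the right of 0, so
  there is no residue.\<close>

lemma mu_sum_bound:
  assumes RH: "Riemann_Hypothesis" and \<delta>: "0 < \<delta>" "\<delta> \<le> 1"
  shows "\<exists>C\<ge>0. \<forall>N>0. \<bar>\<Sum>n<N. mu k (Suc n)\<bar> \<le> C * real N powr (1/2 + 2 * \<delta>)"
proof -
  obtain C where C: "C \<ge> 0" and bd: "\<And>N s w. N > 0 \<Longrightarrow> 1/2 + \<delta> \<le> Re (s + w) \<Longrightarrow> Re (s + w) \<le> 2 \<Longrightarrow> \<bar>Re w\<bar> \<le> 2 \<Longrightarrow>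
     norm w \<ge> \<delta> / 2 * (1 + \<bar>Im w\<bar>) \<Longrightarrow> norm (zeta_inv (s + w) ^ k * perron_kernel N w / w) \<le>
       C * (1 + \<bar>Im s\<bar>) powr (\<delta>/4) * real N powr (Re w + \<delta>) * decay (1 + 3/4 * \<delta>) (Im w)"
    using mu_perron_integrand_bound[OF RH \<delta>, of 2 k] by blast
  define I where "I = (LBINT t. decay (1 + 3/4 * \<delta>) t)"
  have I: "I \<ge> 0" unfolding I_def by (intro integral_nonneg_AE) (auto simp: decay_nonneg)
  have "\<bar>\<Sum>n<N. mu k (Suc n)\<bar> \<le> C * I * real N powr (1/2 + 2 * \<delta>)" if N: "N > 0" for N
  proof -
    define h where "h = (\<lambda>w. zeta_inv (0 + w) ^ k * perron_kernel N w / w)"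
    have hb: "norm (h w) \<le> C * real N powr (Re w + \<delta>) * decay (1 + 3/4 * \<delta>) (Im w)"
      if "1/2 + \<delta> \<le> Re w" "Re w \<le> 2" for w
    proof -
      have "\<delta> / 2 * (1 + \<bar>Im w\<bar>) \<le> norm w"
        using that \<delta> by (intro norm_ge_of_Re) auto
      then show ?thesis unfolding h_def using bd[of N 0 w] that \<delta> N by auto
    qed
    have "vert_integral 2 h = vert_integral (1/2 + \<delta>) h"
    proof (rule vert_integral_shift_holomorphic[where A = "1/2" and B = 3])
      show "h holomorphic_on {w. 1/2 < Re w \<and> Re w < 3}"
        unfolding h_def by (intro holomorphic_intros zeta_inv_shift_holomorphic RH perron_kernel_holomorphic N) auto
      show "norm (h w) \<le> C * real N powr (2 + \<delta>) * decay (1 + 3/4 * \<delta>) (Im w)"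
        if w: "1/2 + \<delta> \<le> Re w" "Re w \<le> 2" for w
      proof -
        have "C * real N powr (Re w + \<delta>) * decay (1 + 3/4 * \<delta>) (Im w) \<le> C * real N powr (2 + \<delta>) * decay (1 + 3/4 * \<delta>) (Im w)"
          using w C N by (intro mult_right_mono mult_left_mono powr_mono) (auto simp: decay_nonneg)
        with hb[OF w] show ?thesis by linarith
      qed
    qed (use \<delta> in auto)
    moreover have "vert_integral 2 h = (\<Sum>n<N. of_real (mu k (Suc n)) * of_nat (Suc n) powr (- 0))"
      unfolding h_def by (rule mu_perron[symmetric]) (use N in auto)
    ultimately have "of_real (\<Sum>n<N. mu k (Suc n)) = vert_integral (1/2 + \<delta>) h"
      by (simp del: of_nat_Suc)
    then have "\<bar>\<Sum>n<N. mu k (Suc n)\<bar> = norm (vert_integral (1/2 + \<delta>) h)"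
      by (metis norm_of_real)
    also have "\<dots> \<le> (C * real N powr ((1/2 + \<delta>) + \<delta>)) * I"
      unfolding I_def
    proof (rule vert_integral_norm_le)
      show "norm (h (Complex (1/2 + \<delta>) t)) \<le> C * real N powr (1/2 + \<delta> + \<delta>) * decay (1 + 3/4 * \<delta>) t" for t
        using hb[of "Complex (1/2 + \<delta>) t"] \<delta> by simp
    qed (use \<delta> in auto)
    also have "(1/2 + \<delta>) + \<delta> = 1/2 + 2 * \<delta>" by simp
    finally show ?thesis by (simp only: mult_ac)
  qed
  then show ?thesis using C I by (intro exI[of _ "C * I"]) auto
qed

section \<open>The lattice points with large second coordinate\<close>

text \<open>Enumerating pairs by \<open>prod_decode\<close> turns the product of two series into a
  single series, as \<open>perron_formula\<close> requires.\<close>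

lemma
  fixes f g :: "nat \<Rightarrow> complex"
  assumes f: "summable (\<lambda>n. norm (f n))" "f sums A" and g: "summable (\<lambda>n. norm (g n))" "g sums B"
  shows sums_prod_decode: "(\<lambda>i. f (fst (prod_decode i)) * g (snd (prod_decode i))) sums (A * B)"
    and summable_norm_prod_decode: "summable (\<lambda>i. norm (f (fst (prod_decode i)) * g (snd (prod_decode i))))"
proof -
  define P where "P = (\<lambda>(m, n). f m * g n)"
  have F: "(f has_sum A) UNIV" and G: "(g has_sum B) UNIV"
    using assms by (auto intro: norm_summable_imp_has_sum)
  have sf: "(\<lambda>n. norm (f n)) summable_on UNIV"
    using F summable_on_iff_abs_summable_on_complex[of f UNIV] by (auto simp: summable_on_def)
  have sg: "(\<lambda>n. norm (g n)) summable_on UNIV"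
    using G summable_on_iff_abs_summable_on_complex[of g UNIV] by (auto simp: summable_on_def)
  have nP: "(\<lambda>x. norm (P x)) summable_on (UNIV \<times> UNIV)"
    unfolding Infinite_Sum.abs_summable_on_Sigma_iff P_def
    by (auto simp: norm_mult infsum_cmult_right sg abs_mult
             intro!: summable_on_cmult_right summable_on_cmult_left sf sg)
  then have "P summable_on (UNIV \<times> UNIV)"
    by (rule abs_summable_summable)
  moreover have "((\<lambda>n. P (m, n)) has_sum (f m * B)) UNIV" for m
    using has_sum_cmult_right[OF G, of "f m"] by (simp add: P_def)
  moreover have "((\<lambda>m. f m * B) has_sum (A * B)) UNIV"
    by (rule has_sum_cmult_left[OF F])
  ultimately have "(P has_sum (A * B)) (UNIV \<times> UNIV)"
    by (intro has_sum_SigmaI) auto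
  then have "((\<lambda>i. P (prod_decode i)) has_sum (A * B)) UNIV"
    using has_sum_reindex_bij_betw[OF bij_prod_decode, of P] by simp
  from has_sum_imp_sums[OF this]
  show "(\<lambda>i. f (fst (prod_decode i)) * g (snd (prod_decode i))) sums (A * B)"
    by (simp add: P_def case_prod_unfold)
  have "(\<lambda>i. norm (P (prod_decode i))) summable_on UNIV"
    using summable_on_reindex_bij_betw[OF bij_prod_decode, of "\<lambda>x. norm (P x)"] nP by simp
  from summable_on_imp_summable[OF this]
  show "summable (\<lambda>i. norm (f (fst (prod_decode i)) * g (snd (prod_decode i))))"
    by (simp add: P_def case_prod_unfold)
qed

lemma of_nat_powr_exp: "n > 0 \<Longrightarrow> (of_nat n :: complex) powr w = exp (w * of_real (ln (real n)))"
  by (simp add: powr_def Ln_of_nat)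

lemma of_nat_power_mult_powr:
  assumes "l > 0" "d > 0"
  shows "(of_nat (l ^ a * d ^ c) :: complex) powr w = of_nat l powr (of_nat a * w) * of_nat d powr (of_nat c * w)"
  using assms
  by (simp only: of_nat_powr_exp zero_less_power mult_pos_pos)
     (simp add: ln_mult ln_realpow exp_add [symmetric] algebra_simps)

text \<open>\<open>Suc d\<close> is the variable carrying the coefficient, and
  \<open>M \<le> d\<close> with M = \<open>\<lfloor>y\<rfloor>\<close> says that it exceeds y. For
  positive a and c the square loses no lattice points.\<close>

definition tail_sum :: "nat \<Rightarrow> nat \<Rightarrow> nat \<Rightarrow> nat \<Rightarrow> nat \<Rightarrow> real" where
  "tail_sum k a c M N = (\<Sum>l<N. \<Sum>d<N. if Suc l ^ a * Suc d ^ c \<le> N \<and> M \<le> d then mu k (Suc d) else 0)"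

lemma mu_tail_sums:
  assumes "Re s > 1"
  shows "(\<lambda>n. (if M \<le> n then of_real (mu k (Suc n)) else 0) * of_nat (Suc n) powr (- s)) sums mu_tail k M s"
proof -
  have "(\<lambda>n. if n \<in> {..<M} then of_real (mu k (Suc n)) * of_nat (Suc n) powr (- s) else 0)
     sums (\<Sum>n\<in>{..<M}. of_real (mu k (Suc n)) * of_nat (Suc n) powr (- s))"
    by (rule sums_If_finite_set) simp
  from sums_diff[OF mu_series[OF assms, of k] this] show ?thesis
    unfolding mu_tail_def
    by (rule sums_cong[THEN iffD1, rotated]) (auto simp del: of_nat_Suc)
qed

text \<open>On Re w = 2 both a w and c w have real part above 1, so the two series converge
  absolutely and multiply to one with frequencies l^a d^c.\<close>

lemma tail_sum_perron:
  assumes a: "a > 0" and c: "c > 0" and N: "N > 0"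
  shows "of_real (tail_sum k a c M N) =
     vert_integral 2 (\<lambda>w. zeta (of_nat a * w) * mu_tail k M (of_nat c * w) * perron_kernel N w / w)"
proof -
  define L where "L = (\<lambda>i. Suc (fst (prod_decode i)) ^ a * Suc (snd (prod_decode i)) ^ c)"
  define b where "b = (\<lambda>i. if M \<le> snd (prod_decode i) then complex_of_real (mu k (Suc (snd (prod_decode i)))) else 0)"
  define f where "f = (\<lambda>w p. of_nat (Suc p) powr (- (of_nat a * w)) :: complex)"
  define g where "g = (\<lambda>w q. (if M \<le> q then of_real (mu k (Suc q)) else 0) * of_nat (Suc q) powr (- (of_nat c * w)) :: complex)"
  have bL: "b i * of_nat (L i) powr (- w) = f w (fst (prod_decode i)) * g w (snd (prod_decode i))" for i w
    using of_nat_power_mult_powr[of "Suc (fst (prod_decode i))" "Suc (snd (prod_decode i))" a c "- w"]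
    by (simp add: b_def L_def f_def g_def del: of_nat_Suc of_nat_mult of_nat_power)
  have fg: "f w sums zeta (of_nat a * w)" "g w sums mu_tail k M (of_nat c * w)"
    "summable (\<lambda>p. norm (f w p))" "summable (\<lambda>q. norm (g w q))" if w: "Re w = 2" for w
  proof -
    have re: "Re (of_nat a * w) > 1" "Re (of_nat c * w) > 1" using w a c by auto
    show "f w sums zeta (of_nat a * w)"
      using zeta_sums[OF re(1)] by (simp add: f_def powr_minus_divide del: of_nat_Suc)
    show "g w sums mu_tail k M (of_nat c * w)"
      unfolding g_def by (rule mu_tail_sums[OF re(2)])
    have "summable (\<lambda>p. real (Suc p) powr (- Re (of_nat a * w)))"
      by (subst summable_Suc_iff, subst summable_real_powr_iff) (use re in simp)
    then show "summable (\<lambda>p. norm (f w p))"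
      by (simp add: f_def norm_of_nat_powr del: of_nat_Suc)
    show "summable (\<lambda>q. norm (g w q))"
      by (rule summable_comparison_test'[OF mu_abs_summable[OF re(2), of k], of 0])
         (auto simp: g_def norm_mult norm_of_nat_powr simp del: of_nat_Suc)
  qed
  have "(\<lambda>i. if L i \<le> N then b i else 0) sums
     vert_integral 2 (\<lambda>w. zeta (of_nat a * w) * mu_tail k M (of_nat c * w) * perron_kernel N w / w)"
  proof (rule perron_formula)
    show L0: "L i > 0" for i by (simp add: L_def)
    have "norm (b i) * real (L i) powr (- 2) = norm (b i * of_nat (L i) powr (- 2 :: complex))" for i
      using L0[of i] by (simp only: norm_mult norm_of_pos_nat_powr) simp
    then show "summable (\<lambda>i. norm (b i) * real (L i) powr (- 2))"
      unfolding bL using summable_norm_prod_decode[OF fg(3,1,4,2)[of 2]] by simp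
    show "(\<lambda>i. b i * of_nat (L i) powr (- w)) sums (zeta (of_nat a * w) * mu_tail k M (of_nat c * w))"
      if "Re w = 2" for w
      unfolding bL using sums_prod_decode[OF fg(3,1,4,2)[OF that]] .
  qed (use N in auto)
  \<comment> \<open>Pairs outside the square contribute nothing, as one of the two factors alone
    exceeds N.\<close>
  moreover have "(\<lambda>i. if L i \<le> N then b i else 0) sums (\<Sum>i\<in>prod_encode ` ({..<N} \<times> {..<N}). if L i \<le> N then b i else 0)"
  proof (rule sums_finite)
    fix i assume i: "i \<notin> prod_encode ` ({..<N} \<times> {..<N})"
    obtain p q where pq: "prod_decode i = (p, q)" by (cases "prod_decode i")
    then have ipq: "i = prod_encode (p, q)" by (metis prod_decode_inverse)
    have "p \<ge> N \<or> q \<ge> N"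
    proof (rule ccontr)
      assume "\<not> (p \<ge> N \<or> q \<ge> N)"
      with i ipq show False by auto
    qed
    moreover have "Suc p ^ 1 \<le> Suc p ^ a" "Suc q ^ 1 \<le> Suc q ^ c"
      using a c by (intro power_increasing; simp)+
    then have "Suc p * 1 \<le> Suc p ^ a * Suc q ^ c" "1 * Suc q \<le> Suc p ^ a * Suc q ^ c"
      by (intro mult_mono; simp)+
    ultimately have "L i > N" by (auto simp: L_def pq)
    then show "(if L i \<le> N then b i else 0) = 0" by simp
  qed simp
  ultimately have "vert_integral 2 (\<lambda>w. zeta (of_nat a * w) * mu_tail k M (of_nat c * w) * perron_kernel N w / w)
      = (\<Sum>i\<in>prod_encode ` ({..<N} \<times> {..<N}). if L i \<le> N then b i else 0)"
    by (rule sums_unique2)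
  also have "\<dots> = (\<Sum>x\<in>{..<N} \<times> {..<N}. if L (prod_encode x) \<le> N then b (prod_encode x) else 0)"
    by (subst sum.reindex) (auto intro: inj_on_subset[OF inj_prod_encode])
  also have "\<dots> = (\<Sum>(l, d)\<in>{..<N} \<times> {..<N}. if Suc l ^ a * Suc d ^ c \<le> N \<and> M \<le> d then of_real (mu k (Suc d)) else 0)"
    by (intro sum.cong) (auto simp: L_def b_def)
  also have "\<dots> = of_real (tail_sum k a c M N)"
    unfolding tail_sum_def of_real_sum sum.cartesian_product [symmetric]
    by (intro sum.cong) auto
  finally show ?thesis by simp
qed

lemma mu_tail_scaled_holomorphic:
  assumes "Riemann_Hypothesis" "A \<subseteq> {w. Re (of_nat c * w) > 1/2}"
  shows "(\<lambda>w. mu_tail k M (of_nat c * w)) holomorphic_on A"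
proof -
  have "(mu_tail k M \<circ> (\<lambda>w. of_nat c * w)) holomorphic_on A"
    by (rule holomorphic_on_compose_gen[OF _ mu_tail_holomorphic[OF assms(1)]])
       (use assms(2) in \<open>auto intro!: holomorphic_intros\<close>)
  then show ?thesis by (simp add: o_def)
qed

lemma zeta_reg_scaled_holomorphic:
  assumes "A \<subseteq> {w. Re (of_nat a * w) > 0}"
  shows "(\<lambda>w. zeta_reg (of_nat a * w)) holomorphic_on A"
proof -
  have "(zeta_reg \<circ> (\<lambda>w. of_nat a * w)) holomorphic_on A"
    by (rule holomorphic_on_compose_gen[OF _ zeta_reg_holomorphic])
       (use assms in \<open>auto intro!: holomorphic_intros\<close>)
  then show ?thesis by (simp add: o_def)
qed

lemma one_plus_scaled_powr_le:
  assumes "a > 0" "p \<ge> 0"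
  shows "(1 + \<bar>real a * t\<bar>) powr p \<le> real a powr p * decay (- p) t"
proof -
  have "1 + \<bar>real a * t\<bar> \<le> real a * (1 + \<bar>t\<bar>)"
    using assms by (simp add: abs_mult algebra_simps)
  then have "(1 + \<bar>real a * t\<bar>) powr p \<le> (real a * (1 + \<bar>t\<bar>)) powr p"
    using assms by (intro powr_mono2) auto
  also have "\<dots> = real a powr p * (1 + \<bar>t\<bar>) powr p" by (rule powr_mult)
  finally show ?thesis by (simp add: decay_def)
qed

text \<open>With zeta(a w) written as \<open>zeta_reg (of_nat a * w) / (of_nat a * (w - p))\<close>,
  moving the line from 2 to \<alpha> crosses only the pole p = 1/a, and its residue is the
  subtracted term.\<close>

lemma tail_sum_estimate:
  assumes RH: "Riemann_Hypothesis" and a: "a > 0" and ac: "a < c"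
    and \<delta>: "0 < \<delta>" "\<delta> \<le> 1 / (8 * real a)"
  shows "\<exists>C\<ge>0. \<forall>M N. M > 0 \<and> N > 0 \<longrightarrow>
     norm (of_real (tail_sum k a c M N) - mu_tail k M (of_nat c / of_nat a) * perron_kernel N (1 / of_nat a)) \<le>
       C * (real N powr (1 / (2 * real a) + 3 * \<delta>) * real M powr (1/2 - real c / (2 * real a)))"
proof -
  \<comment> \<open>The shift 2 \<delta> keeps Re (a w) above 1/2 + \<delta>. Multiplied by c \<ge>
    1 it also absorbs the 2 \<delta> lost in \<open>mu_tail_bound\<close>, so M has the exponent 1/2
    - c/(2a) without an \<epsilon>.\<close>
  define \<alpha> where "\<alpha> = 1 / (2 * real a) + 2 * \<delta>"
  \<comment> \<open>In units of \<open>d\<close> the pole lies at 4 d and the critical line at 2 d.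
    As \<delta> \<le> d/2, the line \<alpha> lies between 2 d and 3 d, at distance at least d from
    both 0 and p.\<close>
  define d where "d = 1 / (4 * real a)"
  define p where "p = 1 / (of_nat a :: complex)"
  have p: "p = of_real (1 / real a)" by (simp add: p_def)
  have c1: "c > 0" "real c > real a" "real a \<ge> 1" using a ac by auto
  have \<delta>a: "\<delta> * real a \<le> 1/8" using \<delta> a by (simp add: field_simps)
  have "\<delta> * 1 \<le> \<delta> * real a" using c1 \<delta> by (intro mult_left_mono) auto
  then have \<delta>1: "\<delta> \<le> 1/8" using \<delta>a by linarith
  have d: "0 < d" "d \<le> 1" "\<delta> \<le> d / 2" using c1 \<delta> by (auto simp: d_def field_simps)
  have \<alpha>: "\<alpha> = 2 * d + 2 * \<delta>" "\<alpha> \<le> 3 * d" "1 / real a = 4 * d" using d c1 by (auto simp: \<alpha>_def d_def)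
  have \<alpha>2: "4 * d < 2" using c1 by (simp add: d_def field_simps)
  have a\<alpha>: "real a * \<alpha> = 1/2 + 2 * \<delta> * real a" using a by (simp add: \<alpha>_def algebra_simps)
  have c\<alpha>: "real c * \<alpha> = real c / (2 * real a) + 2 * \<delta> * real c" by (simp add: \<alpha>_def algebra_simps)
  have ca: "real c / (2 * real a) > 1/2" using c1 by (simp add: field_simps)
  have \<delta>c: "\<delta> * real c \<ge> \<delta> * 1" "\<delta> * real a \<ge> \<delta> * 1" using c1 \<delta> by (intro mult_left_mono; simp)+
  obtain C1 where C1: "C1 \<ge> 0" "\<And>w. 1/2 + \<delta> \<le> Re w \<Longrightarrow> Re w \<le> 2 * real a \<Longrightarrow>
      norm (zeta_reg w) \<le> C1 * (1 + \<bar>Im w\<bar>) powr (1 + \<delta>/4)"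
    using zeta_reg_growth[OF RH \<delta>(1), of "\<delta>/4" "2 * real a"] \<delta> by auto
  obtain C2 where C2: "C2 \<ge> 0" "\<And>N s. N > 0 \<Longrightarrow> 1/2 + 2 * \<delta> \<le> Re s \<Longrightarrow> Re s \<le> 2 * real c \<Longrightarrow>
     norm (mu_tail k N s) \<le> C2 * (1 + \<bar>Im s\<bar>) powr (\<delta>/4) * real N powr (1/2 + 2 * \<delta> - Re s)"
    using mu_tail_bound[OF RH \<delta>(1), of "2 * real c" k] \<delta>1 by auto
  define C3 where "C3 = 2 * (1 + 2 powr 2) * (2 / \<delta>) powr (1 + \<delta>)"
  have C3: "C3 \<ge> 0" by (simp add: C3_def)
  define C where "C = (C1 * real a powr (1 + \<delta>/4) / real a) * (C2 * real c powr (\<delta>/4)) * C3 * (2 / d)"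
  have C: "C \<ge> 0" using C1(1) C2(1) C3 d by (auto simp: C_def)
  define I where "I = (LBINT t. decay (1 + \<delta>/2) t)"
  have I: "I \<ge> 0" unfolding I_def by (intro integral_nonneg_AE) (auto simp: decay_nonneg)
  have "norm (of_real (tail_sum k a c M N) - mu_tail k M (of_nat c / of_nat a) * perron_kernel N (1 / of_nat a)) \<le>
       C * I * (real N powr (1 / (2 * real a) + 3 * \<delta>) * real M powr (1/2 - real c / (2 * real a)))"
    if M: "M > 0" and N: "N > 0" for M N
  proof -
    define G where "G = (\<lambda>w. zeta_reg (of_nat a * w) / of_nat a * mu_tail k M (of_nat c * w) * perron_kernel N w / w)"
    define h where "h = (\<lambda>w. G w / (w - p))"
    define m where "m = real M powr (1/2 - real c / (2 * real a))"
    have h_bound: "norm (h w) \<le> C * m * real N powr (Re w + \<delta>) * decay (1 + \<delta>/2) (Im w)"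
      if w: "\<alpha> \<le> Re w" "Re w \<le> 2" and wp: "norm (w - p) \<ge> d / 2 * (1 + \<bar>Im w\<bar>)" for w
    proof -
      define t where "t = Im w"
      have awl: "real a * \<alpha> \<le> real a * Re w" and awu: "real a * Re w \<le> real a * 2"
        and cwl: "real c * \<alpha> \<le> real c * Re w" and cwu: "real c * Re w \<le> real c * 2"
        using w by (intro mult_left_mono; simp)+
      have b1: "norm (zeta_reg (of_nat a * w) / of_nat a) \<le> C1 * real a powr (1 + \<delta>/4) / real a * decay (- (1 + \<delta>/4)) t"
      proof -
        have "norm (zeta_reg (of_nat a * w)) \<le> C1 * (1 + \<bar>real a * t\<bar>) powr (1 + \<delta>/4)"
          using C1(2)[of "of_nat a * w"] awl awu a\<alpha> \<delta>c \<delta> by (simp add: t_def)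
        also have "\<dots> \<le> C1 * (real a powr (1 + \<delta>/4) * decay (- (1 + \<delta>/4)) t)"
          using C1(1) a \<delta> by (intro mult_left_mono one_plus_scaled_powr_le) auto
        finally show ?thesis using a by (simp add: norm_divide divide_right_mono)
      qed
      have b2: "norm (mu_tail k M (of_nat c * w)) \<le> C2 * real c powr (\<delta>/4) * decay (- (\<delta>/4)) t * m"
      proof -
        have re: "Re (of_nat c * w) = real c * Re w" "Im (of_nat c * w) = real c * t" by (simp_all add: t_def)
        have lo: "1/2 + 2 * \<delta> \<le> real c * Re w" and hi: "real c * Re w \<le> 2 * real c"
          and ex: "1/2 + 2 * \<delta> - real c * Re w \<le> 1/2 - real c / (2 * real a)"
          using cwl cwu c\<alpha> ca \<delta>c by linarith+
        have "norm (mu_tail k M (of_nat c * w)) \<le> C2 * (1 + \<bar>real c * t\<bar>) powr (\<delta>/4) * real M powr (1/2 + 2 * \<delta> - real c * Re w)"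
          using C2(2)[OF M, of "of_nat c * w", unfolded re] lo hi by blast
        also have "\<dots> \<le> C2 * (real c powr (\<delta>/4) * decay (- (\<delta>/4)) t) * m"
          unfolding m_def using C2(1) c1 \<delta> M ex
          by (intro mult_mono mult_left_mono one_plus_scaled_powr_le powr_mono) (auto simp: decay_nonneg)
        finally show ?thesis by (simp only: mult_ac)
      qed
      have b3: "norm (perron_kernel N w / w) \<le> C3 * real N powr (Re w + \<delta>) * decay (1 + \<delta>) t"
        unfolding C3_def t_def
      proof (rule perron_kernel_div_bound[OF N])
        show "\<delta> / 2 * (1 + \<bar>Im w\<bar>) \<le> norm w"
          using w \<alpha> d \<delta> \<delta>1 by (intro norm_ge_of_Re) auto
      qed (use w \<alpha> d \<delta> \<delta>1 in auto)
      have b4: "1 / norm (w - p) \<le> 2 / d * decay 1 t"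
      proof -
        have pos: "0 < d / 2 * (1 + \<bar>t\<bar>)" using d by (intro mult_pos_pos) auto
        then have "0 < norm (w - p)" using wp unfolding t_def by linarith
        then have "1 / norm (w - p) \<le> 1 / (d / 2 * (1 + \<bar>t\<bar>))"
          using wp pos unfolding t_def by (intro frac_le) auto
        also have "\<dots> = 2 / d * decay 1 t" using d by (simp add: decay_def powr_minus field_simps)
        finally show ?thesis .
      qed
      have "norm (h w) = norm (zeta_reg (of_nat a * w) / of_nat a) * norm (mu_tail k M (of_nat c * w))
          * norm (perron_kernel N w / w) * (1 / norm (w - p))"
        by (simp add: h_def G_def norm_mult norm_divide)
      also have "\<dots> \<le> (C1 * real a powr (1 + \<delta>/4) / real a * decay (- (1 + \<delta>/4)) t)
          * (C2 * real c powr (\<delta>/4) * decay (- (\<delta>/4)) t * m)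
          * (C3 * real N powr (Re w + \<delta>) * decay (1 + \<delta>) t) * (2 / d * decay 1 t)"
        using C1(1) C2(1) C3 d
        by (intro mult_mono[OF mult_mono[OF mult_mono[OF b1 b2] b3] b4])
           (auto simp: decay_nonneg m_def intro!: mult_nonneg_nonneg)
      also have "\<dots> = C * m * real N powr (Re w + \<delta>) *
          (decay (- (1 + \<delta>/4)) t * decay (- (\<delta>/4)) t * decay (1 + \<delta>) t * decay 1 t)"
        unfolding C_def by (simp only: mult_ac)
      \<comment> \<open>The factors are, in this order, \<open>zeta_reg\<close>,
        \<open>mu_tail\<close>, the kernel over w, and 1/(w - p).\<close>
      also have "decay (- (1 + \<delta>/4)) t * decay (- (\<delta>/4)) t * decay (1 + \<delta>) t * decay 1 t = decay (1 + \<delta>/2) t"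
        unfolding decay_mult by (rule arg_cong[where f = "\<lambda>p. decay p t"]) simp
      finally show ?thesis by (simp add: t_def)
    qed
    have pole: "vert_integral 2 h - vert_integral \<alpha> h = G p"
      unfolding h_def
    proof (rule vert_integral_shift[where A = "2 * d" and B = 3])
      have re: "1/2 < real c * Re w \<and> 0 < real a * Re w \<and> w \<noteq> 0" if "2 * d < Re w" for w
      proof -
        have "0 < Re w" using that d by linarith
        moreover have "real c * (2 * d) < real c * Re w" using that c1 by (intro mult_strict_left_mono) auto
        moreover have "real c * (2 * d) = real c / (2 * real a)" by (simp add: d_def)
        ultimately have "1/2 < real c * Re w" "0 < real a * Re w" using ca c1 by (linarith, auto)
        then show ?thesis by auto
      qed
      show "G holomorphic_on {w. 2 * d < Re w \<and> Re w < 3}"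
        unfolding G_def using a re
        by (intro holomorphic_intros zeta_reg_scaled_holomorphic mu_tail_scaled_holomorphic RH perron_kernel_holomorphic N) auto
      \<comment> \<open>The power of N is wasteful, but this bound only justifies moving the
        line.\<close>
      show "norm (G w / (w - p)) \<le> C * m * real N powr (2 + \<delta>) * decay (1 + \<delta>/2) (Im w)"
        if w: "\<alpha> \<le> Re w" "Re w \<le> 2" "\<bar>Im w\<bar> \<ge> 1" for w
      proof -
        have "norm (w - p) \<ge> 1 / 2 * (1 + \<bar>Im w\<bar>)"
          using norm_ge_of_Im[of "w - p"] w by (simp add: p)
        moreover have "d / 2 * (1 + \<bar>Im w\<bar>) \<le> 1 / 2 * (1 + \<bar>Im w\<bar>)" using d by (intro mult_right_mono) auto
        ultimately have "norm (h w) \<le> C * m * real N powr (Re w + \<delta>) * decay (1 + \<delta>/2) (Im w)"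
          using w by (intro h_bound) linarith+
        also have "\<dots> \<le> C * m * real N powr (2 + \<delta>) * decay (1 + \<delta>/2) (Im w)"
          using C w N by (intro mult_right_mono mult_left_mono powr_mono) (auto simp: decay_nonneg m_def)
        finally show ?thesis by (simp only: h_def)
      qed
      show "\<alpha> < Re p" "Re p < 2" using \<alpha> \<alpha>2 d by (auto simp: p)
    qed (use \<alpha> \<delta> in auto)
    have "vert_integral 2 h = of_real (tail_sum k a c M N)"
      unfolding tail_sum_perron[OF a c1(1) N] vert_integral_def
    proof (intro arg_cong[where f = "\<lambda>g. (1 / (2 * pi)) *\<^sub>R integral\<^sup>L lborel g"] ext)
      fix t
      define w where "w = Complex 2 t"
      have "Re w - 1 / real a > 0" using \<alpha> \<alpha>2 by (simp add: w_def)
      then have "Re w \<noteq> Re p" by (simp add: p)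
      then have wp: "w \<noteq> p" by auto
      then have awp: "of_nat a * w \<noteq> 1" using a by (auto simp: p_def field_simps)
      have "zeta_reg (of_nat a * w) = of_nat a * (w - p) * zeta (of_nat a * w)"
        using zeta_reg_eq[of "of_nat a * w"] awp a by (simp add: w_def p_def algebra_simps)
      then show "h (Complex 2 t) = zeta (of_nat a * Complex 2 t) * mu_tail k M (of_nat c * Complex 2 t)
          * perron_kernel N (Complex 2 t) / Complex 2 t"
        using wp a unfolding w_def [symmetric] by (simp add: h_def G_def)
    qed
    \<comment> \<open>The residue 1/a of zeta(a w) cancels against the denominator w = 1/a.\<close>
    moreover have "G p = mu_tail k M (of_nat c / of_nat a) * perron_kernel N (1 / of_nat a)"
      using a by (simp add: G_def p_def zeta_reg_1)
    ultimately have "of_real (tail_sum k a c M N) - mu_tail k M (of_nat c / of_nat a) * perron_kernel N (1 / of_nat a)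
        = vert_integral \<alpha> h"
      using pole by (simp add: algebra_simps)
    also have "norm (vert_integral \<alpha> h) \<le> (C * m * real N powr (\<alpha> + \<delta>)) * I"
      unfolding I_def
    proof (rule vert_integral_norm_le)
      fix t
      have "d / 2 * (1 + \<bar>Im (Complex \<alpha> t - p)\<bar>) \<le> norm (Complex \<alpha> t - p)"
        using \<alpha> d by (intro norm_ge_of_Re) (auto simp: p)
      then show "norm (h (Complex \<alpha> t)) \<le> C * m * real N powr (\<alpha> + \<delta>) * decay (1 + \<delta>/2) t"
        using h_bound[of "Complex \<alpha> t"] \<alpha> \<alpha>2 d by (simp add: p)
    qed (use \<delta> in auto)
    also have "\<alpha> + \<delta> = 1 / (2 * real a) + 3 * \<delta>" by (simp add: \<alpha>_def)
    finally show ?thesis by (simp only: m_def mult_ac)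
  qed
  then show ?thesis using C I by (intro exI[of _ "C * I"]) auto
qed

section \<open>Elementary counting and the final estimate\<close>

text \<open>Both numbers lie between N^\<theta> and (N + 1)^\<theta>, which differ by at most 1
  because \<theta> \<le> 1. For the kernel this is 1 \<le> (exp z - 1)/z \<le> exp z.\<close>

lemma perron_kernel_close_to_powr:
  assumes \<theta>: "0 < \<theta>" "\<theta> \<le> 1" and N: "N > 0" and x: "real N \<le> x" "x \<le> real N + 1"
  shows "norm (perron_kernel N (of_real \<theta>) - of_real (x powr \<theta>)) \<le> 1"
proof -
  define z where "z = log_step N * \<theta>"
  have z: "z > 0" using log_step_bounds(3)[OF N] \<theta> by (simp add: z_def)
  define K where "K = real N powr \<theta> * ((exp z - 1) / z)"
  have "perron_kernel N (of_real \<theta>) = of_real K"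
  proof -
    have "of_real (log_step N) * of_real \<theta> = complex_of_real z" by (simp add: z_def)
    moreover have "expq (complex_of_real z) = of_real ((exp z - 1) / z)"
      using z by (simp add: expq_def exp_of_real)
    moreover have "of_nat N powr complex_of_real \<theta> = of_real (real N powr \<theta>)"
      using powr_of_real[of "real N" \<theta>] by simp
    ultimately show ?thesis by (simp add: perron_kernel_def K_def)
  qed
  moreover have "real N powr \<theta> * 1 \<le> K" unfolding K_def
  proof (rule mult_left_mono)
    have "z \<le> exp z - 1" using exp_ge_add_one_self[of z] by linarith
    then show "1 \<le> (exp z - 1) / z" using z by (simp only: le_divide_eq_1_pos)
  qed simp
  moreover have "K \<le> real N powr \<theta> * exp z" unfolding K_def
  proof (rule mult_left_mono)
    have "1 - z \<le> exp (- z)" using exp_ge_add_one_self[of "- z"] by simp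
    then have "(1 - z) * exp z \<le> 1" by (simp add: exp_minus field_simps)
    then show "(exp z - 1) / z \<le> exp z" using z by (simp add: divide_le_eq algebra_simps)
  qed simp
  moreover have "real N powr \<theta> * exp z = (real N + 1) powr \<theta>"
  proof -
    have "exp z = (real (Suc N) / real N) powr \<theta>"
      using N by (simp add: z_def log_step_def powr_def mult.commute)
    then show ?thesis using N by (simp add: powr_divide add.commute)
  qed
  moreover have "(real N + 1) powr \<theta> \<le> real N powr \<theta> + 1"
  proof -
    have "((real N + 1) / real N) powr \<theta> \<le> ((real N + 1) / real N) powr 1"
      using N \<theta> by (intro powr_mono) (auto simp: field_simps)
    then have "(real N + 1) powr \<theta> \<le> real N powr \<theta> * (1 + 1 / real N)"
      using N by (simp add: powr_divide field_simps)
    also have "real N powr \<theta> * (1 + 1 / real N) = real N powr \<theta> + real N powr \<theta> / real N"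
      by (simp add: algebra_simps)
    also have "real N powr \<theta> \<le> real N powr 1" using N \<theta> by (intro powr_mono) auto
    then have "real N powr \<theta> / real N \<le> 1" using N by simp
    finally show ?thesis by simp
  qed
  moreover have "real N powr \<theta> \<le> x powr \<theta>" "x powr \<theta> \<le> (real N + 1) powr \<theta>"
    using x \<theta> by (auto intro!: powr_mono2)
  ultimately have "\<bar>K - x powr \<theta>\<bar> \<le> 1" "perron_kernel N (of_real \<theta>) = of_real K" by linarith+
  then show ?thesis by (metis norm_of_real of_real_diff)
qed

lemma sum_upto_floor: "(\<Sum>l | l > 0 \<and> real l \<le> y. f l) = (\<Sum>n<nat \<lfloor>y\<rfloor>. f (Suc n))"
proof (rule sum.reindex_bij_witness[of _ Suc "\<lambda>l. l - 1"])
  show "Suc n \<in> {l. l > 0 \<and> real l \<le> y}" if "n \<in> {..<nat \<lfloor>y\<rfloor>}" for n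
    using that by simp linarith
  show "l - 1 \<in> {..<nat \<lfloor>y\<rfloor>}" if "l \<in> {l. l > 0 \<and> real l \<le> y}" for l
    using that by simp linarith
qed auto

lemma sum_u_coeff:
  assumes a: "a > 0" and c: "c > 0"
  shows "(\<Sum>n | n > 0 \<and> real n \<le> x. u_coeff k a c n) =
    (\<Sum>d<nat \<lfloor>x\<rfloor>. \<Sum>l<nat \<lfloor>x\<rfloor>. if Suc l ^ a * Suc d ^ c \<le> nat \<lfloor>x\<rfloor> then mu k (Suc d) else 0)"
proof -
  define N where "N = nat \<lfloor>x\<rfloor>"
  have le: "l \<le> l ^ a * d ^ c" "d \<le> l ^ a * d ^ c" if "l > 0" "d > 0" for l d :: nat
  proof -
    have "l ^ 1 \<le> l ^ a" "d ^ 1 \<le> d ^ c" using that a c by (intro power_increasing; simp)+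
    then have "l * 1 \<le> l ^ a * d ^ c" "1 * d \<le> l ^ a * d ^ c"
      using that by (intro mult_mono; simp)+
    then show "l \<le> l ^ a * d ^ c" "d \<le> l ^ a * d ^ c" by simp_all
  qed
  have "(\<Sum>n | n > 0 \<and> real n \<le> x. u_coeff k a c n) = (\<Sum>n<N. u_coeff k a c (Suc n))"
    unfolding N_def by (rule sum_upto_floor)
  also have "\<dots> = (\<Sum>n<N. \<Sum>(l, d)\<in>{..<N} \<times> {..<N}. if Suc l ^ a * Suc d ^ c = Suc n then mu k (Suc d) else 0)"
  proof (rule sum.cong[OF refl])
    fix n assume n: "n \<in> {..<N}"
    have "u_coeff k a c (Suc n) = (\<Sum>(l, d) \<in> {x\<in>{..<N} \<times> {..<N}. Suc (fst x) ^ a * Suc (snd x) ^ c = Suc n}. mu k (Suc d))"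
      unfolding u_coeff_def
    proof (rule sum.reindex_bij_witness[of _ "\<lambda>(l, d). (Suc l, Suc d)" "\<lambda>(l, d). (l - 1, d - 1)"])
      fix x assume "x \<in> {(l, d). 0 < l \<and> 0 < d \<and> l ^ a * d ^ c = Suc n}"
      then obtain l d where x: "x = (l, d)" "l > 0" "d > 0" "l ^ a * d ^ c = Suc n" by auto
      then have "l \<le> Suc n" "d \<le> Suc n" using le[of l d] by auto
      then show "(case x of (l, d) \<Rightarrow> (l - 1, d - 1)) \<in> {x \<in> {..<N} \<times> {..<N}. Suc (fst x) ^ a * Suc (snd x) ^ c = Suc n}"
        using x n by auto
    qed auto
    also have "\<dots> = (\<Sum>x\<in>{..<N} \<times> {..<N}. if Suc (fst x) ^ a * Suc (snd x) ^ c = Suc n then (case x of (l, d) \<Rightarrow> mu k (Suc d)) else 0)"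
      by (rule sum.inter_filter) simp
    also have "\<dots> = (\<Sum>(l, d)\<in>{..<N} \<times> {..<N}. if Suc l ^ a * Suc d ^ c = Suc n then mu k (Suc d) else 0)"
      by (intro sum.cong) auto
    finally show "u_coeff k a c (Suc n) = (\<Sum>(l, d)\<in>{..<N} \<times> {..<N}. if Suc l ^ a * Suc d ^ c = Suc n then mu k (Suc d) else 0)"
      .
  qed
  also have "\<dots> = (\<Sum>(l, d)\<in>{..<N} \<times> {..<N}. \<Sum>n<N. if Suc l ^ a * Suc d ^ c = Suc n then mu k (Suc d) else 0)"
    by (subst sum.swap) (simp add: case_prod_unfold)
  also have "\<dots> = (\<Sum>(l, d)\<in>{..<N} \<times> {..<N}. if Suc l ^ a * Suc d ^ c \<le> N then mu k (Suc d) else 0)"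
  proof (intro sum.cong refl, clarify)
    fix l d
    \<comment> \<open>The product is positive, so it equals \<open>Suc n\<close> for n = q only, and
      q < N says that it is at most N.\<close>
    define q where "q = Suc l ^ a * Suc d ^ c - 1"
    have q: "Suc l ^ a * Suc d ^ c = Suc q" by (simp add: q_def)
    show "(\<Sum>n<N. if Suc l ^ a * Suc d ^ c = Suc n then mu k (Suc d) else 0) = (if Suc l ^ a * Suc d ^ c \<le> N then mu k (Suc d) else 0)"
      unfolding q by (auto simp: Suc_le_eq)
  qed
  also have "\<dots> = (\<Sum>d<N. \<Sum>l<N. if Suc l ^ a * Suc d ^ c \<le> N then mu k (Suc d) else 0)"
    by (subst sum.swap) (simp add: sum.cartesian_product)
  finally show ?thesis by (simp add: N_def)
qed

text \<open>The integers l \<ge> 1 with l^a d^c \<le> x are those up to an a-th root. The root is at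
  most x, so the range of summation cuts nothing off.\<close>

lemma count_powers:
  fixes x v :: real
  assumes a: "a > 0" and x: "x \<ge> 1"
  shows "(\<Sum>l<nat \<lfloor>x\<rfloor>. if Suc l ^ a * Suc d ^ c \<le> nat \<lfloor>x\<rfloor> then v else 0) =
    v * of_int \<lfloor>(x / real (Suc d) ^ c) powr (1 / real a)\<rfloor>"
proof -
  define z where "z = (x / real (Suc d) ^ c) powr (1 / real a)"
  have z0: "z \<ge> 0" by (simp add: z_def)
  have D: "real (Suc d) ^ c \<ge> 1" by simp
  have zx: "z \<le> x"
  proof -
    have "z \<le> x powr (1 / real a)"
      unfolding z_def using x D by (intro powr_mono2) (auto simp: divide_le_eq mult_left_le)
    also have "\<dots> \<le> x powr 1" using x a by (intro powr_mono) (auto simp: divide_le_eq)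
    finally show ?thesis using x by simp
  qed
  have iff: "Suc l ^ a * Suc d ^ c \<le> nat \<lfloor>x\<rfloor> \<longleftrightarrow> real (Suc l) \<le> z" for l
  proof -
    have "Suc l ^ a * Suc d ^ c \<le> nat \<lfloor>x\<rfloor> \<longleftrightarrow> real (Suc l ^ a * Suc d ^ c) \<le> x"
      using x by (simp only: le_nat_iff le_floor_iff) (simp add: le_nat_floor nat_le_real_less of_nat_le_iff)
    also have "\<dots> \<longleftrightarrow> real (Suc l) ^ a \<le> x / real (Suc d) ^ c"
      using D by (simp add: pos_le_divide_eq del: of_nat_Suc)
    also have "\<dots> \<longleftrightarrow> (real (Suc l) ^ a) powr (1 / real a) \<le> z"
    proof
      assume "real (Suc l) ^ a \<le> x / real (Suc d) ^ c"
      then show "(real (Suc l) ^ a) powr (1 / real a) \<le> z"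
        unfolding z_def by (intro powr_mono2) auto
    next
      assume *: "(real (Suc l) ^ a) powr (1 / real a) \<le> z"
      show "real (Suc l) ^ a \<le> x / real (Suc d) ^ c"
      proof (rule ccontr)
        assume "\<not> ?thesis"
        then have "z < (real (Suc l) ^ a) powr (1 / real a)"
          unfolding z_def using x a by (intro powr_less_mono2) auto
        with * show False by simp
      qed
    qed
    also have "(real (Suc l) ^ a) powr (1 / real a) = real (Suc l)"
      using a by (subst powr_realpow [symmetric]) (auto simp: powr_powr simp del: of_nat_Suc)
    finally show ?thesis .
  qed
  have "(\<Sum>l<nat \<lfloor>x\<rfloor>. if Suc l ^ a * Suc d ^ c \<le> nat \<lfloor>x\<rfloor> then v else 0) =
      (\<Sum>l | l \<in> {..<nat \<lfloor>x\<rfloor>} \<and> real (Suc l) \<le> z. v)"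
    unfolding iff by (rule sum.inter_filter [symmetric]) simp
  also have "{l. l \<in> {..<nat \<lfloor>x\<rfloor>} \<and> real (Suc l) \<le> z} = {..<nat \<lfloor>z\<rfloor>}"
  proof (intro set_eqI iffI)
    fix l assume "l \<in> {..<nat \<lfloor>z\<rfloor>}"
    then have "real (Suc l) \<le> z" using z0 by simp linarith
    then show "l \<in> {l. l \<in> {..<nat \<lfloor>x\<rfloor>} \<and> real (Suc l) \<le> z}" using zx by simp linarith
  next
    fix l assume "l \<in> {l. l \<in> {..<nat \<lfloor>x\<rfloor>} \<and> real (Suc l) \<le> z}"
    then show "l \<in> {..<nat \<lfloor>z\<rfloor>}" by simp linarith
  qed
  also have "(\<Sum>l<nat \<lfloor>z\<rfloor>. v) = v * of_int \<lfloor>z\<rfloor>" using z0 by (simp add: mult.commute)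
  finally show ?thesis unfolding z_def .
qed


lemma zeta_of_real:
  assumes "r > 1"
  shows "zeta (of_real r) = of_real (Re (zeta (of_real r)))"
proof -
  have "(\<lambda>n. 1 / of_nat (Suc n) powr complex_of_real r) sums zeta (of_real r)"
    using assms by (intro zeta_sums) simp
  then have "(\<lambda>n. Im (1 / of_nat (Suc n) powr complex_of_real r)) sums Im (zeta (of_real r))"
    by (simp only: sums_complex_iff)
  moreover have "Im (1 / of_nat (Suc n) powr complex_of_real r) = 0" for n
    using powr_of_real[of "real (Suc n)" r] by (simp del: of_nat_Suc)
  ultimately have "Im (zeta (of_real r)) = 0"
    using sums_unique2[OF sums_zero, of "Im (zeta (of_real r))"] by simp
  then show ?thesis by (simp add: complex_eq_iff)
qed

lemma mu_tail_of_real: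
  assumes "r > 1"
  shows "mu_tail k M (of_real r) =
    of_real (1 / Re (zeta (of_real r)) ^ k - (\<Sum>d<M. mu k (Suc d) * real (Suc d) powr (- r)))"
proof -
  have "zeta_inv (of_real r) = 1 / zeta (of_real r)"
    using assms by (intro zeta_inv_eq) (auto simp: of_real_eq_1_iff)
  also have "\<dots> = of_real (1 / Re (zeta (of_real r)))"
    by (subst zeta_of_real[OF assms]) simp
  finally have "zeta_inv (of_real r) ^ k = of_real (1 / Re (zeta (of_real r)) ^ k)"
    by (simp add: power_one_over)
  moreover have "of_nat (Suc n) powr (- complex_of_real r) = of_real (real (Suc n) powr (- r))" for n
    using powr_of_real[of "real (Suc n)" "- r"] by (simp del: of_nat_Suc)
  ultimately show ?thesis by (simp add: mu_tail_def del: of_nat_Suc)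
qed

text \<open>An exact identity. Replacing each floor by \<open>t - sawtooth t - 1 / 2\<close>, the
  terms t merge with the main term of \<open>Delta\<close> into the \<open>mu_tail\<close> term, and
  the halves give the last sum.\<close>

lemma Delta_decomposition:
  assumes a: "a > 0" and ac: "a < c" and x: "x \<ge> 1" and y: "0 \<le> y" "y \<le> x"
  shows "Delta k a c x + (\<Sum>l | l > 0 \<and> real l \<le> y. mu k l * sawtooth ((x / real l ^ c) powr (1 / real a))) =
    tail_sum k a c (nat \<lfloor>y\<rfloor>) (nat \<lfloor>x\<rfloor>)
     - x powr (1 / real a) * Re (mu_tail k (nat \<lfloor>y\<rfloor>) (of_real (real c / real a)))
     - (\<Sum>d<nat \<lfloor>y\<rfloor>. mu k (Suc d)) / 2"
proof -
  define N where "N = nat \<lfloor>x\<rfloor>"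
  define M where "M = nat \<lfloor>y\<rfloor>"
  have MN: "M \<le> N" unfolding M_def N_def using y by (intro nat_mono floor_mono)
  define z where "z = (\<lambda>d. (x / real (Suc d) ^ c) powr (1 / real a))"
  define X where "X = x powr (1 / real a)"
  have z: "z d = X * real (Suc d) powr (- (real c / real a))" for d
  proof -
    have "z d = X / (real (Suc d) ^ c) powr (1 / real a)"
      unfolding z_def X_def by (rule powr_divide)
    also have "(real (Suc d) ^ c) powr (1 / real a) = real (Suc d) powr (real c / real a)"
      by (subst powr_realpow [symmetric]) (auto simp: powr_powr simp del: of_nat_Suc)
    finally show ?thesis by (simp add: powr_minus divide_inverse del: of_nat_Suc)
  qed
  have fl: "of_int \<lfloor>t\<rfloor> = t - sawtooth t - 1 / 2" for t :: real
    by (simp add: sawtooth_def frac_def)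
  have "(\<Sum>n | n > 0 \<and> real n \<le> x. u_coeff k a c n) =
      (\<Sum>d<N. \<Sum>l<N. if Suc l ^ a * Suc d ^ c \<le> N then mu k (Suc d) else 0)"
    unfolding N_def using a ac by (intro sum_u_coeff) auto
  also have "\<dots> = (\<Sum>d<N. if d < M then mu k (Suc d) * of_int \<lfloor>z d\<rfloor> else 0) +
      (\<Sum>d<N. \<Sum>l<N. if Suc l ^ a * Suc d ^ c \<le> N \<and> M \<le> d then mu k (Suc d) else 0)"
    unfolding sum.distrib [symmetric] N_def z_def
    by (intro sum.cong) (auto simp: count_powers[OF a x] simp del: of_nat_Suc)
  also have "(\<Sum>d<N. if d < M then mu k (Suc d) * of_int \<lfloor>z d\<rfloor> else 0) = (\<Sum>d<M. mu k (Suc d) * of_int \<lfloor>z d\<rfloor>)"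
    using MN by (intro sum.mono_neutral_cong_right) auto
  also have "(\<Sum>d<N. \<Sum>l<N. if Suc l ^ a * Suc d ^ c \<le> N \<and> M \<le> d then mu k (Suc d) else 0) = tail_sum k a c M N"
    unfolding tail_sum_def by (rule sum.swap)
  also have "(\<Sum>d<M. mu k (Suc d) * of_int \<lfloor>z d\<rfloor>) =
      X * (\<Sum>d<M. mu k (Suc d) * real (Suc d) powr (- (real c / real a)))
      - (\<Sum>d<M. mu k (Suc d) * sawtooth (z d)) - (\<Sum>d<M. mu k (Suc d)) / 2"
    unfolding fl
    by (simp add: z algebra_simps sum_subtractf sum.distrib sum_distrib_left sum_divide_distrib del: of_nat_Suc)
  finally have *: "(\<Sum>n | n > 0 \<and> real n \<le> x. u_coeff k a c n) =
      X * (\<Sum>d<M. mu k (Suc d) * real (Suc d) powr (- (real c / real a)))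
      - (\<Sum>d<M. mu k (Suc d) * sawtooth (z d)) - (\<Sum>d<M. mu k (Suc d)) / 2 + tail_sum k a c M N" .
  have "real c / real a > 1" using a ac by simp
  then have "Re (mu_tail k M (of_real (real c / real a))) = 1 / Re (zeta (of_real (real c / real a))) ^ k
      - (\<Sum>d<M. mu k (Suc d) * real (Suc d) powr (- (real c / real a)))"
    by (simp only: mu_tail_of_real Re_complex_of_real)
  moreover have "(\<Sum>l | l > 0 \<and> real l \<le> y. mu k l * sawtooth ((x / real l ^ c) powr (1 / real a))) =
      (\<Sum>d<M. mu k (Suc d) * sawtooth (z d))"
    unfolding M_def z_def by (rule sum_upto_floor)
  ultimately show ?thesis
    unfolding Delta_def * N_def [symmetric] M_def [symmetric] X_def [symmetric]
    by (simp only: right_diff_distrib times_divide_eq_right mult_1_right)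
qed

theorem theorem2:
  fixes a c k :: nat and \<epsilon> :: real
  assumes "Riemann_Hypothesis" and "a > 0" and "a < c" and "k > 0" and "\<epsilon> > 0"
  shows "\<exists>C. \<forall>x y :: real. x \<ge> 2 \<and> 1 \<le> y \<and> y < x powr (1 / real c) \<longrightarrow>
           \<bar>Delta k a c x - (- (\<Sum>l | l > 0 \<and> real l \<le> y. mu k l * sawtooth ((x / real l ^ c) powr (1 / real a))))\<bar>
             \<le> C * (x powr (1 / (2 * real a) + \<epsilon>) * y powr (1 / 2 - real c / (2 * real a)) + y powr (1 / 2 + \<epsilon>))"
proof -
  note RH = assms(1) and a = assms(2) and ac = assms(3)
  define r where "r = real c / real a"
  define q where "q = r / 2 - 1/2"
  have r: "r > 1" using a ac by (simp add: r_def)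
  then have q: "q > 0" by (simp add: q_def)
  have q_eq: "1/2 - real c / (2 * real a) = - q" by (simp add: q_def r_def)
  \<comment> \<open>At most 3 \<delta> is lost in any exponent; 1/(8a) keeps the line of integration
    left of the pole at 1/a.\<close>
  define \<delta> where "\<delta> = min (\<epsilon> / 3) (1 / (8 * real a))"
  have \<delta>: "0 < \<delta>" "\<delta> \<le> 1 / (8 * real a)" "3 * \<delta> \<le> \<epsilon>" using assms by (auto simp: \<delta>_def)
  have "1 / (8 * real a) \<le> 1/8" using a by (simp add: field_simps)
  then have \<delta>1: "\<delta> \<le> 1/8" using \<delta> by linarith
  obtain C1 where C1: "C1 \<ge> 0" "\<And>M N. M > 0 \<Longrightarrow> N > 0 \<Longrightarrow>
     norm (of_real (tail_sum k a c M N) - mu_tail k M (of_nat c / of_nat a) * perron_kernel N (1 / of_nat a)) \<le>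
       C1 * (real N powr (1 / (2 * real a) + 3 * \<delta>) * real M powr (- q))"
    using tail_sum_estimate[OF RH a ac \<delta>(1,2), of k] unfolding q_eq by blast
  obtain C2 where C2: "C2 \<ge> 0" "\<And>N. N > 0 \<Longrightarrow> \<bar>\<Sum>n<N. mu k (Suc n)\<bar> \<le> C2 * real N powr (1/2 + 2 * \<delta>)"
    using mu_sum_bound[OF RH \<delta>(1), of k] \<delta>1 by auto
  obtain C3 where C3: "C3 \<ge> 0" "\<And>N s. N > 0 \<Longrightarrow> 1/2 + 2 * \<delta> \<le> Re s \<Longrightarrow> Re s \<le> r \<Longrightarrow>
     norm (mu_tail k N s) \<le> C3 * (1 + \<bar>Im s\<bar>) powr (\<delta>/4) * real N powr (1/2 + 2 * \<delta> - Re s)"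
    using mu_tail_bound[OF RH \<delta>(1), of r k] \<delta>1 by auto
  define C where "C = C1 * 2 powr q + C2 + C3"
  have "\<bar>Delta k a c x - (- (\<Sum>l | l > 0 \<and> real l \<le> y. mu k l * sawtooth ((x / real l ^ c) powr (1 / real a))))\<bar>
       \<le> C * (x powr (1 / (2 * real a) + \<epsilon>) * y powr (1 / 2 - real c / (2 * real a)) + y powr (1 / 2 + \<epsilon>))"
    if x: "x \<ge> 2" and y: "1 \<le> y" "y < x powr (1 / real c)" for x y
  proof -
    define N where "N = nat \<lfloor>x\<rfloor>"
    define M where "M = nat \<lfloor>y\<rfloor>"
    define T where "T = tail_sum k a c M N"
    define W where "W = Re (mu_tail k M (of_real r))"
    define S where "S = (\<Sum>d<M. mu k (Suc d))"
    define X where "X = x powr (1 / real a)"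
    define K where "K = perron_kernel N (of_real (1 / real a))"
    have "x powr (1 / real c) \<le> x powr 1" using x a ac by (intro powr_mono) (auto simp: divide_le_eq)
    then have yx: "y \<le> x" using x y by simp
    \<comment> \<open>Since y \<ge> 1, rounding down loses at most a factor 2; for the negative
      power -q this is the factor \<open>2 powr q\<close> in \<open>C\<close>.\<close>
    have M: "M > 0" "real M \<le> y" "y / 2 \<le> real M"
    proof -
      have "1 \<le> \<lfloor>y\<rfloor>" using y by simp
      then have "1 \<le> real_of_int \<lfloor>y\<rfloor>" by linarith
      moreover from \<open>1 \<le> \<lfloor>y\<rfloor>\<close> have "real M = real_of_int \<lfloor>y\<rfloor>" by (simp add: M_def)
      ultimately show "M > 0" "real M \<le> y" "y / 2 \<le> real M"
        by linarith+
    qed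
    have N: "N > 0" "real N \<le> x" "x \<le> real N + 1"
      unfolding N_def using x by (auto simp: le_nat_floor)
    have Wc: "mu_tail k M (of_real r) = of_real W"
      unfolding W_def by (subst mu_tail_of_real[OF r])+ simp
    \<comment> \<open>\<open>W\<close> later multiplies \<open>K - X\<close>, the error of the mean,
      which is at most 1; so it needs no saving in y and goes into the second error term.\<close>
    have Wb: "\<bar>W\<bar> \<le> C3 * y powr (1/2 + \<epsilon>)"
    proof -
      have "\<bar>W\<bar> = norm (mu_tail k M (of_real r))" by (simp add: Wc)
      also have "\<dots> \<le> C3 * real M powr (1/2 + 2 * \<delta> - r)"
        using C3(2)[of M "of_real r"] M r \<delta>1 by simp
      also have "\<dots> \<le> C3 * real M powr (1/2 + \<epsilon>)"
        using C3(1) M r \<delta> by (intro mult_left_mono powr_mono) auto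
      also have "\<dots> \<le> C3 * y powr (1/2 + \<epsilon>)"
        using C3(1) M \<delta> by (intro mult_left_mono powr_mono2) auto
      finally show ?thesis .
    qed
    have Sb: "\<bar>S\<bar> \<le> C2 * y powr (1/2 + \<epsilon>)"
    proof -
      have "\<bar>S\<bar> \<le> C2 * real M powr (1/2 + 2 * \<delta>)" unfolding S_def by (rule C2(2)[OF M(1)])
      also have "\<dots> \<le> C2 * real M powr (1/2 + \<epsilon>)"
        using C2(1) M \<delta> by (intro mult_left_mono powr_mono) auto
      also have "\<dots> \<le> C2 * y powr (1/2 + \<epsilon>)"
        using C2(1) M \<delta> by (intro mult_left_mono powr_mono2) auto
      finally show ?thesis .
    qed
    have Tb: "norm (of_real T - of_real W * K) \<le> C1 * 2 powr q * (x powr (1 / (2 * real a) + \<epsilon>) * y powr (- q))"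
    proof -
      have "norm (of_real T - of_real W * K) \<le> C1 * (real N powr (1 / (2 * real a) + 3 * \<delta>) * real M powr (- q))"
        using C1(2)[OF M(1) N(1)] Wc by (simp add: T_def K_def r_def)
      also have "\<dots> \<le> C1 * (x powr (1 / (2 * real a) + \<epsilon>) * (2 powr q * y powr (- q)))"
      proof (intro mult_left_mono mult_mono C1(1))
        have "real N powr (1 / (2 * real a) + 3 * \<delta>) \<le> x powr (1 / (2 * real a) + 3 * \<delta>)"
          using N \<delta> by (intro powr_mono2) auto
        also have "\<dots> \<le> x powr (1 / (2 * real a) + \<epsilon>)" using x \<delta> by (intro powr_mono) auto
        finally show "real N powr (1 / (2 * real a) + 3 * \<delta>) \<le> x powr (1 / (2 * real a) + \<epsilon>)" .
        have "real M powr (- q) \<le> (y / 2) powr (- q)" using M y q by (intro powr_mono2') auto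
        also have "\<dots> = 2 powr q * y powr (- q)"
          using y by (simp add: powr_divide powr_minus field_simps)
        finally show "real M powr (- q) \<le> 2 powr q * y powr (- q)" .
      qed auto
      finally show ?thesis by (simp only: mult_ac)
    qed
    have Kb: "norm (K - of_real X) \<le> 1"
      unfolding K_def X_def using a N by (intro perron_kernel_close_to_powr) (auto simp: divide_le_eq)
    have "\<bar>T - W * X\<bar> = norm ((of_real T - of_real W * K) + of_real W * (K - of_real X))"
      by (subst norm_of_real [symmetric, where 'a = complex]) (simp add: algebra_simps)
    also have "\<dots> \<le> norm (of_real T - of_real W * K) + \<bar>W\<bar> * norm (K - of_real X)"
      by (intro order_trans[OF norm_triangle_ineq]) (simp add: norm_mult)
    also have "\<bar>W\<bar> * norm (K - of_real X) \<le> \<bar>W\<bar> * 1" using Kb by (intro mult_left_mono) auto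
    finally have TW: "\<bar>T - W * X\<bar> \<le> C1 * 2 powr q * (x powr (1 / (2 * real a) + \<epsilon>) * y powr (- q)) + C3 * y powr (1/2 + \<epsilon>)"
      using Tb Wb by linarith
    have "Delta k a c x - (- (\<Sum>l | l > 0 \<and> real l \<le> y. mu k l * sawtooth ((x / real l ^ c) powr (1 / real a))))
        = T - W * X - S / 2"
      using Delta_decomposition[OF a ac, of x y k] x y yx
      by (simp add: T_def W_def X_def S_def M_def N_def r_def mult.commute)
    then have "\<bar>Delta k a c x - (- (\<Sum>l | l > 0 \<and> real l \<le> y. mu k l * sawtooth ((x / real l ^ c) powr (1 / real a))))\<bar>
        \<le> \<bar>T - W * X\<bar> + \<bar>S\<bar>" by simp
    also have "\<dots> \<le> C1 * 2 powr q * (x powr (1 / (2 * real a) + \<epsilon>) * y powr (- q)) + (C2 + C3) * y powr (1/2 + \<epsilon>)"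
      using TW Sb by (simp add: algebra_simps)
    also have "\<dots> \<le> C * (x powr (1 / (2 * real a) + \<epsilon>) * y powr (- q)) + C * y powr (1/2 + \<epsilon>)"
      unfolding C_def using C1(1) C2(1) C3(1) by (intro add_mono mult_right_mono) auto
    finally show ?thesis unfolding q_eq by (simp only: distrib_left)
  qed
  then show ?thesis by blast
qed

end
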